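(* Let $X$ be a connected complex manifold of complex dimension $n$, let $g$ be a $C^\infty$ Hermitian metric in $X$, and let $L$ be a holomorphic line bundle on $X$. If $X$ is noncompact or $L=[D]$ is the holomorphic line bundle associated to a nontrivial effective divisor $D$ in $X$ (i.e. $L$ is a holomorphic line bundle which admits a nontrivial global holomorphic section), then $L$ admits a $C^\infty$ Hermitian metric $h$ with positive scalar curvature (that is, $\mathcal R_h>0$ on $X$, where $\mathcal R_h$ is the scalar curvature of $h$ with respect to $g$).
   Context: The Levi form of a $C^2$ function $\varphi$ on $X$ is the Hermitian tensor given in local holomorphic coordinates $(z_1,\dots,z_n)$ by $$\mathcal L(\varphi)=\sum_{i,j=1}^n\frac{\partial^2\varphi}{\partial z_i\partial\bar z_j}\,dz_i\,d\bar z_j.$$ The Laplace operator $\Delta_g$ for the Hermitian metric $g$ is given by the trace of the Levi form: $$\Delta_g=\sum_{i,j} g^{i\bar j}\frac{\partial^2}{\partial z_i\partial\bar z_j},\qquad (g^{i\bar j})=\overline{(g_{i\bar j})^{-1}}.$$ For a $C^2$ Hermitian metric $h$ in a holomorphic line bundle $L$ on $X$, the curvature of $h$ is the Hermitian tensor $\Theta_h=\mathcal L(-\log|s|_h^2)$ for any nonvanishing local holomorphic section $s$ of $L$, and the scalar curvature $\mathcal R_h$ of $h$ with respect to $g$ is the trace of the curvature; that is, locally, $$\mathcal R_h=\Delta_g(-\log|s|_h^2).$$ *)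

theory Defs
  imports "HOL-Analysis.Analysis"
begin

section \<open>Calculus on open subsets of complex coordinate space\<close>

text \<open>All notions in this section are meant for \<^emph>\<open>open\<close> sets \<open>S\<close>; derivatives are full
  Frechet derivatives at interior points.\<close>

definition hol_on :: "(complex ^ 'n) set \<Rightarrow> (complex ^ 'n \<Rightarrow> complex) \<Rightarrow> bool" where
  "hol_on S f \<longleftrightarrow>
     (\<forall>z\<in>S. \<exists>f'. (f has_derivative f') (at z) \<and> (\<forall>a v. f' (a *s v) = a * f' v))"

fun Ck_on :: "nat \<Rightarrow> 'a set \<Rightarrow> ('a::real_normed_vector \<Rightarrow> 'b::real_normed_vector) \<Rightarrow> bool" where
  "Ck_on 0 S f \<longleftrightarrow> continuous_on S f"
| "Ck_on (Suc k) S f \<longleftrightarrow>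
     (\<forall>x\<in>S. f differentiable (at x)) \<and> (\<forall>v. Ck_on k S (\<lambda>x. frechet_derivative f (at x) v))"

definition smooth_on :: "'a set \<Rightarrow> ('a::real_normed_vector \<Rightarrow> 'b::real_normed_vector) \<Rightarrow> bool" where
  "smooth_on S f \<longleftrightarrow> (\<forall>k. Ck_on k S f)"

text \<open>The Wirtinger operators
  \<open>\<partial>/\<partial>z\<^sub>i = (\<partial>/\<partial>x\<^sub>i - \<i> \<partial>/\<partial>y\<^sub>i)/2\<close> and
  \<open>\<partial>/\<partial>(cnj z\<^sub>i) = (\<partial>/\<partial>x\<^sub>i + \<i> \<partial>/\<partial>y\<^sub>i)/2\<close>; the real directions
  \<open>x\<^sub>i\<close>, \<open>y\<^sub>i\<close> are \<open>axis i 1\<close> and \<open>axis i \<i>\<close>.\<close>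

definition d_z :: "'n \<Rightarrow> (complex ^ 'n::finite \<Rightarrow> complex) \<Rightarrow> complex ^ 'n \<Rightarrow> complex" where
  "d_z i f z = (frechet_derivative f (at z) (axis i 1)
                 - \<i> * frechet_derivative f (at z) (axis i \<i>)) / 2"

definition d_zbar :: "'n \<Rightarrow> (complex ^ 'n::finite \<Rightarrow> complex) \<Rightarrow> complex ^ 'n \<Rightarrow> complex" where
  "d_zbar i f z = (frechet_derivative f (at z) (axis i 1)
                    + \<i> * frechet_derivative f (at z) (axis i \<i>)) / 2"


section \<open>Complex manifolds\<close>

text \<open>The underlying space is a whole type \<open>'a\<close>, Hausdorff and second countable by its type
  classes. The dimension is \<open>CARD('n)\<close>. A chart is its domain together with the coordinate map,
  whose values off the domain are irrelevant.\<close>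

type_synonym ('a, 'n) chart = "'a set \<times> ('a \<Rightarrow> complex ^ 'n)"

definition in_chart :: "('a, 'n) chart \<Rightarrow> ('a \<Rightarrow> 'b) \<Rightarrow> complex ^ 'n \<Rightarrow> 'b" where
  "in_chart c f = (\<lambda>z. f (inv_into (fst c) (snd c) z))"

definition complex_manifold ::
    "('a::{t2_space, second_countable_topology}, 'n::finite) chart set \<Rightarrow> bool" where
  "complex_manifold A \<longleftrightarrow>
     (\<Union>c\<in>A. fst c) = UNIV \<and>
     (\<forall>c\<in>A. open (fst c) \<and> open (snd c ` fst c) \<and>
        (\<exists>\<psi>. homeomorphism (fst c) (snd c ` fst c) (snd c) \<psi>)) \<and>
     (\<forall>c\<in>A. \<forall>d\<in>A. \<forall>k. hol_on (snd c ` (fst c \<inter> fst d)) (in_chart c (\<lambda>p. snd d p $ k)))"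

definition holomorphic_fun :: "('a, 'n::finite) chart set \<Rightarrow> 'a set \<Rightarrow> ('a \<Rightarrow> complex) \<Rightarrow> bool" where
  "holomorphic_fun A W f \<longleftrightarrow> (\<forall>c\<in>A. hol_on (snd c ` (W \<inter> fst c)) (in_chart c f))"

definition smooth_fun ::
    "('a, 'n::finite) chart set \<Rightarrow> 'a set \<Rightarrow> ('a \<Rightarrow> 'b::real_normed_vector) \<Rightarrow> bool" where
  "smooth_fun A W f \<longleftrightarrow> (\<forall>c\<in>A. smooth_on (snd c ` (W \<inter> fst c)) (in_chart c f))"


section \<open>Hermitian tensors, Levi form and Laplace operator\<close>

text \<open>A Hermitian tensor \<open>\<Sum> g\<^sub>i\<^sub>j dz\<^sub>i d(cnj z\<^sub>j)\<close> is given by its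
  component matrix \<open>g c p\<close> at each point \<open>p\<close> of each chart \<open>c\<close>. The last clause below is the
  transformation law of these components, \<open>d_z i (in_chart c (\<lambda>q. snd d q $ k))\<close> being the
  \<open>(k,i)\<close> entry of the holomorphic Jacobian of the coordinate change from \<open>c\<close> to \<open>d\<close>.\<close>

type_synonym ('a, 'n) tensor = "('a, 'n) chart \<Rightarrow> 'a \<Rightarrow> complex ^ 'n ^ 'n"

definition hermitian_metric ::
    "('a, 'n::finite) chart set \<Rightarrow> ('a, 'n) tensor \<Rightarrow> bool" where
  "hermitian_metric A g \<longleftrightarrow>
     (\<forall>c\<in>A.
        (\<forall>i j. smooth_on (snd c ` fst c) (in_chart c (\<lambda>p. g c p $ i $ j))) \<and>
        (\<forall>p\<in>fst c.
           (\<forall>i j. g c p $ j $ i = cnj (g c p $ i $ j)) \<and>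
           (\<forall>v. v \<noteq> 0 \<longrightarrow> 0 < Re (\<Sum>i\<in>UNIV. \<Sum>j\<in>UNIV. g c p $ i $ j * (v $ i) * cnj (v $ j)))) \<and>
        (\<forall>d\<in>A. \<forall>p\<in>fst c \<inter> fst d. \<forall>i j.
           g c p $ i $ j =
             (\<Sum>k\<in>UNIV. \<Sum>l\<in>UNIV. g d p $ k $ l
                * d_z i (in_chart c (\<lambda>q. snd d q $ k)) (snd c p)
                * cnj (d_z j (in_chart c (\<lambda>q. snd d q $ l)) (snd c p)))))"

definition levi_form :: "('a \<Rightarrow> real) \<Rightarrow> ('a, 'n::finite) tensor" where
  "levi_form \<phi> c p =
     (\<chi> i j. d_z i (d_zbar j (in_chart c (\<lambda>q. complex_of_real (\<phi> q)))) (snd c p))"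

text \<open>\<open>\<Sum> g\<^sup>i\<^sup>j H\<^sub>i\<^sub>j\<close> with \<open>(g\<^sup>i\<^sup>j)\<close> the conjugate of the inverse matrix.
  The sum is real for Hermitian \<open>G\<close> and \<open>H\<close>, so \<open>Re\<close> only changes the type.\<close>

definition herm_trace :: "complex ^ 'n ^ 'n \<Rightarrow> complex ^ 'n ^ 'n::finite \<Rightarrow> real" where
  "herm_trace G H = Re (\<Sum>i\<in>UNIV. \<Sum>j\<in>UNIV. cnj (matrix_inv G $ i $ j) * H $ i $ j)"

definition laplacian ::
    "('a, 'n::finite) tensor \<Rightarrow> ('a \<Rightarrow> real) \<Rightarrow> ('a, 'n) chart \<Rightarrow> 'a \<Rightarrow> real" where
  "laplacian g \<phi> c p = herm_trace (g c p) (levi_form \<phi> c p)"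


section \<open>Holomorphic line bundles\<close>

text \<open>The total space is a type \<open>'e\<close> with projection \<open>\<pi>\<close>. A local trivialization over \<open>U\<close> is
  \<open>e \<mapsto> (\<pi> e, t e)\<close>, recorded as \<open>(U, t)\<close>. Changes of trivialization are
  multiplication by nowhere zero holomorphic functions, so the trivializations determine the
  vector space structure of the fibres and the topology and complex structure of \<open>'e\<close>.\<close>

type_synonym ('a, 'e) triv = "'a set \<times> ('e \<Rightarrow> complex)"

definition holomorphic_line_bundle ::
    "('a::topological_space, 'n::finite) chart set \<Rightarrow> ('e \<Rightarrow> 'a) \<Rightarrow> ('a, 'e) triv set \<Rightarrow> bool" where
  "holomorphic_line_bundle A \<pi> T \<longleftrightarrow>
     (\<Union>(U, t)\<in>T. U) = UNIV \<and>
     (\<forall>(U, t)\<in>T. open U \<and> bij_betw (\<lambda>e. (\<pi> e, t e)) (\<pi> -` U) (U \<times> UNIV)) \<and>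
     (\<forall>(U, t)\<in>T. \<forall>(V, u)\<in>T. \<exists>\<tau>. holomorphic_fun A (U \<inter> V) \<tau> \<and>
        (\<forall>p\<in>U \<inter> V. \<tau> p \<noteq> 0) \<and> (\<forall>e. \<pi> e \<in> U \<inter> V \<longrightarrow> t e = \<tau> (\<pi> e) * u e))"

definition holomorphic_section ::
    "('a, 'n::finite) chart set \<Rightarrow> ('e \<Rightarrow> 'a) \<Rightarrow> ('a, 'e) triv set \<Rightarrow> 'a set \<Rightarrow> ('a \<Rightarrow> 'e) \<Rightarrow> bool" where
  "holomorphic_section A \<pi> T W s \<longleftrightarrow>
     (\<forall>p\<in>W. \<pi> (s p) = p) \<and>
     (\<forall>(U, t)\<in>T. holomorphic_fun A (W \<inter> U) (\<lambda>p. t (s p)))"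

definition nonvanishing_on :: "('a, 'e) triv set \<Rightarrow> 'a set \<Rightarrow> ('a \<Rightarrow> 'e) \<Rightarrow> bool" where
  "nonvanishing_on T W s \<longleftrightarrow> (\<forall>(U, t)\<in>T. \<forall>p\<in>W \<inter> U. t (s p) \<noteq> 0)"

lemma holomorphic_fun_cong:
  assumes A: "complex_manifold A" and W: "open W"
    and eq: "\<And>p. p \<in> W \<Longrightarrow> f p = f' p" and hol: "holomorphic_fun A W f"
  shows "holomorphic_fun A W f'"
  unfolding holomorphic_fun_def
proof
  fix c assume c: "c \<in> A"
  let ?S = "snd c ` (W \<inter> fst c)"
  have ch: "\<forall>c\<in>A. open (fst c) \<and> open (snd c ` fst c) \<and>
      (\<exists>\<psi>. homeomorphism (fst c) (snd c ` fst c) (snd c) \<psi>)"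
    using A unfolding complex_manifold_def by (elim conjE)
  from bspec[OF ch c] obtain \<psi> where hom: "homeomorphism (fst c) (snd c ` fst c) (snd c) \<psi>"
    and op: "open (fst c)" "open (snd c ` fst c)"
    by (elim conjE exE)
  have inj: "inj_on (snd c) (fst c)"
    using hom unfolding homeomorphism_def by (metis inj_on_inverseI)
  have "openin (top_of_set (fst c)) (W \<inter> fst c)"
    using openin_open_Int[OF W, of "fst c"] by (simp only: Int_commute)
  hence "openin (top_of_set (snd c ` fst c)) ?S"
    using homeomorphism_imp_open_map[OF hom] by blast
  hence oS: "open ?S"
    using op(2) openin_open_trans by blast
  have agree: "in_chart c f z = in_chart c f' z" if "z \<in> ?S" for z
    using that inj eq by (auto simp: in_chart_def)
  show "hol_on ?S (in_chart c f')"
    unfolding hol_on_def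
  proof
    fix z assume z: "z \<in> ?S"
    then obtain d where d: "(in_chart c f has_derivative d) (at z)" "\<forall>a v. d (a *s v) = a * d v"
      using hol c unfolding holomorphic_fun_def hol_on_def by blast
    have "(in_chart c f' has_derivative d) (at z)"
      using has_derivative_transform_within_open[OF d(1) oS z] agree by blast
    with d(2) show "\<exists>d. (in_chart c f' has_derivative d) (at z) \<and> (\<forall>a v. d (a *s v) = a * d v)"
      by blast
  qed
qed

lemma nonvanishing_holomorphic_section_exists:
  assumes A: "complex_manifold A" and L: "holomorphic_line_bundle A \<pi> T"
  shows "\<exists>W s. p \<in> W \<and> open W \<and> holomorphic_section A \<pi> T W s \<and> nonvanishing_on T W s"
proof -
  note L' = L[unfolded holomorphic_line_bundle_def]
  note cov = conjunct1[OF L'] and triv = conjunct1[OF conjunct2[OF L']]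
    and trans = conjunct2[OF conjunct2[OF L']]
  have "p \<in> (\<Union>(U, t)\<in>T. U)"
    unfolding cov by (rule UNIV_I)
  then obtain U t where Ut: "(U, t) \<in> T" "p \<in> U"
    by auto
  have oU: "open U" and bij: "bij_betw (\<lambda>e. (\<pi> e, t e)) (\<pi> -` U) (U \<times> UNIV)"
    using bspec[OF triv Ut(1)] by simp_all
  define s where "s q = inv_into (\<pi> -` U) (\<lambda>e. (\<pi> e, t e)) (q, 1)" for q
  have s: "\<pi> (s q) = q" "t (s q) = 1" if "q \<in> U" for q
  proof -
    have "(q, 1) \<in> (\<lambda>e. (\<pi> e, t e)) ` (\<pi> -` U)"
      using that bij by (auto simp: bij_betw_def)
    hence "(\<lambda>e. (\<pi> e, t e)) (s q) = (q, 1)"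
      unfolding s_def by (rule f_inv_into_f)
    thus "\<pi> (s q) = q" "t (s q) = 1" by auto
  qed
  have *: "holomorphic_fun A (U \<inter> V) (\<lambda>q. u (s q)) \<and> (\<forall>q\<in>U \<inter> V. u (s q) \<noteq> 0)"
    if Vu: "(V, u) \<in> T" for V u
  proof -
    obtain \<tau> where \<tau>: "holomorphic_fun A (V \<inter> U) \<tau>" "\<forall>q\<in>V \<inter> U. \<tau> q \<noteq> 0"
      "\<forall>e. \<pi> e \<in> V \<inter> U \<longrightarrow> u e = \<tau> (\<pi> e) * t e"
      using bspec[OF bspec[OF trans Vu, unfolded prod.case] Ut(1), unfolded prod.case]
      by (elim exE conjE)
    have eq: "\<tau> q = u (s q)" if "q \<in> V \<inter> U" for q
      using that \<tau>(3) s[of q] by auto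
    have "open V"
      using bspec[OF triv Vu] by simp
    hence "holomorphic_fun A (V \<inter> U) (\<lambda>q. u (s q))"
      using holomorphic_fun_cong[OF A _ eq \<tau>(1)] oU by blast
    thus ?thesis
      using \<tau>(2) eq by (auto simp: Int_commute)
  qed
  have "holomorphic_section A \<pi> T U s" "nonvanishing_on T U s"
    using s * unfolding holomorphic_section_def nonvanishing_on_def by auto
  thus ?thesis using oU Ut(2) by blast
qed

text \<open>A smooth Hermitian metric in the bundle is a Hermitian inner product \<open>h e e'\<close> on each
  fibre, varying smoothly. On a one-dimensional fibre with linear coordinate \<open>t\<close> these are the
  forms \<open>\<rho> t(e) cnj(t(e'))\<close> with \<open>\<rho> > 0\<close>. Values of \<open>h\<close> on points
  of different fibres are irrelevant.\<close>

definition smooth_hermitian_bundle_metric ::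
    "('a, 'n::finite) chart set \<Rightarrow> ('e \<Rightarrow> 'a) \<Rightarrow> ('a, 'e) triv set \<Rightarrow> ('e \<Rightarrow> 'e \<Rightarrow> complex) \<Rightarrow> bool" where
  "smooth_hermitian_bundle_metric A \<pi> T h \<longleftrightarrow>
     (\<forall>(U, t)\<in>T. \<exists>\<rho> :: 'a \<Rightarrow> real. smooth_fun A U \<rho> \<and> (\<forall>p\<in>U. 0 < \<rho> p) \<and>
        (\<forall>e e'. \<pi> e \<in> U \<and> \<pi> e' = \<pi> e \<longrightarrow>
           h e e' = complex_of_real (\<rho> (\<pi> e)) * t e * cnj (t e')))"

definition norm_sq :: "('e \<Rightarrow> 'e \<Rightarrow> complex) \<Rightarrow> 'e \<Rightarrow> real" where
  "norm_sq h e = Re (h e e)"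

text \<open>The curvature tensor, computed from a nonvanishing local holomorphic section \<open>s\<close>.\<close>

definition curvature_form ::
    "('e \<Rightarrow> 'e \<Rightarrow> complex) \<Rightarrow> ('a \<Rightarrow> 'e) \<Rightarrow> ('a, 'n::finite) tensor" where
  "curvature_form h s = levi_form (\<lambda>q. - ln (norm_sq h (s q)))"

text \<open>\<open>R\<close> is the scalar curvature of \<open>h\<close> with respect to \<open>g\<close>: in every chart and for every
  nonvanishing local holomorphic section it is the trace of the curvature. Since such sections
  exist near every point, this determines \<open>R\<close> uniquely.\<close>

definition is_scalar_curvature ::
    "('a::topological_space, 'n::finite) chart set \<Rightarrow> ('a, 'n) tensor \<Rightarrow> ('e \<Rightarrow> 'a) \<Rightarrow> ('a, 'e) triv set
      \<Rightarrow> ('e \<Rightarrow> 'e \<Rightarrow> complex) \<Rightarrow> ('a \<Rightarrow> real) \<Rightarrow> bool" where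
  "is_scalar_curvature A g \<pi> T h R \<longleftrightarrow>
     (\<forall>W s. open W \<and> holomorphic_section A \<pi> T W s \<and> nonvanishing_on T W s \<longrightarrow>
        (\<forall>c\<in>A. \<forall>p\<in>W \<inter> fst c. R p = herm_trace (g c p) (curvature_form h s c p)))"

lemma scalar_curvature_eq_laplacian:
  "herm_trace (g c p) (curvature_form h s c p) = laplacian g (\<lambda>q. - ln (norm_sq h (s q))) c p"
  by (simp add: curvature_form_def laplacian_def)


section \<open>Effective divisors\<close>

text \<open>An effective divisor is given by local defining functions: an open cover with a holomorphic
  function on each member, not identically zero on any nonempty open subset, whose
  quotients on overlaps are nowhere zero holomorphic functions.\<close>

definition effective_divisor ::
    "('a::topological_space, 'n::finite) chart set \<Rightarrow> ('a set \<times> ('a \<Rightarrow> complex)) set \<Rightarrow> bool" where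
  "effective_divisor A D \<longleftrightarrow>
     (\<Union>(U, f)\<in>D. U) = UNIV \<and>
     (\<forall>(U, f)\<in>D. open U \<and> holomorphic_fun A U f \<and>
        (\<forall>V. open V \<and> V \<noteq> {} \<and> V \<subseteq> U \<longrightarrow> (\<exists>p\<in>V. f p \<noteq> 0))) \<and>
     (\<forall>(U, f)\<in>D. \<forall>(V, k)\<in>D. \<exists>\<tau>. holomorphic_fun A (U \<inter> V) \<tau> \<and>
        (\<forall>p\<in>U \<inter> V. \<tau> p \<noteq> 0 \<and> f p = \<tau> p * k p))"

text \<open>The divisor is zero iff all its local defining functions are units.\<close>

definition nontrivial_divisor :: "('a set \<times> ('a \<Rightarrow> complex)) set \<Rightarrow> bool" where
  "nontrivial_divisor D \<longleftrightarrow> (\<exists>(U, f)\<in>D. \<exists>p\<in>U. f p = 0)"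

text \<open>The bundle is \<open>[D]\<close>, up to isomorphism: it has holomorphic trivializations \<open>F (U, f)\<close> over the
  sets \<open>U\<close> (compatible with the given ones) whose transition functions are the quotients
  \<open>f/k\<close> of the local defining functions.\<close>

definition is_bundle_of_divisor ::
    "('a::topological_space, 'n::finite) chart set \<Rightarrow> ('e \<Rightarrow> 'a) \<Rightarrow> ('a, 'e) triv set
      \<Rightarrow> ('a set \<times> ('a \<Rightarrow> complex)) set \<Rightarrow> bool" where
  "is_bundle_of_divisor A \<pi> T D \<longleftrightarrow>
     (\<exists>F. holomorphic_line_bundle A \<pi> (T \<union> (\<lambda>(U, f). (U, F (U, f))) ` D) \<and>
        (\<forall>(U, f)\<in>D. \<forall>(V, k)\<in>D. \<exists>\<tau>. holomorphic_fun A (U \<inter> V) \<tau> \<and>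
           (\<forall>p\<in>U \<inter> V. \<tau> p \<noteq> 0 \<and> f p = \<tau> p * k p) \<and>
           (\<forall>e. \<pi> e \<in> U \<inter> V \<longrightarrow> F (U, f) e = \<tau> (\<pi> e) * F (V, k) e)))"

end

theory Submission
  imports Defs "HOL-Complex_Analysis.Cauchy_Integral_Formula"
begin

text \<open>
  If \<open>h\<^sub>0\<close> is any smooth Hermitian metric in the bundle, then \<open>h\<^sub>0 exp (- \<phi>)\<close> has scalar curvature
  \<open>R\<^sub>0 + \<Delta> \<phi>\<close>, where \<open>R\<^sub>0\<close> is that of \<open>h\<^sub>0\<close>. So it suffices to have some \<open>h\<^sub>0\<close> (\<open>weights_exist\<close>)
  and a smooth real function \<open>\<phi>\<close> with \<open>\<Delta> \<phi> > - R\<^sub>0\<close>.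

  The building block is the bump \<open>exp (- a / (r\<^sup>2 - \<bar>z\<bar>\<^sup>2))\<close> on a coordinate ball, continued by \<open>0\<close>. For
  large \<open>a\<close> its Laplacian is negative at most in an arbitrarily small ball around the centre
  (\<open>bump\<close>). The negative part of one bump can be outweighed by a large multiple of a second bump
  whose own negative part lies elsewhere. Adding bumps along a chain of balls therefore produces,
  inside any connected open set, a compactly supported function whose Laplacian is positive near
  a given point \<open>x\<close> and negative only near another given point \<open>y\<close>. The relation \<open>reach\<close> expresses
  this; it is transitive and holds locally, so connectedness gives it globally
  (\<open>reach_connected\<close>).

  On a noncompact connected manifold the negative part is pushed to infinity. There is an
  exhaustion by compact sets \<open>E\<^sub>k\<close> such that no component of the complement of \<open>E\<^sub>k\<close> is relatively
  compact (\<open>filled_hull\<close>). A function that solves the inequality on \<open>E\<^sub>k\<close> is changed only off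
  \<open>E\<^sub>k\<close> so that it solves the inequality on \<open>E\<^sub>k\<^sub>+\<^sub>1\<close>: the error region is covered by functions
  whose Laplacians are negative only beyond \<open>E\<^sub>k\<^sub>+\<^sub>1\<close> (\<open>extend_potential\<close>). The successive functions stabilize on
  each \<open>E\<^sub>k\<close>, and their limit is \<open>\<phi>\<close> (\<open>noncompact_potential\<close>).

  On a compact manifold the negative part cannot disappear, since no function has
  positive Laplacian everywhere. Here the section \<open>s\<close> of \<open>[D]\<close> enters through \<open>S = \<bar>s\<bar>\<^sup>2\<close>, which vanishes
  exactly on \<open>D\<close> and satisfies \<open>\<Delta> (- ln S) = R\<^sub>0\<close> off \<open>D\<close>. First choose the metric such that the
  curvature is negative only near a point \<open>q \<notin> D\<close>, and choose a function \<open>\<psi>\<close> whose Laplacian is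
  negative only near \<open>D\<close>. Then \<open>- ln S\<close> and \<open>\<epsilon> \<psi> + const\<close> complement each other: the
  first is the larger one near \<open>D\<close>, where it has positive Laplacian, and for a suitable constant
  the second is the larger one near \<open>q\<close>. The smooth substitute
  \<open>(1/N) ln (exp (N u) + exp (N v))\<close> for the maximum of \<open>u = - ln S\<close> and \<open>v = \<epsilon> \<psi> + const\<close> has positive
  Laplacian for large \<open>N\<close>, and it differs from \<open>- ln S\<close> by a function that is smooth across \<open>D\<close>
  (\<open>glue_potential\<close>).

  Two facts make these computations legitimate. A complex differentiable function of several
  variables is smooth (\<open>hol_on_smooth_on\<close>, by Cauchy's formula on circles), so bumps given in one chart
  are smooth in every other chart. And the trace of the Levi form does not depend on the chart
  (\<open>laplacian_chart_independent\<close>), because the matrices of the metric and of the Levi form transform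
  by the same congruence.
\<close>

section \<open>Smooth functions on open subsets of normed spaces\<close>

lemma frechet_derivative_cong_open:
  assumes "open S" "x \<in> S" "\<And>y. y \<in> S \<Longrightarrow> f y = g y"
  shows "frechet_derivative f (at x) = frechet_derivative g (at x)"
    and "f differentiable (at x) \<longleftrightarrow> g differentiable (at x)"
proof -
  have "(f has_derivative D) (at x) \<longleftrightarrow> (g has_derivative D) (at x)" for D
    using has_derivative_transform_within_open[of f D x UNIV S g]
      has_derivative_transform_within_open[of g D x UNIV S f] assms by auto
  then show "frechet_derivative f (at x) = frechet_derivative g (at x)"
    and "f differentiable (at x) \<longleftrightarrow> g differentiable (at x)"
    by (simp_all add: frechet_derivative_def differentiable_def)
qed

lemma Ck_on_subset: "Ck_on k S f \<Longrightarrow> T \<subseteq> S \<Longrightarrow> Ck_on k T f"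
  by (induction k arbitrary: f) (auto intro: continuous_on_subset)

lemma Ck_on_cong:
  assumes "open S" "\<And>x. x \<in> S \<Longrightarrow> f x = g x" 
  shows "Ck_on k S f \<longleftrightarrow> Ck_on k S g"
  using assms(2)
proof (induction k arbitrary: f g)
  case 0
  then show ?case by (auto cong: continuous_on_cong)
next
  case (Suc k)
  note c = frechet_derivative_cong_open[OF assms(1) _ Suc.prems]
  have "Ck_on k S (\<lambda>x. frechet_derivative f (at x) v) \<longleftrightarrow> Ck_on k S (\<lambda>x. frechet_derivative g (at x) v)" for v
    by (rule Suc.IH) (simp add: c(1))
  then show ?case using c(2) by simp
qed

lemma Ck_on_local:
  assumes "\<And>x. x \<in> S \<Longrightarrow> \<exists>N. open N \<and> x \<in> N \<and> Ck_on k N f"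
  shows "Ck_on k S f"
  using assms
proof (induction k arbitrary: f)
  case 0
  show ?case unfolding Ck_on.simps
  proof (rule continuous_at_imp_continuous_on, rule ballI)
    fix x assume "x \<in> S"
    from 0[OF this] obtain N where "open N" "x \<in> N" "continuous_on N f" by auto
    then show "isCont f x" by (simp add: continuous_on_eq_continuous_at)
  qed
next
  case (Suc k)
  show ?case unfolding Ck_on.simps
  proof (intro conjI ballI allI)
    fix x assume "x \<in> S" then show "f differentiable (at x)" using Suc.prems by fastforce
  next
    fix v show "Ck_on k S (\<lambda>x. frechet_derivative f (at x) v)"
      by (rule Suc.IH) (use Suc.prems in fastforce)
  qed
qed

lemma Ck_on_Suc_imp: "Ck_on (Suc k) S f \<Longrightarrow> Ck_on k S f"
proof (induction k arbitrary: f)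
  case 0
  then show ?case
    by (auto intro!: continuous_at_imp_continuous_on differentiable_imp_continuous_within)
next
  case (Suc k)
  then show ?case by (metis Ck_on.simps(2))
qed

lemma Ck_on_SucD:
  assumes "Ck_on (Suc k) S f" "x \<in> S"
  shows "(f has_derivative frechet_derivative f (at x)) (at x)"
  using assms by (auto simp: frechet_derivative_works)

lemma Ck_on_SucD2: "Ck_on (Suc k) S f \<Longrightarrow> Ck_on k S (\<lambda>x. frechet_derivative f (at x) v)"
  by simp

lemma Ck_on_SucI:
  assumes "open S" "\<And>x. x \<in> S \<Longrightarrow> (f has_derivative f' x) (at x)"
    "\<And>v. Ck_on k S (\<lambda>x. f' x v)"
  shows "Ck_on (Suc k) S f"
proof -
  have "Ck_on k S (\<lambda>x. frechet_derivative f (at x) v)" for v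
    using Ck_on_cong[OF assms(1), of "\<lambda>x. frechet_derivative f (at x) v" "\<lambda>x. f' x v" k]
      assms(3) frechet_derivative_at[OF assms(2)] by metis
  then show ?thesis using assms(2) by (auto simp: differentiable_def)
qed

lemma Ck_on_const: "Ck_on k S (\<lambda>_. c)"
  by (induction k arbitrary: c) auto

lemma Ck_on_add:
  assumes "open S" shows "Ck_on k S f \<Longrightarrow> Ck_on k S g \<Longrightarrow> Ck_on k S (\<lambda>x. f x + g x)"
proof (induction k arbitrary: f g)
  case 0 then show ?case by (auto intro: continuous_intros)
next
  case (Suc k)
  show ?case
    by (rule Ck_on_SucI[OF assms, where f' = "\<lambda>x v. frechet_derivative f (at x) v + frechet_derivative g (at x) v"])
      (use Suc in \<open>auto intro!: Suc.IH has_derivative_add intro: Ck_on_SucD\<close>)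
qed

lemma Ck_on_linear:
  assumes "open S" "bounded_linear L" shows "Ck_on k S L"
proof (cases k)
  case 0 then show ?thesis using assms by (auto intro: linear_continuous_on)
next
  case (Suc k')
  show ?thesis unfolding Suc
    by (rule Ck_on_SucI[OF assms(1), where f' = "\<lambda>x. L"])
      (auto intro: bounded_linear_imp_has_derivative assms Ck_on_const)
qed

lemma Ck_on_bilinear:
  assumes "open S" "bounded_bilinear B"
  shows "Ck_on k S f \<Longrightarrow> Ck_on k S g \<Longrightarrow> Ck_on k S (\<lambda>x. B (f x) (g x))"
proof (induction k arbitrary: f g)
  case 0 then show ?case by (auto intro: bounded_bilinear.continuous_on[OF assms(2)])
next
  case (Suc k)
  show ?case
  proof (rule Ck_on_SucI[OF assms(1)])
    show "((\<lambda>x. B (f x) (g x)) has_derivative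
       (\<lambda>v. B (f x) (frechet_derivative g (at x) v) + B (frechet_derivative f (at x) v) (g x))) (at x)"
      if "x \<in> S" for x
      by (intro bounded_bilinear.FDERIV[OF assms(2)] Ck_on_SucD[OF Suc.prems(1) that] Ck_on_SucD[OF Suc.prems(2) that])
    show "Ck_on k S (\<lambda>x. B (f x) (frechet_derivative g (at x) v) + B (frechet_derivative f (at x) v) (g x))" for v
      using Suc.prems by (intro Ck_on_add[OF assms(1)] Suc.IH Ck_on_Suc_imp[OF Suc.prems(1)] Ck_on_Suc_imp[OF Suc.prems(2)]) auto
  qed
qed

lemma Ck_on_sum:
  assumes "open S" "\<And>i. i \<in> I \<Longrightarrow> Ck_on k S (f i)"
  shows "Ck_on k S (\<lambda>x. \<Sum>i\<in>I. f i x)"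
  using assms(2)
  by (induction I rule: infinite_finite_induct) (auto intro: Ck_on_const Ck_on_add[OF assms(1)])

text \<open>By the chain rule the directional derivative of \<open>f \<circ> g\<close> is
  \<open>\<Sum>b\<in>Basis. (D g v \<bullet> b) D f b\<close>. Expanding in the basis matters: \<open>D f\<close> is then
  evaluated at finitely many constant directions, so that the induction hypothesis applies to each
  \<open>x \<mapsto> D f (g x) b\<close>.\<close>

lemma Ck_on_compose:
  fixes f :: "'b::euclidean_space \<Rightarrow> 'c::real_normed_vector" and g :: "'a::real_normed_vector \<Rightarrow> 'b"
  assumes "open S" "open T" "g ` S \<subseteq> T"
  shows "Ck_on k T f \<Longrightarrow> Ck_on k S g \<Longrightarrow> Ck_on k S (\<lambda>x. f (g x))"
proof (induction k arbitrary: f)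
  case 0 then show ?case using assms by (auto intro: continuous_on_compose2)
next
  case (Suc k)
  have df: "(f has_derivative frechet_derivative f (at (g x))) (at (g x))" if "x \<in> S" for x
    using Ck_on_SucD[OF Suc.prems(1)] that assms(3) by auto
  show ?case
  proof (rule Ck_on_SucI[OF assms(1)])
    fix x assume x: "x \<in> S"
    have "((\<lambda>x. f (g x)) has_derivative (\<lambda>v. frechet_derivative f (at (g x)) (frechet_derivative g (at x) v))) (at x)"
      using has_derivative_compose[OF Ck_on_SucD[OF Suc.prems(2) x] df[OF x]] .
    moreover have "frechet_derivative f (at (g x)) w = (\<Sum>b\<in>Basis. (w \<bullet> b) *\<^sub>R frechet_derivative f (at (g x)) b)" for w
    proof -
      interpret linear "frechet_derivative f (at (g x))"
        using df[OF x] has_derivative_linear by blast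
      have "frechet_derivative f (at (g x)) (\<Sum>b\<in>Basis. (w \<bullet> b) *\<^sub>R b) = (\<Sum>b\<in>Basis. (w \<bullet> b) *\<^sub>R frechet_derivative f (at (g x)) b)"
        by (simp add: sum scale)
      then show ?thesis by (simp add: euclidean_representation)
    qed
    ultimately show "((\<lambda>x. f (g x)) has_derivative (\<lambda>v. \<Sum>b\<in>Basis. (frechet_derivative g (at x) v \<bullet> b) *\<^sub>R frechet_derivative f (at (g x)) b)) (at x)"
      by (metis (no_types, lifting) has_derivative_eq_rhs ext)
  next
    fix v
    have "Ck_on k S (\<lambda>x. (frechet_derivative g (at x) v \<bullet> b) *\<^sub>R frechet_derivative f (at (g x)) b)" for b
    proof (rule Ck_on_bilinear[OF assms(1) bounded_bilinear_scaleR])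
      have "Ck_on k S (\<lambda>x. frechet_derivative g (at x) v)" using Suc.prems by simp
      from Ck_on_bilinear[OF assms(1) bounded_bilinear_inner this Ck_on_const]
      show "Ck_on k S (\<lambda>x. frechet_derivative g (at x) v \<bullet> b)" .
      show "Ck_on k S (\<lambda>x. frechet_derivative f (at (g x)) b)"
        by (rule Suc.IH[OF Suc.prems(1)[THEN Ck_on_SucD2] Suc.prems(2)[THEN Ck_on_Suc_imp]])
    qed
    then show "Ck_on k S (\<lambda>x. \<Sum>b\<in>Basis. (frechet_derivative g (at x) v \<bullet> b) *\<^sub>R frechet_derivative f (at (g x)) b)"
      by (intro Ck_on_sum[OF assms(1)])
  qed
qed

lemma smooth_on_subset: "smooth_on S f \<Longrightarrow> T \<subseteq> S \<Longrightarrow> smooth_on T f"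
  unfolding smooth_on_def using Ck_on_subset by blast

lemma smooth_on_cong:
  assumes "open S" "\<And>x. x \<in> S \<Longrightarrow> f x = g x"
  shows "smooth_on S f \<longleftrightarrow> smooth_on S g"
  unfolding smooth_on_def using Ck_on_cong[OF assms] by simp

lemma smooth_on_local:
  assumes "\<And>x. x \<in> S \<Longrightarrow> \<exists>N. open N \<and> x \<in> N \<and> smooth_on N f"
  shows "smooth_on S f"
  unfolding smooth_on_def
proof
  fix k show "Ck_on k S f"
    by (rule Ck_on_local) (use assms in \<open>unfold smooth_on_def, blast\<close>)
qed

lemma smooth_on_const: "smooth_on S (\<lambda>_. c)"
  by (simp add: smooth_on_def Ck_on_const)

lemma smooth_on_add:
  "open S \<Longrightarrow> smooth_on S f \<Longrightarrow> smooth_on S g \<Longrightarrow> smooth_on S (\<lambda>x. f x + g x)"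
  by (simp add: smooth_on_def Ck_on_add)

lemma smooth_on_bilinear:
  "open S \<Longrightarrow> bounded_bilinear B \<Longrightarrow> smooth_on S f \<Longrightarrow> smooth_on S g \<Longrightarrow> smooth_on S (\<lambda>x. B (f x) (g x))"
  by (simp add: smooth_on_def Ck_on_bilinear)

lemma smooth_on_sum:
  "open S \<Longrightarrow> (\<And>i. i \<in> I \<Longrightarrow> smooth_on S (f i)) \<Longrightarrow> smooth_on S (\<lambda>x. \<Sum>i\<in>I. f i x)"
  by (simp add: smooth_on_def Ck_on_sum)

lemma smooth_on_compose:
  fixes f :: "'b::euclidean_space \<Rightarrow> 'c::real_normed_vector" and g :: "'a::real_normed_vector \<Rightarrow> 'b"
  shows "open S \<Longrightarrow> open T \<Longrightarrow> g ` S \<subseteq> T \<Longrightarrow> smooth_on T f \<Longrightarrow> smooth_on S g \<Longrightarrow> smooth_on S (\<lambda>x. f (g x))"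
  unfolding smooth_on_def by (intro allI, rule Ck_on_compose[of S T g]) (assumption | erule spec)+

lemma smooth_on_linear:
  "open S \<Longrightarrow> bounded_linear L \<Longrightarrow> smooth_on S L"
  by (simp add: smooth_on_def Ck_on_linear)

lemma smooth_on_linear_compose:
  fixes f :: "'a::real_normed_vector \<Rightarrow> 'b::euclidean_space"
  shows "open S \<Longrightarrow> bounded_linear L \<Longrightarrow> smooth_on S f \<Longrightarrow> smooth_on S (\<lambda>x. L (f x))"
  by (rule smooth_on_compose[where T = UNIV]) (auto intro: smooth_on_linear)

lemma smooth_on_differentiable:
  "smooth_on S f \<Longrightarrow> x \<in> S \<Longrightarrow> f differentiable (at x)"
  unfolding smooth_on_def by (metis Ck_on.simps(2))

lemma smooth_on_frechet:
  "smooth_on S f \<Longrightarrow> smooth_on S (\<lambda>x. frechet_derivative f (at x) v)"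
  unfolding smooth_on_def by (metis Ck_on.simps(2))

lemma smooth_on_continuous: "smooth_on S f \<Longrightarrow> continuous_on S f"
  unfolding smooth_on_def by (metis Ck_on.simps(1))

text \<open>Smoothness of a function follows from membership in any class of differentiable functions that
  is closed under directional derivatives. This avoids an explicit formula for the higher
  derivatives of exponentials, flat functions and holomorphic functions.\<close>

lemma smooth_on_coinduct:
  assumes "P f"
    and "\<And>f x. P f \<Longrightarrow> x \<in> S \<Longrightarrow> f differentiable (at x)"
    and "\<And>f v. P f \<Longrightarrow> P (\<lambda>x. frechet_derivative f (at x) v)"
  shows "smooth_on S f"
proof -
  have "P f \<Longrightarrow> Ck_on k S f" for k f
    by (induction k arbitrary: f)
      (auto intro!: continuous_at_imp_continuous_on differentiable_imp_continuous_within assms(2,3))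
  then show ?thesis using assms(1) by (simp add: smooth_on_def)
qed

lemma smooth_on_exp: "smooth_on S (exp :: real \<Rightarrow> real)"
proof (rule smooth_on_coinduct[where P = "\<lambda>f. \<exists>c. f = (\<lambda>x. exp x * c)"])
  have d: "((\<lambda>x. exp x * c) has_derivative (\<lambda>v. exp x * (v * c))) (at x)" for c x :: real
    by (auto intro!: derivative_eq_intros)
  show "\<exists>c. exp = (\<lambda>x::real. exp x * c)" by (intro exI[of _ 1]) auto
  show "f differentiable (at x)" if "\<exists>c. f = (\<lambda>x::real. exp x * c)" for f x
    using that d unfolding differentiable_def by blast
  show "\<exists>c. (\<lambda>x. frechet_derivative f (at x) v) = (\<lambda>x. exp x * c)" if "\<exists>c. f = (\<lambda>x::real. exp x * c)" for f v
    using that frechet_derivative_at[OF d] by metis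
qed

lemma Ck_on_inverse: "Ck_on k (- {0}) (inverse :: real \<Rightarrow> real)"
proof (induction k)
  case 0 then show ?case by (auto intro: continuous_on_inverse continuous_on_id)
next
  case (Suc k)
  have o: "open (- {0::real})" by auto
  show ?case
  proof (rule Ck_on_SucI[OF o])
    show "(inverse has_derivative (\<lambda>v. - v * (inverse x * inverse x))) (at x)" if "x \<in> - {0}" for x :: real
      using that by (auto intro!: derivative_eq_intros)
    show "Ck_on k (- {0}) (\<lambda>x. - v * (inverse x * inverse x))" for v :: real
      by (intro Ck_on_bilinear[OF o bounded_bilinear_mult] Ck_on_const Suc)
  qed
qed

lemma smooth_on_ln: "smooth_on {0<..} (ln :: real \<Rightarrow> real)"
proof -
  have "Ck_on k {0<..} (ln :: real \<Rightarrow> real)" for k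
  proof (rule Ck_on_Suc_imp, rule Ck_on_SucI)
    show "(ln has_derivative (\<lambda>v. inverse x * v)) (at x)" if "x \<in> {0<..}" for x :: real
      using that by (auto intro!: derivative_eq_intros simp: divide_inverse)
    show "Ck_on k {0<..} (\<lambda>x. inverse x * v)" for v :: real
      by (intro Ck_on_bilinear[OF _ bounded_bilinear_mult] Ck_on_const Ck_on_subset[OF Ck_on_inverse]) auto
  qed auto
  then show ?thesis by (simp add: smooth_on_def)
qed

section \<open>Flat functions on the real line\<close>

text \<open>The functions \<open>P (1/t) exp (- 1/t)\<close>, continued by \<open>0\<close> to \<open>t \<le> 0\<close>. Unlike the single function
  \<open>exp (- 1/t)\<close>, this family is closed under differentiation.\<close>

definition flat_poly :: "real poly \<Rightarrow> real \<Rightarrow> real" where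
  "flat_poly P t = (if 0 < t then poly P (1 / t) * exp (- 1 / t) else 0)"

lemma poly_exp_tendsto_0: "((\<lambda>y. poly P y * exp (- y)) \<longlongrightarrow> (0::real)) at_top"
proof -
  have "((\<lambda>y. \<Sum>i\<le>degree P. coeff P i * (y ^ i / exp y)) \<longlongrightarrow> (\<Sum>i\<le>degree P. coeff P i * 0)) at_top"
    by (intro tendsto_intros tendsto_power_div_exp_0)
  then show ?thesis
    by (simp add: poly_altdef sum_distrib_right exp_minus divide_inverse mult.assoc)
qed

lemma flat_poly_has_derivative:
  "(flat_poly P has_real_derivative flat_poly (monom 1 2 * (P - pderiv P)) t) (at t)"
proof -
  consider "t < 0" | "0 < t" | "t = 0" by linarith
  then show ?thesis
  proof cases
    case 1
    have "((\<lambda>_. 0) has_real_derivative 0) (at t)" by simp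
    then have "(flat_poly P has_real_derivative 0) (at t)"
      by (rule has_field_derivative_transform_within[where d = "- t"]) (use 1 in \<open>auto simp: flat_poly_def dist_real_def\<close>)
    then show ?thesis using 1 by (simp add: flat_poly_def)
  next
    case 2
    have "((\<lambda>t. poly P (1 / t) * exp (- 1 / t)) has_real_derivative
        poly (monom 1 2 * (P - pderiv P)) (1 / t) * exp (- 1 / t)) (at t)"
      using 2 by (auto intro!: derivative_eq_intros DERIV_chain2[OF poly_DERIV]
          simp: poly_monom algebra_simps power2_eq_square divide_inverse)
    then have "(flat_poly P has_real_derivative 
        poly (monom 1 2 * (P - pderiv P)) (1 / t) * exp (- 1 / t)) (at t)"
      by (rule has_field_derivative_transform_within[where d = t]) (use 2 in \<open>auto simp: flat_poly_def dist_real_def\<close>)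
    then show ?thesis using 2 by (simp add: flat_poly_def)
  next
    case 3
    have "((\<lambda>h. flat_poly P h / h) \<longlongrightarrow> 0) (at 0)"
    proof -
      have "((\<lambda>h. poly (monom 1 1 * P) (inverse h) * exp (- inverse h)) \<longlongrightarrow> 0) (at_right 0)"
        by (rule filterlim_compose[OF poly_exp_tendsto_0 filterlim_inverse_at_top_right])
      \<comment> \<open>The quotient by \<open>h\<close> is again of the form \<open>P' (1/h) exp (- 1/h)\<close>, with \<open>P' = X P\<close>.\<close>
      then have r: "((\<lambda>h. flat_poly P h / h) \<longlongrightarrow> 0) (at_right 0)"
        by (rule Lim_transform_eventually)
          (auto simp: eventually_at_filter flat_poly_def poly_monom divide_inverse mult_ac)
      have l: "((\<lambda>h. flat_poly P h / h) \<longlongrightarrow> 0) (at_left 0)"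
        by (rule Lim_transform_eventually[of "\<lambda>_. 0"])
          (auto simp: eventually_at_filter flat_poly_def)
      from l r show ?thesis by (rule filterlim_split_at)
    qed
    then show ?thesis unfolding 3 DERIV_def by (simp add: flat_poly_def)
  qed
qed

lemma smooth_on_flat_poly: "smooth_on S (flat_poly P)"
proof (rule smooth_on_coinduct[where P = "\<lambda>f. \<exists>c Q. f = (\<lambda>x. flat_poly Q x * c)"])
  have d: "((\<lambda>x. flat_poly Q x * c) has_derivative
      (\<lambda>v. flat_poly (monom 1 2 * (Q - pderiv Q)) x * (v * c))) (at x)" for c x Q
    using DERIV_cmult_right[OF flat_poly_has_derivative[of Q x], of c]
    unfolding has_field_derivative_def by (rule has_derivative_eq_rhs) (auto simp: mult_ac)
  show "\<exists>c Q. flat_poly P = (\<lambda>x. flat_poly Q x * c)"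
    by (intro exI[of _ 1] exI[of _ P]) auto
  show "f differentiable (at x)" if "\<exists>c Q. f = (\<lambda>x. flat_poly Q x * c)" for f x
    using that d unfolding differentiable_def by blast
  show "\<exists>c Q. (\<lambda>x. frechet_derivative f (at x) v) = (\<lambda>x. flat_poly Q x * c)"
    if "\<exists>c Q. f = (\<lambda>x. flat_poly Q x * c)" for f v
    using that frechet_derivative_at[OF d] by metis
qed

section \<open>Holomorphic functions of several variables are smooth\<close>

lemma norm_smult: "norm (a *s v) = norm a * norm (v :: complex ^ 'n)"
  by (simp add: norm_vec_def norm_mult L2_set_right_distrib)

lemma bounded_linear_smult_left: "bounded_linear (\<lambda>a. a *s (v :: complex ^ 'n))"
  by (rule bounded_linear_intro[where K = "norm v"])
    (auto simp: norm_smult vec_eq_iff algebra_simps)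

lemma hol_on_frechet:
  assumes "hol_on S f" "z \<in> S"
  shows "(f has_derivative frechet_derivative f (at z)) (at z)"
    and "frechet_derivative f (at z) (a *s v) = a * frechet_derivative f (at z) v"
proof -
  from assms obtain f' where f': "(f has_derivative f') (at z)" "\<forall>a v. f' (a *s v) = a * f' v"
    unfolding hol_on_def by blast
  with frechet_derivative_at[OF f'(1)]
  show "(f has_derivative frechet_derivative f (at z)) (at z)"
    "frechet_derivative f (at z) (a *s v) = a * frechet_derivative f (at z) v" by auto
qed

lemma hol_on_continuous: "hol_on S f \<Longrightarrow> continuous_on S f"
  by (meson continuous_at_imp_continuous_on has_derivative_continuous hol_on_frechet(1))

text \<open>The circle of radius \<open>r\<close> about \<open>0\<close>, parametrized by \<open>[0, 1]\<close>. As \<open>d\<zeta> = 2 \<pi> \<i> \<zeta> dt\<close> along it,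
  Cauchy's formula for the derivative becomes the mean of \<open>f(\<zeta>) / \<zeta>\<close> over \<open>t\<close>.\<close>

definition circle_param :: "real \<Rightarrow> real \<Rightarrow> complex" where
  "circle_param r t = of_real r * exp (2 * of_real pi * \<i> * of_real t)"

lemma norm_circle_param: "0 < r \<Longrightarrow> norm (circle_param r t) = r"
  by (simp add: circle_param_def norm_mult)

lemma circle_param_nonzero: "0 < r \<Longrightarrow> circle_param r t \<noteq> 0"
  by (simp add: circle_param_def)

lemma continuous_on_circ [continuous_intros]: "continuous_on A g \<Longrightarrow> continuous_on A (\<lambda>x. circle_param r (g x))"
  unfolding circle_param_def by (intro continuous_intros)

lemma continuous_on_smult [continuous_intros]:
  fixes v :: "complex ^ 'n::finite"
  shows "continuous_on A g \<Longrightarrow> continuous_on A (\<lambda>x. g x *s v)"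
  using continuous_on_compose2[OF linear_continuous_on[OF bounded_linear_smult_left, of UNIV]] by auto

text \<open>Cauchy's formula for the one-variable holomorphic function \<open>\<zeta> \<mapsto> f (z + \<zeta> v)\<close>. It represents
  the directional derivative by values of \<open>f\<close> alone, so regularity of \<open>f\<close> passes to its
  derivative.\<close>

lemma hol_on_circle_formula:
  assumes "open S" "hol_on S f" "0 < r" and sub: "\<And>\<zeta>. norm \<zeta> \<le> r \<Longrightarrow> z + \<zeta> *s v \<in> S"
  shows "frechet_derivative f (at z) v = integral (cbox 0 1) (\<lambda>t. f (z + circle_param r t *s v) / circle_param r t)"
proof -
  let ?g = "\<lambda>\<zeta>. f (z + \<zeta> *s v)"
  have d: "(?g has_field_derivative frechet_derivative f (at (z + \<zeta> *s v)) v) (at \<zeta>)" if "norm \<zeta> \<le> r" for \<zeta>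
  proof -
    have "((\<lambda>\<zeta>. z + \<zeta> *s v) has_derivative (\<lambda>h. h *s v)) (at \<zeta>)"
      using bounded_linear_imp_has_derivative[OF bounded_linear_smult_left]
      by (auto intro!: derivative_eq_intros)
    from has_derivative_compose[OF this hol_on_frechet(1)[OF assms(2) sub[OF that]]]
    show ?thesis unfolding has_field_derivative_def
      by (rule has_derivative_eq_rhs) (use hol_on_frechet(2)[OF assms(2) sub[OF that]] in \<open>auto simp: mult.commute\<close>)
  qed
  have c: "continuous_on (cball 0 r) ?g"
    by (rule continuous_at_imp_continuous_on) (auto intro!: DERIV_isCont[OF d])
  have h: "?g holomorphic_on ball 0 r"
    using d has_field_derivative_at_within less_imp_le
    unfolding holomorphic_on_def field_differentiable_def by (metis dist_0_norm mem_ball)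
  have cp: "circlepath 0 r t = circle_param r t" for t
    by (simp add: circlepath circle_param_def)
  have "(?g has_field_derivative (1 / (2 * of_real pi * \<i>) * contour_integral(circlepath 0 r) (\<lambda>u. ?g u / (u-0)^2))) (at 0)"
    using Cauchy_derivative_integral_circlepath(2)[OF c h, of 0] \<open>0 < r\<close> by simp
  moreover have "(?g has_field_derivative frechet_derivative f (at z) v) (at 0)"
    using d[of 0] \<open>0 < r\<close> by simp
  ultimately have "frechet_derivative f (at z) v = 1 / (2 * of_real pi * \<i>) * contour_integral(circlepath 0 r) (\<lambda>u. ?g u / (u-0)^2)"
    using DERIV_unique by blast
  also have "contour_integral(circlepath 0 r) (\<lambda>u. ?g u / (u-0)^2) =
      integral {0..1} (\<lambda>t. (2 * of_real pi * \<i>) * (f (z + circle_param r t *s v) / circle_param r t))"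
    unfolding contour_integral_integral
  proof (rule integral_cong)
    fix t :: real
    have "vector_derivative (circlepath 0 r) (at t) = 2 * of_real pi * \<i> * circle_param r t"
      by (simp add: vector_derivative_circlepath circle_param_def mult_ac)
    moreover have "circle_param r t \<noteq> 0" using \<open>0 < r\<close> by (simp add: circle_param_def)
    ultimately show "?g (circlepath 0 r t) / (circlepath 0 r t - 0)^2 * vector_derivative (circlepath 0 r) (at t)
        = 2 * of_real pi * \<i> * (f (z + circle_param r t *s v) / circle_param r t)"
      by (simp add: cp power2_eq_square)
  qed
  also have "\<dots> = (2 * of_real pi * \<i>) * integral {0..1} (\<lambda>t. f (z + circle_param r t *s v) / circle_param r t)"
    by (rule integral_mult_right)
  finally show ?thesis by (simp add: cbox_interval)
qed

lemma hol_on_small_ball: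
  fixes v :: "complex ^ 'n"
  assumes "open S" "z0 \<in> S"
  obtains \<delta> r where "0 < \<delta>" "0 < r" "\<And>z \<zeta>. z \<in> ball z0 \<delta> \<Longrightarrow> norm \<zeta> \<le> r \<Longrightarrow> z + \<zeta> *s v \<in> S"
proof -
  obtain e where e: "0 < e" "ball z0 e \<subseteq> S" using assms open_contains_ball by blast
  let ?r = "e / (2 * (norm v + 1))"
  have nv: "0 < norm v + 1" by (smt (verit) norm_ge_zero)
  have "z + \<zeta> *s v \<in> S" if "z \<in> ball z0 (e/2)" "norm \<zeta> \<le> ?r" for z \<zeta>
  proof -
    have "norm (\<zeta> *s v) \<le> ?r * norm v"
      unfolding norm_smult using that(2) by (intro mult_right_mono) auto
    also have "\<dots> \<le> ?r * (norm v + 1)"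
      using e nv by (intro mult_left_mono) auto
    also have "\<dots> = e / 2" using nv by (simp add: field_simps)
    finally have "dist (z + \<zeta> *s v) z \<le> e / 2" by (simp add: dist_norm)
    then have "dist z0 (z + \<zeta> *s v) < e" using that(1)
      by (smt (verit) dist_commute dist_triangle field_sum_of_halves mem_ball)
    then show ?thesis using e by auto
  qed
  moreover have "0 < ?r" using e nv by simp
  ultimately show ?thesis using that[of "e/2" ?r] e by simp
qed

text \<open>The definition of \<open>hol_on\<close> gives no continuity of the derivative; the circle formula does. It is
  what differentiation under the integral sign needs in the next lemma.\<close>

lemma hol_on_continuous_frechet:
  fixes f :: "complex ^ 'n::finite \<Rightarrow> complex"
  assumes "open S" "hol_on S f"
  shows "continuous_on S (\<lambda>z. frechet_derivative f (at z) v)"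
proof -
  have "Ck_on 0 S (\<lambda>z. frechet_derivative f (at z) v)"
  proof (rule Ck_on_local)
    fix z0 assume "z0 \<in> S"
    from hol_on_small_ball[OF assms(1) this, of v] obtain \<delta> r where \<delta>: "0 < \<delta>" "0 < r"
      and sub: "\<And>z \<zeta>. z \<in> ball z0 \<delta> \<Longrightarrow> norm \<zeta> \<le> r \<Longrightarrow> z + \<zeta> *s v \<in> S" by metis
    have "continuous_on (ball z0 \<delta>) (\<lambda>z. integral (cbox 0 1) (\<lambda>t. f (z + circle_param r t *s v) / circle_param r t))"
    proof (rule integral_continuous_on_param)
      have "continuous_on (ball z0 \<delta> \<times> cbox 0 1) (\<lambda>x. f (fst x + circle_param r (snd x) *s v) / circle_param r (snd x))"
        by (intro continuous_on_divide continuous_on_compose2[OF hol_on_continuous[OF assms(2)]]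
            continuous_intros)
          (use \<delta> sub norm_circle_param[of r] circle_param_nonzero in auto)
      then show "continuous_on (ball z0 \<delta> \<times> cbox 0 1) (\<lambda>(z, t). f (z + circle_param r t *s v) / circle_param r t)"
        by (simp add: split_def)
    qed
    moreover have "frechet_derivative f (at z) v = integral (cbox 0 1) (\<lambda>t. f (z + circle_param r t *s v) / circle_param r t)"
      if "z \<in> ball z0 \<delta>" for z
      by (rule hol_on_circle_formula[OF assms \<delta>(2)]) (use sub that in auto)
    ultimately have "continuous_on (ball z0 \<delta>) (\<lambda>z. frechet_derivative f (at z) v)"
      by (metis (no_types, lifting) continuous_on_eq)
    then show "\<exists>N. open N \<and> z0 \<in> N \<and> Ck_on 0 N (\<lambda>z. frechet_derivative f (at z) v)"
      using \<delta> by (intro exI[of _ "ball z0 \<delta>"]) auto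
  qed
  then show ?thesis by simp
qed

text \<open>Differentiating the circle formula under the integral sign gives a derivative that is an
  integral of complex linear maps, hence complex linear.\<close>

lemma hol_on_frechet_hol_on:
  fixes f :: "complex ^ 'n::finite \<Rightarrow> complex"
  assumes "open S" "hol_on S f"
  shows "hol_on S (\<lambda>z. frechet_derivative f (at z) v)"
  unfolding hol_on_def
proof
  fix z0 assume "z0 \<in> S"
  from hol_on_small_ball[OF assms(1) this, of v] obtain \<delta> r where \<delta>: "0 < \<delta>" "0 < r"
    and sub: "\<And>z \<zeta>. z \<in> ball z0 \<delta> \<Longrightarrow> norm \<zeta> \<le> r \<Longrightarrow> z + \<zeta> *s v \<in> S" by metis
  let ?U = "ball z0 \<delta>"
  define D where "D z t w = frechet_derivative f (at (z + circle_param r t *s v)) w / circle_param r t" for z t w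
  have cn0: "circle_param r t \<noteq> 0" for t using \<delta> by (simp add: circle_param_def)
  have inS: "z + circle_param r t *s v \<in> S" if "z \<in> ?U" for z t
    using sub[OF that] norm_circle_param[OF \<delta>(2)] by simp
  have dD: "((\<lambda>z. f (z + circle_param r t *s v) / circle_param r t) has_derivative D z t) (at z)" if "z \<in> ?U" for z t
  proof -
    have "((\<lambda>z. z + circle_param r t *s v) has_derivative (\<lambda>w. w)) (at z)"
      by (auto intro!: derivative_eq_intros)
    from has_derivative_compose[OF this hol_on_frechet(1)[OF assms(2) inS[OF that]]]
    show ?thesis unfolding D_def divide_inverse by (rule has_derivative_mult_left)
  qed
  have bl: "bounded_linear (D z t)" if "z \<in> ?U" for z t
    using dD[OF that] has_derivative_bounded_linear by blast
  have contD: "continuous_on (?U \<times> cbox 0 1) (\<lambda>x. D (fst x) (snd x) w)" for w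
  proof -
    have "continuous_on (?U \<times> cbox 0 1) (\<lambda>x. frechet_derivative f (at (fst x + circle_param r (snd x) *s v)) w / circle_param r (snd x))"
      by (intro continuous_on_divide continuous_on_compose2[OF hol_on_continuous_frechet[OF assms]]
            continuous_intros)
          (use inS cn0 in auto)
    then show ?thesis by (simp add: D_def split_def)
  qed
  have contB: "continuous_on (?U \<times> cbox 0 1) (\<lambda>(z, t). Blinfun (D z t))"
  proof (rule continuous_on_blinfun_componentwise)
    fix i :: "complex ^ 'n"
    show "continuous_on (?U \<times> cbox 0 1) (\<lambda>x. blinfun_apply (case x of (z, t) \<Rightarrow> Blinfun (D z t)) i)"
      using contD[of i] by (rule continuous_on_eq) (auto simp: bounded_linear_Blinfun_apply bl)
  qed
  have intg: "(\<lambda>t. f (z + circle_param r t *s v) / circle_param r t) integrable_on cbox 0 1" if "z \<in> ?U" for z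
    by (intro integrable_continuous continuous_on_divide 
        continuous_on_compose2[OF hol_on_continuous[OF assms(2)]] continuous_intros)
      (use inS that cn0 in auto)
  have L: "((\<lambda>z. integral (cbox 0 1) (\<lambda>t. f (z + circle_param r t *s v) / circle_param r t)) has_derivative
      integral (cbox 0 1) (\<lambda>t. Blinfun (D z0 t))) (at z0 within ?U)"
  proof (rule leibniz_rule[OF _ intg contB])
    show "((\<lambda>z. f (z + circle_param r t *s v) / circle_param r t) has_derivative blinfun_apply (Blinfun (D z t))) (at z within ?U)"
      if "z \<in> ?U" for z t
      using has_derivative_at_withinI[OF dD[OF that]] bounded_linear_Blinfun_apply[OF bl[OF that]] by simp
  qed (use \<delta> in auto)
  have z0: "z0 \<in> ?U" using \<delta> by simp
  have L': "((\<lambda>z. frechet_derivative f (at z) v) has_derivative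
      integral (cbox 0 1) (\<lambda>t. Blinfun (D z0 t))) (at z0)"
  proof (rule has_derivative_transform_within_open[of _ _ _ UNIV ?U])
    show "((\<lambda>z. integral (cbox 0 1) (\<lambda>t. f (z + circle_param r t *s v) / circle_param r t)) has_derivative
      integral (cbox 0 1) (\<lambda>t. Blinfun (D z0 t))) (at z0)"
      using L unfolding at_within_open[OF z0 open_ball] .
    show "integral (cbox 0 1) (\<lambda>t. f (z + circle_param r t *s v) / circle_param r t) = frechet_derivative f (at z) v"
      if "z \<in> ?U" for z
      by (rule hol_on_circle_formula[OF assms \<delta>(2), symmetric]) (use sub that in auto)
  qed (use \<delta> in auto)
  have contB0: "continuous_on (cbox 0 1) (\<lambda>t. Blinfun (D z0 t))"
  proof -
    have "continuous_on (cbox 0 1) (\<lambda>t. (\<lambda>(z, t). Blinfun (D z t)) (z0, t))"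
      by (rule continuous_on_compose2[OF contB]) (use z0 in \<open>auto intro!: continuous_intros\<close>)
    then show ?thesis by simp
  qed
  have app: "blinfun_apply (integral (cbox 0 1) (\<lambda>t. Blinfun (D z0 t))) w = integral (cbox 0 1) (\<lambda>t. D z0 t w)" for w
    using blinfun_apply_integral[OF integrable_continuous[OF contB0], of w]
    by (simp add: bounded_linear_Blinfun_apply[OF bl[OF z0]])
  have "D z0 t (a *s w) = a * D z0 t w" for a t w
    using hol_on_frechet(2)[OF assms(2) inS[OF z0]] by (simp add: D_def)
  then have "blinfun_apply (integral (cbox 0 1) (\<lambda>t. Blinfun (D z0 t))) (a *s w) =
      a * blinfun_apply (integral (cbox 0 1) (\<lambda>t. Blinfun (D z0 t))) w" for a w
    unfolding app by simp
  with L' show "\<exists>f'. ((\<lambda>z. frechet_derivative f (at z) v) has_derivative f') (at z0) \<and> (\<forall>a v. f' (a *s v) = a * f' v)"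
    by blast
qed

lemma hol_on_smooth_on:
  fixes f :: "complex ^ 'n::finite \<Rightarrow> complex"
  assumes "open S" "hol_on S f"
  shows "smooth_on S f"
proof (rule smooth_on_coinduct[where P = "hol_on S"])
  show "f differentiable (at x)" if "hol_on S f" "x \<in> S" for f x
    using hol_on_frechet(1)[OF that] unfolding differentiable_def by blast
qed (use assms hol_on_frechet_hol_on in auto)

section \<open>Wirtinger calculus\<close>

text \<open>The real derivative splits into a complex linear and an antilinear part, with the Wirtinger
  derivatives as coefficients. The chain rule for holomorphic inner maps rests on this splitting.\<close>

lemma frechet_wirtinger:
  fixes f :: "complex ^ 'n::finite \<Rightarrow> complex"
  assumes "f differentiable (at z)"
  shows "frechet_derivative f (at z) v = (\<Sum>k\<in>UNIV. d_z k f z * v $ k + d_zbar k f z * cnj (v $ k))"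
proof -
  let ?D = "frechet_derivative f (at z)"
  interpret D: linear ?D by (rule linear_frechet_derivative[OF assms])
  have "v = (\<Sum>k\<in>UNIV. Re (v $ k) *\<^sub>R axis k 1 + Im (v $ k) *\<^sub>R axis k \<i>)"
    by (simp add: vec_eq_iff axis_def if_distrib sum.distrib complex_eq_iff cong: if_cong)
  then have "?D v = ?D (\<Sum>k\<in>UNIV. Re (v $ k) *\<^sub>R axis k 1 + Im (v $ k) *\<^sub>R axis k \<i>)" by (rule arg_cong)
  also have "\<dots> = (\<Sum>k\<in>UNIV. Re (v $ k) *\<^sub>R ?D (axis k 1) + Im (v $ k) *\<^sub>R ?D (axis k \<i>))"
    by (simp add: D.sum D.add D.scale)
  also have "\<dots> = (\<Sum>k\<in>UNIV. d_z k f z * v $ k + d_zbar k f z * cnj (v $ k))"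
    by (rule sum.cong) (auto simp: d_z_def d_zbar_def complex_eq_iff field_simps)
  finally show ?thesis .
qed

lemma d_z_eqI:
  assumes "(f has_derivative D) (at z)"
  shows "d_z i f z = (D (axis i 1) - \<i> * D (axis i \<i>)) / 2"
    and "d_zbar i f z = (D (axis i 1) + \<i> * D (axis i \<i>)) / 2"
  using frechet_derivative_at[OF assms] by (simp_all add: d_z_def d_zbar_def)

lemma d_z_cong:
  assumes "open S" "z \<in> S" "\<And>y. y \<in> S \<Longrightarrow> f y = g y"
  shows "d_z i f z = d_z i g z" "d_zbar i f z = d_zbar i g z"
  using frechet_derivative_cong_open(1)[OF assms] by (simp_all add: d_z_def d_zbar_def)

lemma d_z_const: "d_z i (\<lambda>_. c) z = 0" "d_zbar i (\<lambda>_. c) z = 0"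
  by (simp_all add: d_z_def d_zbar_def)

lemma d_z_add:
  assumes "f differentiable (at z)" "g differentiable (at z)"
  shows "d_z i (\<lambda>z. f z + g z) z = d_z i f z + d_z i g z"
    and "d_zbar i (\<lambda>z. f z + g z) z = d_zbar i f z + d_zbar i g z"
proof -
  note h = has_derivative_add[OF assms[unfolded frechet_derivative_works]]
  show "d_z i (\<lambda>z. f z + g z) z = d_z i f z + d_z i g z"
    "d_zbar i (\<lambda>z. f z + g z) z = d_zbar i f z + d_zbar i g z"
    unfolding d_z_eqI[OF h] by (simp_all add: d_z_def d_zbar_def field_simps)
qed

lemma d_z_sum:
  assumes "\<And>k. k \<in> I \<Longrightarrow> f k differentiable (at z)"
  shows "d_z i (\<lambda>z. \<Sum>k\<in>I. f k z) z = (\<Sum>k\<in>I. d_z i (f k) z)"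
    and "d_zbar i (\<lambda>z. \<Sum>k\<in>I. f k z) z = (\<Sum>k\<in>I. d_zbar i (f k) z)"
proof -
  have h: "((\<lambda>z. \<Sum>k\<in>I. f k z) has_derivative (\<lambda>v. \<Sum>k\<in>I. frechet_derivative (f k) (at z) v)) (at z)"
    using assms by (intro has_derivative_sum) (simp add: frechet_derivative_works)
  show "d_z i (\<lambda>z. \<Sum>k\<in>I. f k z) z = (\<Sum>k\<in>I. d_z i (f k) z)"
    and "d_zbar i (\<lambda>z. \<Sum>k\<in>I. f k z) z = (\<Sum>k\<in>I. d_zbar i (f k) z)"
    unfolding d_z_eqI[OF h]
    by (simp_all add: d_z_def d_zbar_def sum_distrib_left sum.distrib sum_subtractf flip: sum_divide_distrib)
qed

lemma d_z_mult:
  assumes "f differentiable (at z)" "g differentiable (at z)"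
  shows "d_z i (\<lambda>z. f z * g z) z = d_z i f z * g z + f z * d_z i g z"
    and "d_zbar i (\<lambda>z. f z * g z) z = d_zbar i f z * g z + f z * d_zbar i g z"
proof -
  note h = has_derivative_mult[OF assms[unfolded frechet_derivative_works]]
  show "d_z i (\<lambda>z. f z * g z) z = d_z i f z * g z + f z * d_z i g z"
    "d_zbar i (\<lambda>z. f z * g z) z = d_zbar i f z * g z + f z * d_zbar i g z"
    unfolding d_z_eqI[OF h] by (simp_all add: d_z_def d_zbar_def field_simps)
qed

lemma d_z_cnj:
  assumes "f differentiable (at z)"
  shows "d_z i (\<lambda>z. cnj (f z)) z = cnj (d_zbar i f z)"
    and "d_zbar i (\<lambda>z. cnj (f z)) z = cnj (d_z i f z)"
proof -
  note h = has_derivative_cnj[OF assms[unfolded frechet_derivative_works]]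
  show "d_z i (\<lambda>z. cnj (f z)) z = cnj (d_zbar i f z)"
    and "d_zbar i (\<lambda>z. cnj (f z)) z = cnj (d_z i f z)"
    unfolding d_z_eqI[OF h] by (simp_all add: d_z_def d_zbar_def)
qed

lemma differentiable_of_real:
  "(f :: 'a::real_normed_vector \<Rightarrow> real) differentiable (at z) \<Longrightarrow> (\<lambda>z. complex_of_real (f z)) differentiable (at z)"
  unfolding differentiable_def using has_derivative_of_real by blast

lemma differentiable_cnj:
  "f differentiable (at z) \<Longrightarrow> (\<lambda>z. cnj (f z)) differentiable (at z)"
  unfolding differentiable_def using has_derivative_cnj by blast

lemma d_zbar_of_real:
  assumes "\<phi> differentiable (at z)"
  shows "d_zbar i (\<lambda>z. complex_of_real (\<phi> z)) z = cnj (d_z i (\<lambda>z. complex_of_real (\<phi> z)) z)"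
  using d_z_cnj(2)[OF differentiable_of_real[OF assms], of i] by simp

lemma d_z_real_compose:
  assumes "\<phi> differentiable (at z)" "(\<theta> has_real_derivative D) (at (\<phi> z))"
  shows "d_z i (\<lambda>z. complex_of_real (\<theta> (\<phi> z))) z = of_real D * d_z i (\<lambda>z. of_real (\<phi> z)) z"
    and "d_zbar i (\<lambda>z. complex_of_real (\<theta> (\<phi> z))) z = of_real D * d_zbar i (\<lambda>z. of_real (\<phi> z)) z"
proof -
  have d: "(\<phi> has_derivative frechet_derivative \<phi> (at z)) (at z)"
    using assms(1) by (simp add: frechet_derivative_works)
  note h1 = has_derivative_of_real[OF d, where 'a = complex]
  note h2 = has_derivative_of_real[OF has_derivative_compose[OF d assms(2)[unfolded has_field_derivative_def]], where 'a = complex]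
  show "d_z i (\<lambda>z. complex_of_real (\<theta> (\<phi> z))) z = of_real D * d_z i (\<lambda>z. of_real (\<phi> z)) z"
    and "d_zbar i (\<lambda>z. complex_of_real (\<theta> (\<phi> z))) z = of_real D * d_zbar i (\<lambda>z. of_real (\<phi> z)) z"
    unfolding d_z_eqI[OF h1] d_z_eqI[OF h2] by (simp_all add: field_simps)
qed

lemma axis_i_smult: "axis i \<i> = \<i> *s (axis i 1 :: complex ^ 'n)"
  by (simp add: vec_eq_iff axis_def)

lemma hol_on_d_zbar: "hol_on S f \<Longrightarrow> z \<in> S \<Longrightarrow> d_zbar i f z = 0"
  by (simp add: d_zbar_def axis_i_smult hol_on_frechet(2))

lemma hol_on_d_z: "hol_on S f \<Longrightarrow> z \<in> S \<Longrightarrow> d_z i f z = frechet_derivative f (at z) (axis i 1)"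
  by (simp add: d_z_def axis_i_smult hol_on_frechet(2))

lemma hol_on_cong:
  assumes "open S" "\<And>z. z \<in> S \<Longrightarrow> f z = g z" "hol_on S f" shows "hol_on S g"
  unfolding hol_on_def
proof
  fix z assume z: "z \<in> S"
  with assms(3) obtain D where D: "(f has_derivative D) (at z)" "\<forall>a v. D (a *s v) = a * D v"
    unfolding hol_on_def by blast
  have "(g has_derivative D) (at z)"
    by (rule has_derivative_transform_within_open[OF D(1) assms(1) z assms(2)])
  with D(2) show "\<exists>D. (g has_derivative D) (at z) \<and> (\<forall>a v. D (a *s v) = a * D v)" by blast
qed

lemma hol_on_subset: "hol_on S f \<Longrightarrow> T \<subseteq> S \<Longrightarrow> hol_on T f"
  unfolding hol_on_def by blast

lemma hol_on_d_z_hol_on: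
  assumes "open S" "hol_on S f" shows "hol_on S (\<lambda>z. d_z i f z)"
  by (rule hol_on_cong[OF assms(1) _ hol_on_frechet_hol_on[OF assms, of "axis i 1"]])
    (simp add: hol_on_d_z[OF assms(2)])

lemma hol_on_mult:
  assumes "hol_on S f" "hol_on S g" shows "hol_on S (\<lambda>z. f z * g z)"
  unfolding hol_on_def
proof
  fix z assume z: "z \<in> S"
  show "\<exists>D. ((\<lambda>z. f z * g z) has_derivative D) (at z) \<and> (\<forall>a v. D (a *s v) = a * D v)"
    by (rule exI, rule conjI, rule has_derivative_mult[OF hol_on_frechet(1)[OF assms(1) z] hol_on_frechet(1)[OF assms(2) z]])
      (simp add: hol_on_frechet(2)[OF assms(1) z] hol_on_frechet(2)[OF assms(2) z] algebra_simps)
qed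

lemma hol_on_inverse:
  assumes "hol_on S f" "\<And>z. z \<in> S \<Longrightarrow> f z \<noteq> 0" shows "hol_on S (\<lambda>z. inverse (f z))"
  unfolding hol_on_def
proof
  fix z assume z: "z \<in> S"
  show "\<exists>D. ((\<lambda>z. inverse (f z)) has_derivative D) (at z) \<and> (\<forall>a v. D (a *s v) = a * D v)"
    by (rule exI, rule conjI, rule Deriv.has_derivative_inverse[OF assms(2)[OF z] hol_on_frechet(1)[OF assms(1) z]])
      (simp add: hol_on_frechet(2)[OF assms(1) z] algebra_simps)
qed

lemma bounded_linear_axis: "bounded_linear (\<lambda>c :: complex. axis k c :: complex ^ 'n::finite)"
  unfolding linear_conv_bounded_linear[symmetric]
  by (rule linearI) (auto simp: vec_eq_iff axis_def)

text \<open>A map is the finite sum of its components placed on the coordinate axes, so derivatives may be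
  computed componentwise.\<close>

lemma hol_map_has_derivative:
  fixes F :: "complex ^ 'm::finite \<Rightarrow> complex ^ 'n::finite"
  assumes "\<And>k. hol_on S (\<lambda>z. F z $ k)" "z \<in> S"
  shows "(F has_derivative (\<lambda>v. \<chi> k. frechet_derivative (\<lambda>z. F z $ k) (at z) v)) (at z)"
proof -
  have "((\<lambda>z. \<Sum>k\<in>UNIV. axis k (F z $ k)) has_derivative
      (\<lambda>v. \<Sum>k\<in>UNIV. axis k (frechet_derivative (\<lambda>z. F z $ k) (at z) v))) (at z)"
  proof (intro has_derivative_sum)
    fix k :: 'n
    show "((\<lambda>z. axis k (F z $ k)) has_derivative (\<lambda>v. axis k (frechet_derivative (\<lambda>z. F z $ k) (at z) v))) (at z)"
      by (rule bounded_linear.has_derivative[OF bounded_linear_axis hol_on_frechet(1)[OF assms]])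
  qed
  moreover have "(\<Sum>k\<in>UNIV. axis k (w k)) = (\<chi> k. w k)" for w :: "'n \<Rightarrow> complex"
    by (simp add: vec_eq_iff axis_def if_distrib cong: if_cong)
  ultimately show ?thesis by simp
qed

lemma hol_map_smooth_on:
  fixes F :: "complex ^ 'm::finite \<Rightarrow> complex ^ 'n::finite"
  assumes "open S" "\<And>k. hol_on S (\<lambda>z. F z $ k)"
  shows "smooth_on S F"
proof -
  have "smooth_on S (\<lambda>z. \<Sum>k\<in>UNIV. axis k (F z $ k))"
  proof (intro smooth_on_sum[OF assms(1)])
    fix k :: 'n
    show "smooth_on S (\<lambda>z. axis k (F z $ k) :: complex ^ 'n)"
      by (rule smooth_on_linear_compose[OF assms(1) bounded_linear_axis hol_on_smooth_on[OF assms]])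
  qed
  moreover have "(\<Sum>k\<in>UNIV. axis k (F z $ k)) = F z" for z
    by (simp add: vec_eq_iff axis_def if_distrib cong: if_cong)
  ultimately show ?thesis by simp
qed

text \<open>A holomorphic inner map sends the complex linear part of the derivative of \<open>f\<close> to the complex
  linear part of that of \<open>f \<circ> F\<close>, and likewise the antilinear part; there are no mixed terms.\<close>

lemma d_z_hol_compose:
  fixes F :: "complex ^ 'm::finite \<Rightarrow> complex ^ 'n::finite" and f :: "complex ^ 'n \<Rightarrow> complex"
  assumes "\<And>k. hol_on S (\<lambda>z. F z $ k)" "z \<in> S" "f differentiable (at (F z))"
  shows "d_z i (\<lambda>z. f (F z)) z = (\<Sum>k\<in>UNIV. d_z k f (F z) * d_z i (\<lambda>z. F z $ k) z)"
    and "d_zbar i (\<lambda>z. f (F z)) z = (\<Sum>k\<in>UNIV. d_zbar k f (F z) * cnj (d_z i (\<lambda>z. F z $ k) z))"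
proof -
  note h = has_derivative_compose[OF hol_map_has_derivative[OF assms(1,2)] assms(3)[unfolded frechet_derivative_works]]
  show "d_z i (\<lambda>z. f (F z)) z = (\<Sum>k\<in>UNIV. d_z k f (F z) * d_z i (\<lambda>z. F z $ k) z)"
    and "d_zbar i (\<lambda>z. f (F z)) z = (\<Sum>k\<in>UNIV. d_zbar k f (F z) * cnj (d_z i (\<lambda>z. F z $ k) z))"
    unfolding d_z_eqI[OF h] frechet_wirtinger[OF assms(3)] sum_distrib_left
      sum_subtractf[symmetric] sum.distrib[symmetric] sum_divide_distrib
    by (auto simp: axis_i_smult hol_on_frechet(2)[OF assms(1,2)] hol_on_d_z[OF assms(1,2)]
        field_simps intro!: sum.cong)
qed

lemma smooth_on_d_z:
  fixes f :: "complex ^ 'n::finite \<Rightarrow> complex"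
  assumes "open S" "smooth_on S f"
  shows "smooth_on S (d_z i f)" "smooth_on S (d_zbar i f)"
proof -
  note s = smooth_on_frechet[OF assms(2)]
  have "smooth_on S (\<lambda>z. 1/2 * frechet_derivative f (at z) (axis i 1) + (c * frechet_derivative f (at z) (axis i \<i>)))" for c
    by (intro smooth_on_add smooth_on_bilinear[OF _ bounded_bilinear_mult] assms s smooth_on_const)
  from this[of "- \<i> / 2"] this[of "\<i> / 2"]
  have "smooth_on S (\<lambda>z. d_z i f z)" "smooth_on S (\<lambda>z. d_zbar i f z)"
    by (simp_all add: d_z_def d_zbar_def add_divide_distrib diff_divide_distrib)
  then show "smooth_on S (d_z i f)" "smooth_on S (d_zbar i f)" by simp_all
qed

lemma smooth_on_of_real:
  fixes \<phi> :: "'a::real_normed_vector \<Rightarrow> real"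
  shows "open S \<Longrightarrow> smooth_on S \<phi> \<Longrightarrow> smooth_on S (\<lambda>z. complex_of_real (\<phi> z))"
  by (rule smooth_on_linear_compose[OF _ bounded_linear_of_real])

section \<open>The Levi matrix in coordinates\<close>

definition levi_matrix :: "(complex ^ 'n::finite \<Rightarrow> real) \<Rightarrow> complex ^ 'n \<Rightarrow> complex ^ 'n ^ 'n" where
  "levi_matrix \<phi> z = (\<chi> i j. d_z i (d_zbar j (\<lambda>z. complex_of_real (\<phi> z))) z)"

lemma levi_nth: "levi_matrix \<phi> z $ i $ j = d_z i (d_zbar j (\<lambda>z. complex_of_real (\<phi> z))) z"
  by (simp add: levi_matrix_def)

lemma levi_cong:
  assumes "open S" "z \<in> S" "\<And>y. y \<in> S \<Longrightarrow> \<phi> y = \<psi> y"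
  shows "levi_matrix \<phi> z = levi_matrix \<psi> z"
proof -
  have "d_zbar j (\<lambda>z. complex_of_real (\<phi> z)) y = d_zbar j (\<lambda>z. complex_of_real (\<psi> z)) y" if "y \<in> S" for j y
    by (rule d_z_cong(2)[OF assms(1) that]) (simp add: assms(3))
  then have "d_z i (d_zbar j (\<lambda>z. complex_of_real (\<phi> z))) z = d_z i (d_zbar j (\<lambda>z. complex_of_real (\<psi> z))) z" for i j
    by (intro d_z_cong(1)[OF assms(1,2)])
  then show ?thesis unfolding levi_matrix_def by simp
qed

lemma smooth_on_levi:
  assumes "open S" "smooth_on S \<phi>"
  shows "smooth_on S (\<lambda>z. levi_matrix \<phi> z $ i $ j)"
  unfolding levi_nth
  by (rule smooth_on_d_z(1)[OF assms(1) smooth_on_d_z(2)[OF assms(1) smooth_on_of_real[OF assms]]])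

lemma d_zbar_differentiable:
  assumes "open S" "smooth_on S \<phi>" "z \<in> S"
  shows "d_zbar j (\<lambda>z. complex_of_real (\<phi> z)) differentiable (at z)"
  by (rule smooth_on_differentiable[OF smooth_on_d_z(2)[OF assms(1) smooth_on_of_real[OF assms(1,2)]] assms(3)])

lemma levi_add:
  assumes "open S" "smooth_on S \<phi>" "smooth_on S \<psi>" "z \<in> S"
  shows "levi_matrix (\<lambda>z. \<phi> z + \<psi> z) z = levi_matrix \<phi> z + levi_matrix \<psi> z"
proof -
  note d = smooth_on_differentiable[OF smooth_on_of_real[OF assms(1)]]
  have "d_z i (d_zbar j (\<lambda>z. complex_of_real (\<phi> z + \<psi> z))) z =
      d_z i (\<lambda>z. d_zbar j (\<lambda>z. complex_of_real (\<phi> z)) z + d_zbar j (\<lambda>z. complex_of_real (\<psi> z)) z) z" for i j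
    by (rule d_z_cong(1)[OF assms(1,4)]) (simp add: d_z_add(2) d[OF assms(2)] d[OF assms(3)])
  then show ?thesis
    by (simp add: vec_eq_iff levi_nth d_z_add(1) d_zbar_differentiable[OF assms(1)] assms)
qed

text \<open>The gradient term \<open>t2 \<partial>\<phi>/\<partial>z\<^sub>i cnj (\<partial>\<phi>/\<partial>z\<^sub>j)\<close> is a positive semidefinite form whenever \<open>t2 \<ge> 0\<close>. This is why
  convex functions of \<open>\<phi>\<close> lose no positivity.\<close>

lemma levi_real_compose:
  fixes \<phi> :: "complex ^ 'n::finite \<Rightarrow> real"
  assumes S: "open S" "smooth_on S \<phi>" "z \<in> S"
    and U: "open U" "\<phi> z \<in> U" "\<And>x. x \<in> U \<Longrightarrow> (\<theta> has_real_derivative \<theta>1 x) (at x)"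
      "(\<theta>1 has_real_derivative t2) (at (\<phi> z))"
  shows "levi_matrix (\<lambda>z. \<theta> (\<phi> z)) z $ i $ j = of_real (\<theta>1 (\<phi> z)) * levi_matrix \<phi> z $ i $ j
      + of_real t2 * (d_z i (\<lambda>z. of_real (\<phi> z)) z * cnj (d_z j (\<lambda>z. of_real (\<phi> z)) z))"
proof -
  define V where "V = S \<inter> \<phi> -` U"
  have oV: "open V" unfolding V_def
    using continuous_open_preimage[OF smooth_on_continuous[OF S(2)] S(1) U(1)] .
  have zV: "z \<in> V" using S U by (simp add: V_def)
  have d\<phi>: "\<phi> differentiable (at y)" if "y \<in> V" for y
    using smooth_on_differentiable[OF S(2)] that by (simp add: V_def)
  have d\<theta>: "(\<lambda>z. \<theta>1 (\<phi> z)) differentiable (at z)"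
    using differentiable_chain_at[of \<phi> z \<theta>1, OF d\<phi>[OF zV]] U(4) 
    by (auto simp: o_def differentiable_def has_field_derivative_def)
  have "levi_matrix (\<lambda>z. \<theta> (\<phi> z)) z $ i $ j =
      d_z i (\<lambda>z. complex_of_real (\<theta>1 (\<phi> z)) * d_zbar j (\<lambda>z. of_real (\<phi> z)) z) z"
    unfolding levi_nth
  proof (rule d_z_cong(1)[OF oV zV])
    fix y assume "y \<in> V"
    then show "d_zbar j (\<lambda>z. complex_of_real (\<theta> (\<phi> z))) y = complex_of_real (\<theta>1 (\<phi> y)) * d_zbar j (\<lambda>z. of_real (\<phi> z)) y"
      using d_z_real_compose(2)[OF d\<phi>] U(3) by (simp add: V_def)
  qed
  also have "\<dots> = of_real t2 * d_z i (\<lambda>z. of_real (\<phi> z)) z * d_zbar j (\<lambda>z. of_real (\<phi> z)) z +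
      of_real (\<theta>1 (\<phi> z)) * levi_matrix \<phi> z $ i $ j"
    unfolding levi_nth
    by (subst d_z_mult(1))
      (simp_all add: d_zbar_differentiable[OF S] differentiable_of_real[OF d\<theta>] d_z_real_compose(1)[OF d\<phi>[OF zV] U(4)])
  finally show ?thesis by (simp add: d_zbar_of_real[OF d\<phi>[OF zV]] mult.assoc add.commute)
qed

text \<open>No first derivatives of \<open>\<phi>\<close> survive: they would be multiplied by \<open>\<partial>/\<partial>z\<^sub>i\<close> of the conjugate of a
  holomorphic function, which is \<open>0\<close>. Hence the Levi matrix transforms like a Hermitian tensor.\<close>

lemma levi_hol_compose:
  fixes F :: "complex ^ 'm::finite \<Rightarrow> complex ^ 'n::finite" and \<phi> :: "complex ^ 'n \<Rightarrow> real"
  assumes S: "open S" "\<And>k. hol_on S (\<lambda>z. F z $ k)" "z \<in> S"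
    and T: "open T" "smooth_on T \<phi>" "F ` S \<subseteq> T"
  shows "levi_matrix (\<lambda>z. \<phi> (F z)) z $ i $ j =
    (\<Sum>k\<in>UNIV. \<Sum>l\<in>UNIV. levi_matrix \<phi> (F z) $ k $ l * d_z i (\<lambda>z. F z $ k) z * cnj (d_z j (\<lambda>z. F z $ l) z))"
proof -
  let ?p = "\<lambda>z. complex_of_real (\<phi> z)"
  have FT: "F y \<in> T" if "y \<in> S" for y using T(3) that by auto
  have dp: "?p differentiable (at (F y))" if "y \<in> S" for y
    by (rule smooth_on_differentiable[OF smooth_on_of_real[OF T(1,2)] FT[OF that]])
  have dF: "d_z j (\<lambda>z. F z $ l) differentiable (at z)" for l
    using hol_on_frechet(1)[OF hol_on_d_z_hol_on[OF S(1,2)] S(3)] unfolding differentiable_def by blast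
  have dq: "(\<lambda>z. d_zbar l ?p (F z)) differentiable (at z)" for l
  proof -
    have "F differentiable (at z)" using hol_map_has_derivative[OF S(2,3)] unfolding differentiable_def by blast
    from differentiable_chain_at[OF this d_zbar_differentiable[OF T(1,2) FT[OF S(3)]]]
    show ?thesis by (simp add: o_def)
  qed
  have "levi_matrix (\<lambda>z. \<phi> (F z)) z $ i $ j =
      d_z i (\<lambda>z. \<Sum>l\<in>UNIV. d_zbar l ?p (F z) * cnj (d_z j (\<lambda>z. F z $ l) z)) z"
    unfolding levi_nth
    by (rule d_z_cong(1)[OF S(1,3)]) (rule d_z_hol_compose(2)[OF S(2) _ dp])
  also have "\<dots> = (\<Sum>l\<in>UNIV. d_z i (\<lambda>z. d_zbar l ?p (F z)) z * cnj (d_z j (\<lambda>z. F z $ l) z))"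
    by (subst d_z_sum(1), intro differentiable_mult dq differentiable_cnj dF, intro sum.cong refl,
      subst d_z_mult(1)[OF dq differentiable_cnj[OF dF]])
      (simp add: d_z_cnj(1)[OF dF] hol_on_d_zbar[OF hol_on_d_z_hol_on[OF S(1,2)] S(3)])
  also have "\<dots> = (\<Sum>l\<in>UNIV. \<Sum>k\<in>UNIV. levi_matrix \<phi> (F z) $ k $ l * d_z i (\<lambda>z. F z $ k) z * cnj (d_z j (\<lambda>z. F z $ l) z))"
    by (simp add: levi_nth d_z_hol_compose(1)[OF S(2,3) d_zbar_differentiable[OF T(1,2) FT[OF S(3)]]] sum_distrib_right)
  finally show ?thesis by (subst sum.swap)
qed

text \<open>The \<open>cnj z\<^sub>j\<close> derivative of \<open>ln \<bar>h\<bar>\<^sup>2\<close> is the conjugate of the holomorphic function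
  \<open>(\<partial>h/\<partial>z\<^sub>j) / h\<close>, and so is annihilated by \<open>\<partial>/\<partial>z\<^sub>i\<close>.\<close>

lemma levi_ln_norm_sq_hol:
  fixes h :: "complex ^ 'n::finite \<Rightarrow> complex"
  assumes S: "open S" "hol_on S h" "z \<in> S" "\<And>y. y \<in> S \<Longrightarrow> h y \<noteq> 0"
  shows "levi_matrix (\<lambda>z. ln ((norm (h z))\<^sup>2)) z = 0"
proof -
  have dh: "h differentiable (at y)" if "y \<in> S" for y
    using hol_on_frechet(1)[OF S(2) that] unfolding differentiable_def by blast
  let ?q = "\<lambda>z. d_z j h z * inverse (h z)" 
  have "d_zbar j (\<lambda>z. complex_of_real (ln ((norm (h z))\<^sup>2))) y = cnj (d_z j h y * inverse (h y))" if y: "y \<in> S" for j y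
  proof -
    have n: "complex_of_real ((norm (h z))\<^sup>2) = h z * cnj (h z)" for z
      by (simp add: complex_norm_square[symmetric])
    have dn: "(\<lambda>z. (norm (h z))\<^sup>2) differentiable (at y)"
    proof -
      have "(\<lambda>z. Re (h z * cnj (h z))) differentiable (at y)"
        using has_derivative_Re differentiable_mult[OF dh[OF y] differentiable_cnj[OF dh[OF y]]]
        unfolding differentiable_def by blast
      moreover have "Re (h z * cnj (h z)) = (norm (h z))\<^sup>2" for z
        by (metis n Re_complex_of_real)
      ultimately show ?thesis by simp
    qed
    have "d_zbar j (\<lambda>z. complex_of_real (ln ((norm (h z))\<^sup>2))) y =
        of_real (inverse ((norm (h y))\<^sup>2)) * d_zbar j (\<lambda>z. complex_of_real ((norm (h z))\<^sup>2)) y"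
      by (rule d_z_real_compose(2)[OF dn]) (use S(4)[OF y] in \<open>auto intro!: derivative_eq_intros simp: divide_inverse\<close>)
    also have "d_zbar j (\<lambda>z. complex_of_real ((norm (h z))\<^sup>2)) y = h y * cnj (d_z j h y)"
      unfolding n by (simp add: d_z_mult(2)[OF dh[OF y] differentiable_cnj[OF dh[OF y]]] hol_on_d_zbar[OF S(2) y] d_z_cnj(2)[OF dh[OF y]])
    also have "of_real (inverse ((norm (h y))\<^sup>2)) = inverse (h y) * inverse (cnj (h y))"
      unfolding of_real_inverse n by simp
    finally show ?thesis using S(4)[OF y] by simp
  qed
  then have "levi_matrix (\<lambda>z. ln ((norm (h z))\<^sup>2)) z $ i $ j = d_z i (\<lambda>y. cnj (d_z j h y * inverse (h y))) z" for i j
    unfolding levi_nth by (intro d_z_cong(1)[OF S(1,3)])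
  moreover have "d_z i (\<lambda>y. cnj (d_z j h y * inverse (h y))) z = 0" for i j
  proof -
    have hq: "hol_on S (\<lambda>y. d_z j h y * inverse (h y))"
      by (intro hol_on_mult hol_on_inverse hol_on_d_z_hol_on S)
    then have "(\<lambda>y. d_z j h y * inverse (h y)) differentiable (at z)"
      using hol_on_frechet(1)[OF hq S(3)] unfolding differentiable_def by blast
    from d_z_cnj(1)[OF this] show ?thesis using hol_on_d_zbar[OF hq S(3)] by simp
  qed
  ultimately show ?thesis by (simp add: vec_eq_iff)
qed

lemma hol_on_coord: "hol_on S (\<lambda>z. z $ k - c)"
  unfolding hol_on_def
proof
  fix z
  have "((\<lambda>z. z $ k - c) has_derivative (\<lambda>v. v $ k)) (at z)"
    using bounded_linear_imp_has_derivative[OF bounded_linear_vec_nth[of k]]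
    by (auto intro!: derivative_eq_intros)
  then show "\<exists>f'. ((\<lambda>z. z $ k - c) has_derivative f') (at z) \<and> (\<forall>a v. f' (a *s v) = a * f' v)" by auto
qed

lemma d_z_coord: "d_z i (\<lambda>z. z $ k - c) z = (if i = k then 1 else 0)"
proof -
  have "((\<lambda>z. z $ k - c) has_derivative (\<lambda>v. v $ k)) (at z)"
    using bounded_linear_imp_has_derivative[OF bounded_linear_vec_nth[of k]]
    by (auto intro!: derivative_eq_intros)
  from d_z_eqI(1)[OF this, of i] show ?thesis by (cases "i = k") (auto simp: axis_def)
qed

lemma norm_sq_vec:
  fixes w :: "complex ^ 'n::finite"
  shows "complex_of_real ((norm w)\<^sup>2) = (\<Sum>k\<in>UNIV. w $ k * cnj (w $ k))"
  by (simp add: norm_vec_def L2_set_def sum_nonneg flip: complex_norm_square)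

lemma smooth_on_dist_sq: "open S \<Longrightarrow> smooth_on S (\<lambda>z::complex ^ 'n::finite. (norm (z - z0))\<^sup>2)"
proof -
  assume S: "open S"
  have "smooth_on S (\<lambda>z. (z - z0) \<bullet> (z - z0))"
    using smooth_on_add[OF S smooth_on_linear[OF S bounded_linear_ident] smooth_on_const[of S "- z0"]]
    by (intro smooth_on_bilinear[OF S bounded_bilinear_inner]) auto
  then show ?thesis by (simp add: power2_norm_eq_inner)
qed

lemma dist_sq_wirtinger:
  fixes z0 :: "complex ^ 'n::finite"
  shows "d_z j (\<lambda>z. complex_of_real ((norm (z - z0))\<^sup>2)) z = cnj (z $ j - z0 $ j)"
    and "levi_matrix (\<lambda>z. (norm (z - z0))\<^sup>2) z $ i $ j = (if i = j then 1 else 0)"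
proof -
  have dd: "(\<lambda>z. z $ k - c) differentiable (at (z :: complex ^ 'n))" for k c z
    using hol_on_frechet(1)[OF hol_on_coord[of UNIV k c]] unfolding differentiable_def by blast
  have *: "d_zbar j (\<lambda>z. complex_of_real ((norm (z - z0))\<^sup>2)) z = z $ j - z0 $ j" for z j
  proof -
    have "d_zbar j (\<lambda>z. (z $ k - z0 $ k) * cnj (z $ k - z0 $ k)) z = (if j = k then z $ k - z0 $ k else 0)" for k
      unfolding d_z_mult(2)[OF dd differentiable_cnj[OF dd]] d_z_cnj(2)[OF dd] d_z_coord
        hol_on_d_zbar[OF hol_on_coord UNIV_I] by simp
    then show ?thesis
      unfolding norm_sq_vec vector_minus_component
      by (subst d_z_sum(2)) (auto intro!: differentiable_mult differentiable_cnj dd simp del: complex_cnj_diff cong: if_cong)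
  qed
  have diff: "(\<lambda>z. (norm (z - z0))\<^sup>2) differentiable (at z)"
    using smooth_on_differentiable[OF smooth_on_dist_sq[OF open_UNIV] UNIV_I] .
  show "d_z j (\<lambda>z. complex_of_real ((norm (z - z0))\<^sup>2)) z = cnj (z $ j - z0 $ j)"
    using *[of j z] d_zbar_of_real[OF diff, of j] by (metis complex_cnj_cnj)
  have "d_zbar j (\<lambda>z. complex_of_real ((norm (z - z0))\<^sup>2)) = (\<lambda>z. z $ j - z0 $ j)"
    using * by (rule ext)
  then show "levi_matrix (\<lambda>z. (norm (z - z0))\<^sup>2) z $ i $ j = (if i = j then 1 else 0)"
    unfolding levi_nth by (simp only: d_z_coord)
qed

section \<open>Positive definite matrices and the trace\<close>

definition posdef :: "complex ^ 'n::finite ^ 'n \<Rightarrow> bool" where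
  "posdef G \<longleftrightarrow> (\<forall>v. v \<noteq> 0 \<longrightarrow> 0 < Re (\<Sum>i\<in>UNIV. \<Sum>j\<in>UNIV. G $ i $ j * (v $ i) * cnj (v $ j)))"

lemma posdef_inverse_form:
  assumes "posdef G" "G *v x \<noteq> 0"
  shows "0 < Re (\<Sum>i\<in>UNIV. x $ i * cnj ((G *v x) $ i))"
proof -
  have "x \<noteq> 0" using assms(2) by auto
  then have "(\<chi> i. cnj (x $ i)) \<noteq> 0" by (auto simp: vec_eq_iff)
  from assms(1)[unfolded posdef_def, rule_format, OF this]
  have "0 < Re (\<Sum>i\<in>UNIV. \<Sum>j\<in>UNIV. G $ i $ j * cnj (x $ i) * x $ j)" by simp
  also have "\<dots> = Re (cnj (\<Sum>i\<in>UNIV. \<Sum>j\<in>UNIV. G $ i $ j * cnj (x $ i) * x $ j))"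
    by (simp only: cnj.sel)
  also have "cnj (\<Sum>i\<in>UNIV. \<Sum>j\<in>UNIV. G $ i $ j * cnj (x $ i) * x $ j) = (\<Sum>i\<in>UNIV. x $ i * cnj ((G *v x) $ i))"
    by (simp add: matrix_vector_mult_def sum_distrib_left mult_ac)
  finally show ?thesis .
qed

lemma posdef_invertible:
  assumes "posdef G" shows "invertible G"
proof -
  have "x = 0" if "G *v x = 0" for x
  proof (rule ccontr)
    assume "x \<noteq> 0"
    then have "(\<chi> i. cnj (x $ i)) \<noteq> 0" by (auto simp: vec_eq_iff)
    from assms[unfolded posdef_def, rule_format, OF this]
    have "0 < Re (\<Sum>i\<in>UNIV. \<Sum>j\<in>UNIV. G $ i $ j * cnj (x $ i) * x $ j)" by simp
    also have "(\<Sum>i\<in>UNIV. \<Sum>j\<in>UNIV. G $ i $ j * cnj (x $ i) * x $ j) = (\<Sum>i\<in>UNIV. cnj (x $ i) * (G *v x) $ i)"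
      by (simp add: matrix_vector_mult_def sum_distrib_left mult_ac)
    finally show False using that by simp
  qed
  then show ?thesis using matrix_left_invertible_ker invertible_left_inverse by blast
qed

lemma matrix_inv_mult:
  fixes G :: "complex ^ 'n::finite ^ 'n"
  assumes "invertible G"
  shows "G ** matrix_inv G = mat 1" "matrix_inv G ** G = mat 1"
  using someI_ex[OF assms[unfolded invertible_def]] by (simp_all add: matrix_inv_def)

text \<open>With \<open>x = G\<^sup>-\<^sup>1 w\<close> the forms of \<open>cnj (G\<^sup>-\<^sup>1)\<close> at \<open>w\<close> and of \<open>G\<close> at \<open>cnj x\<close> have the same real part. It is
  this inverse form that the Laplacian applies to gradients.\<close>

lemma posdef_matrix_inv:
  assumes "posdef G" "w \<noteq> 0"
  shows "0 < Re (\<Sum>i\<in>UNIV. \<Sum>j\<in>UNIV. cnj (matrix_inv G $ i $ j) * (w $ i * cnj (w $ j)))"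
proof -
  let ?M = "matrix_inv G"
  have w: "G *v (?M *v w) = w"
    by (simp add: matrix_vector_mul_assoc matrix_inv_mult[OF posdef_invertible[OF assms(1)]])
  have "0 < Re (\<Sum>i\<in>UNIV. (?M *v w) $ i * cnj (w $ i))"
    using posdef_inverse_form[OF assms(1), of "?M *v w"] assms(2) w by simp
  also have "\<dots> = Re (cnj (\<Sum>i\<in>UNIV. (?M *v w) $ i * cnj (w $ i)))" by simp
  also have "cnj (\<Sum>i\<in>UNIV. (?M *v w) $ i * cnj (w $ i)) =
      (\<Sum>i\<in>UNIV. \<Sum>j\<in>UNIV. cnj (?M $ i $ j) * (w $ i * cnj (w $ j)))"
    by (simp add: matrix_vector_mult_def sum_distrib_right sum_distrib_left mult_ac)
  finally show ?thesis .
qed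

lemma matrix_inv_unique:
  fixes G :: "complex ^ 'n::finite ^ 'n"
  assumes "invertible G" "G ** Y = mat 1"
  shows "matrix_inv G = Y"
  by (metis assms matrix_inv_mult(2) matrix_mul_assoc matrix_mul_lid matrix_mul_rid)

text \<open>If \<open>G = J\<^sup>T G' cnj J\<close>, then \<open>G'\<^sup>-\<^sup>1 = cnj J G\<^sup>-\<^sup>1 J\<^sup>T\<close>, and the factors cancel those of
  \<open>H = J\<^sup>T H' cnj J\<close> under the trace. That \<open>J\<close> is invertible is a consequence, because \<open>G\<close> is.\<close>

lemma herm_trace_congruence:
  fixes G G' H H' J :: "complex ^ 'n::finite ^ 'n"
  assumes G: "\<And>i j. G $ i $ j = (\<Sum>k\<in>UNIV. \<Sum>l\<in>UNIV. G' $ k $ l * J $ k $ i * cnj (J $ l $ j))"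
    and H: "\<And>i j. H $ i $ j = (\<Sum>k\<in>UNIV. \<Sum>l\<in>UNIV. H' $ k $ l * J $ k $ i * cnj (J $ l $ j))"
    and inv: "invertible G" "invertible G'"
  shows "herm_trace G H = herm_trace G' H'"
proof -
  define X where "X = matrix_inv G"
  define C where "C = (\<chi> i j. cnj (J $ i $ j))"
  have "G = transpose J ** G' ** C"
    by (simp add: vec_eq_iff G C_def matrix_matrix_mult_def transpose_def sum_distrib_right sum_distrib_left mult_ac)
      (subst sum.swap, simp)
  then have "transpose J ** G' ** C ** X = mat 1"
    using matrix_inv_mult(1)[OF inv(1)] unfolding X_def by metis
  then have "transpose J ** (G' ** C ** X) = mat 1"
    by (simp only: matrix_mul_assoc)
  then have "(G' ** C ** X) ** transpose J = mat 1"
    by (rule matrix_left_right_inverse[THEN iffD1])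
  then have "G' ** (C ** X ** transpose J) = mat 1"
    by (simp only: matrix_mul_assoc)
  then have Y: "matrix_inv G' = C ** X ** transpose J"
    by (rule matrix_inv_unique[OF inv(2)])
  have Ykl: "matrix_inv G' $ k $ l = (\<Sum>i\<in>UNIV. \<Sum>j\<in>UNIV. cnj (J $ k $ i) * X $ i $ j * J $ l $ j)" for k l
    unfolding Y by (simp add: C_def matrix_matrix_mult_def transpose_def sum_distrib_right sum_distrib_left mult_ac)
      (subst sum.swap, simp)
  have "(\<Sum>k\<in>UNIV. \<Sum>l\<in>UNIV. cnj (matrix_inv G' $ k $ l) * H' $ k $ l) =
     (\<Sum>k\<in>UNIV. \<Sum>l\<in>UNIV. \<Sum>i\<in>UNIV. \<Sum>j\<in>UNIV. J $ k $ i * cnj (X $ i $ j) * cnj (J $ l $ j) * H' $ k $ l)"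
    by (simp add: Ykl sum_distrib_right)
  also have "\<dots> = (\<Sum>i\<in>UNIV. \<Sum>j\<in>UNIV. \<Sum>k\<in>UNIV. \<Sum>l\<in>UNIV. J $ k $ i * cnj (X $ i $ j) * cnj (J $ l $ j) * H' $ k $ l)"
  proof -
    have "(\<Sum>k\<in>UNIV. \<Sum>l\<in>UNIV. \<Sum>i\<in>UNIV. \<Sum>j\<in>UNIV. t k l i j) =
        (\<Sum>i\<in>UNIV. \<Sum>j\<in>UNIV. \<Sum>k\<in>UNIV. \<Sum>l\<in>UNIV. t k l i j)" for t :: "'n \<Rightarrow> 'n \<Rightarrow> 'n \<Rightarrow> 'n \<Rightarrow> complex"
    proof -
      have "(\<Sum>k\<in>UNIV. \<Sum>l\<in>UNIV. \<Sum>i\<in>UNIV. \<Sum>j\<in>UNIV. t k l i j) =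
          (\<Sum>k\<in>UNIV. \<Sum>i\<in>UNIV. \<Sum>l\<in>UNIV. \<Sum>j\<in>UNIV. t k l i j)"
        by (rule sum.cong[OF refl], rule sum.swap)
      also have "\<dots> = (\<Sum>i\<in>UNIV. \<Sum>k\<in>UNIV. \<Sum>l\<in>UNIV. \<Sum>j\<in>UNIV. t k l i j)"
        by (rule sum.swap)
      also have "\<dots> = (\<Sum>i\<in>UNIV. \<Sum>k\<in>UNIV. \<Sum>j\<in>UNIV. \<Sum>l\<in>UNIV. t k l i j)"
        by (rule sum.cong[OF refl], rule sum.cong[OF refl], rule sum.swap)
      also have "\<dots> = (\<Sum>i\<in>UNIV. \<Sum>j\<in>UNIV. \<Sum>k\<in>UNIV. \<Sum>l\<in>UNIV. t k l i j)"
        by (rule sum.cong[OF refl], rule sum.swap)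
      finally show ?thesis .
    qed
    then show ?thesis .
  qed
  also have "\<dots> = (\<Sum>i\<in>UNIV. \<Sum>j\<in>UNIV. cnj (X $ i $ j) * H $ i $ j)"
    by (simp add: H sum_distrib_left mult_ac)
  finally show ?thesis by (simp add: herm_trace_def X_def)
qed

lemma herm_trace_add: "herm_trace G (H + K) = herm_trace G H + herm_trace G K"
  by (simp add: herm_trace_def algebra_simps sum.distrib)

lemma continuous_on_det:
  fixes G :: "'a::topological_space \<Rightarrow> complex ^ 'n::finite ^ 'n"
  assumes "\<And>i j. continuous_on S (\<lambda>p. G p $ i $ j)"
  shows "continuous_on S (\<lambda>p. det (G p))"
  unfolding det_def by (intro continuous_intros assms)

text \<open>By Cramer's rule the entries of the inverse are quotients of determinants.\<close>

lemma continuous_on_matrix_inv: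
  fixes G :: "'a::topological_space \<Rightarrow> complex ^ 'n::finite ^ 'n"
  assumes "\<And>i j. continuous_on S (\<lambda>p. G p $ i $ j)" "\<And>p. p \<in> S \<Longrightarrow> invertible (G p)"
  shows "continuous_on S (\<lambda>p. matrix_inv (G p) $ k $ l)"
proof -
  have d: "det (G p) \<noteq> 0" if "p \<in> S" for p using assms(2)[OF that] invertible_det_nz by blast
  have "matrix_inv (G p) $ k $ l = det (\<chi> i j. if j = k then axis l 1 $ i else G p $ i $ j) / det (G p)"
    if "p \<in> S" for p
  proof -
    have "G p *v (matrix_inv (G p) *v axis l 1) = axis l 1"
      by (simp add: matrix_vector_mul_assoc matrix_inv_mult[OF assms(2)[OF that]])
    then have "matrix_inv (G p) *v axis l 1 = (\<chi> k. det (\<chi> i j. if j = k then axis l 1 $ i else G p $ i $ j) / det (G p))"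
      using cramer[OF d[OF that]] by blast
    moreover have "(matrix_inv (G p) *v axis l 1) $ k = matrix_inv (G p) $ k $ l"
      by (simp add: matrix_vector_mult_def axis_def if_distrib cong: if_cong)
    ultimately show ?thesis by simp
  qed
  moreover have "continuous_on S (\<lambda>p. det (\<chi> i j. if j = k then axis l 1 $ i else G p $ i $ j) / det (G p))"
  proof (intro continuous_on_divide continuous_on_det assms ballI d)
    show "continuous_on S (\<lambda>p. (\<chi> i j. if j = k then axis l 1 $ i else G p $ i $ j) $ a $ b)" for a b
      using assms(1) by (cases "b = k") auto
  qed
  ultimately show ?thesis by (simp cong: continuous_on_cong)
qed

section \<open>Charts and smooth functions on a complex manifold\<close>

locale complex_mfd =
  fixes A :: "('a::{t2_space, second_countable_topology}, 'n::finite) chart set"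
  assumes manifold: "complex_manifold A"
begin

lemma chart_cover: obtains c where "c \<in> A" "p \<in> fst c"
  using manifold unfolding complex_manifold_def by blast

lemma chart_data:
  assumes "c \<in> A"
  shows "open (fst c) \<and> open (snd c ` fst c) \<and> (\<exists>\<psi>. homeomorphism (fst c) (snd c ` fst c) (snd c) \<psi>)"
  using manifold assms unfolding complex_manifold_def by (elim conjE) (drule (1) bspec)

lemma chart_open: "c \<in> A \<Longrightarrow> open (fst c)"
  by (rule conjunct1[OF chart_data])

lemma chart_homeo:
  assumes "c \<in> A"
  obtains \<psi> where "homeomorphism (fst c) (snd c ` fst c) (snd c) \<psi>" "open (snd c ` fst c)"
proof -
  from chart_data[OF assms] obtain \<psi> where "homeomorphism (fst c) (snd c ` fst c) (snd c) \<psi>"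
    by (elim conjE exE)
  with chart_data[OF assms] show thesis by (intro that) auto
qed

lemma chart_inj: assumes "c \<in> A" shows "inj_on (snd c) (fst c)"
proof -
  obtain \<psi> where "homeomorphism (fst c) (snd c ` fst c) (snd c) \<psi>" using chart_homeo[OF assms] .
  then show ?thesis by (intro inj_on_inverseI[of _ \<psi>]) (simp add: homeomorphism_def)
qed

lemma chart_continuous: assumes "c \<in> A" shows "continuous_on (fst c) (snd c)"
proof -
  obtain \<psi> where "homeomorphism (fst c) (snd c ` fst c) (snd c) \<psi>" using chart_homeo[OF assms] .
  then show ?thesis by (simp add: homeomorphism_def)
qed

lemma in_chart_eq: "c \<in> A \<Longrightarrow> p \<in> fst c \<Longrightarrow> in_chart c f (snd c p) = f p"
  by (simp add: in_chart_def chart_inj)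

lemma chart_image_open:
  assumes "c \<in> A" "open W" shows "open (snd c ` (W \<inter> fst c))"
proof -
  obtain \<psi> where h: "homeomorphism (fst c) (snd c ` fst c) (snd c) \<psi>" "open (snd c ` fst c)"
    using chart_homeo[OF assms(1)] .
  have "openin (top_of_set (fst c)) (W \<inter> fst c)"
    using openin_open_Int[OF assms(2), of "fst c"] by (simp only: Int_commute)
  then have "openin (top_of_set (snd c ` fst c)) (snd c ` (W \<inter> fst c))"
    using homeomorphism_imp_open_map[OF h(1)] by blast
  then show ?thesis using h(2) openin_open_trans by blast
qed

lemma chart_image_open': "c \<in> A \<Longrightarrow> open W \<Longrightarrow> W \<subseteq> fst c \<Longrightarrow> open (snd c ` W)"
  using chart_image_open by (metis inf.absorb1)

lemma chart_preimage_open: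
  assumes "c \<in> A" "open U" shows "open {p \<in> fst c. snd c p \<in> U}"
  using continuous_open_preimage[OF chart_continuous[OF assms(1)] chart_open[OF assms(1)] assms(2)]
  by (simp add: vimage_def Int_def)

lemma chart_inverse_continuous:
  assumes "c \<in> A" shows "continuous_on (snd c ` fst c) (inv_into (fst c) (snd c))"
proof -
  obtain \<psi> where h: "homeomorphism (fst c) (snd c ` fst c) (snd c) \<psi>"
    using chart_homeo[OF assms(1)] by blast
  then have "continuous_on (snd c ` fst c) \<psi>" by (simp add: homeomorphism_def)
  then show ?thesis
    by (rule continuous_on_eq) (use h in \<open>auto simp: homeomorphism_def chart_inj[OF assms]\<close>)
qed

lemma chart_preimage_eq:
  assumes "c \<in> A" "U \<subseteq> snd c ` fst c"
  shows "{p \<in> fst c. snd c p \<in> U} = inv_into (fst c) (snd c) ` U"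
proof (intro equalityI subsetI)
  fix p assume "p \<in> {p \<in> fst c. snd c p \<in> U}"
  then show "p \<in> inv_into (fst c) (snd c) ` U"
    by (auto intro!: image_eqI[of _ _ "snd c p"] simp: chart_inj[OF assms(1)])
next
  fix p assume "p \<in> inv_into (fst c) (snd c) ` U"
  then obtain z where z: "z \<in> U" "p = inv_into (fst c) (snd c) z" by blast
  then have "z \<in> snd c ` fst c" using assms(2) by blast
  then show "p \<in> {p \<in> fst c. snd c p \<in> U}"
    using z by (simp add: inv_into_into f_inv_into_f)
qed

lemma chart_preimage_compact:
  assumes "c \<in> A" "compact K" "K \<subseteq> snd c ` fst c"
  shows "compact {p \<in> fst c. snd c p \<in> K}"
  unfolding chart_preimage_eq[OF assms(1,3)]
  by (rule compact_continuous_image[OF continuous_on_subset[OF chart_inverse_continuous[OF assms(1)] assms(3)] assms(2)])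

lemma chart_preimage_connected:
  assumes "c \<in> A" "connected K" "K \<subseteq> snd c ` fst c"
  shows "connected {p \<in> fst c. snd c p \<in> K}"
  unfolding chart_preimage_eq[OF assms(1,3)]
  by (rule connected_continuous_image[OF continuous_on_subset[OF chart_inverse_continuous[OF assms(1)] assms(3)] assms(2)])

lemma chart_ball:
  assumes "open W" "p \<in> W"
  obtains c r where "c \<in> A" "p \<in> fst c" "0 < r" "cball (snd c p) r \<subseteq> snd c ` (W \<inter> fst c)"
proof -
  obtain c where c: "c \<in> A" "p \<in> fst c" by (rule chart_cover)
  have "open (snd c ` (W \<inter> fst c))" "snd c p \<in> snd c ` (W \<inter> fst c)"
    using chart_image_open[OF c(1) assms(1)] c assms by auto
  then obtain r where "0 < r" "cball (snd c p) r \<subseteq> snd c ` (W \<inter> fst c)"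
    using open_contains_cball by blast
  with c that show ?thesis by blast
qed

lemma chart_preimage_subset:
  assumes "c \<in> A" "U \<subseteq> snd c ` (W \<inter> fst c)" shows "{p \<in> fst c. snd c p \<in> U} \<subseteq> W"
proof
  fix p assume p: "p \<in> {p \<in> fst c. snd c p \<in> U}"
  then obtain q where "q \<in> W \<inter> fst c" "snd c p = snd c q" using assms(2) by blast
  with p show "p \<in> W" using inj_onD[OF chart_inj[OF assms(1)], of p q] by auto
qed

lemma locally_compact:
  fixes W :: "'a set"
  assumes "open W" "p \<in> W"
  obtains V K where "open V" "p \<in> V" "V \<subseteq> K" "compact K" "K \<subseteq> W"
proof -
  obtain c r where c: "c \<in> A" "p \<in> fst c" "0 < r" "cball (snd c p) r \<subseteq> snd c ` (W \<inter> fst c)"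
    using chart_ball[OF assms] .
  show ?thesis
  proof
    show "open {q \<in> fst c. snd c q \<in> ball (snd c p) r}" by (rule chart_preimage_open[OF c(1)]) simp
    show "compact {q \<in> fst c. snd c q \<in> cball (snd c p) r}"
      by (rule chart_preimage_compact[OF c(1)]) (use c in auto)
    show "{q \<in> fst c. snd c q \<in> cball (snd c p) r} \<subseteq> W" by (rule chart_preimage_subset[OF c(1,4)])
  qed (use c in auto)
qed

lemma locally_connected:
  fixes W :: "'a set"
  assumes "open W" "p \<in> W"
  obtains V where "open V" "p \<in> V" "connected V" "V \<subseteq> W"
proof -
  obtain c r where c: "c \<in> A" "p \<in> fst c" "0 < r" "cball (snd c p) r \<subseteq> snd c ` (W \<inter> fst c)"
    using chart_ball[OF assms] .
  have s: "ball (snd c p) r \<subseteq> snd c ` (W \<inter> fst c)" using c(4) ball_subset_cball by blast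
  show ?thesis
  proof
    show "open {q \<in> fst c. snd c q \<in> ball (snd c p) r}" by (rule chart_preimage_open[OF c(1)]) simp
    show "connected {q \<in> fst c. snd c q \<in> ball (snd c p) r}"
      by (rule chart_preimage_connected[OF c(1)]) (use s in auto)
    show "{q \<in> fst c. snd c q \<in> ball (snd c p) r} \<subseteq> W" by (rule chart_preimage_subset[OF c(1) s])
  qed (use c in auto)
qed

lemma transition_hol:
  assumes "c \<in> A" "d \<in> A" "S \<subseteq> snd c ` (fst c \<inter> fst d)"
  shows "hol_on S (\<lambda>z. in_chart c (snd d) z $ k)"
proof -
  have "hol_on (snd c ` (fst c \<inter> fst d)) (in_chart c (\<lambda>p. snd d p $ k))"
  proof -
    have "\<forall>c\<in>A. \<forall>d\<in>A. \<forall>k. hol_on (snd c ` (fst c \<inter> fst d)) (in_chart c (\<lambda>p. snd d p $ k))"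
      using manifold unfolding complex_manifold_def by (elim conjE)
    from spec[OF bspec[OF bspec[OF this assms(1)] assms(2)]] show ?thesis .
  qed
  then show ?thesis using hol_on_subset[OF _ assms(3)] by (simp add: in_chart_def)
qed

text \<open>Smoothness may be tested in one chart, because coordinate changes are holomorphic and
  hence smooth.\<close>

lemma smooth_fun_chart:
  fixes f :: "'a \<Rightarrow> 'b::real_normed_vector"
  assumes c: "c \<in> A" "open N" "N \<subseteq> fst c" and s: "smooth_on (snd c ` N) (in_chart c f)"
  shows "smooth_fun A N f"
  unfolding smooth_fun_def
proof
  fix d assume d: "d \<in> A"
  let ?S = "snd d ` (N \<inter> fst d)"
  have oS: "open ?S" by (rule chart_image_open[OF d c(2)])
  have "smooth_on ?S (\<lambda>z. in_chart c f (in_chart d (snd c) z))"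
  proof (rule smooth_on_compose[OF oS chart_image_open'[OF c] _ s])
    show "in_chart d (snd c) ` ?S \<subseteq> snd c ` N" by (auto simp: in_chart_eq[OF d])
    show "smooth_on ?S (in_chart d (snd c))"
      by (rule hol_map_smooth_on[OF oS transition_hol[OF d c(1)]]) (use c in auto)
  qed
  moreover have "in_chart c f (in_chart d (snd c) z) = in_chart d f z" if "z \<in> ?S" for z
    using that c by (auto simp: in_chart_eq[OF d] in_chart_eq[OF c(1)])
  ultimately show "smooth_on ?S (in_chart d f)"
    by (rule smooth_on_cong[OF oS, THEN iffD1, rotated])
qed

lemma smooth_fun_subset: "smooth_fun A W f \<Longrightarrow> V \<subseteq> W \<Longrightarrow> smooth_fun A V f"
  unfolding smooth_fun_def by (meson Int_mono image_mono order_refl smooth_on_subset)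

lemma smooth_fun_local:
  assumes "\<And>p. p \<in> W \<Longrightarrow> \<exists>N. open N \<and> p \<in> N \<and> smooth_fun A N f"
  shows "smooth_fun A W f"
  unfolding smooth_fun_def
proof
  fix c assume c: "c \<in> A"
  show "smooth_on (snd c ` (W \<inter> fst c)) (in_chart c f)"
  proof (rule smooth_on_local)
    fix z assume "z \<in> snd c ` (W \<inter> fst c)"
    then obtain p where p: "p \<in> W" "p \<in> fst c" "z = snd c p" by auto
    from assms[OF p(1)] obtain N where N: "open N" "p \<in> N" "smooth_fun A N f" by blast
    then show "\<exists>N. open N \<and> z \<in> N \<and> smooth_on N (in_chart c f)"
      using chart_image_open[OF c N(1)] c p unfolding smooth_fun_def by blast
  qed
qed

lemma smooth_fun_cong:
  assumes "open W" "\<And>p. p \<in> W \<Longrightarrow> f p = h p" "smooth_fun A W f"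
  shows "smooth_fun A W h"
  unfolding smooth_fun_def
proof
  fix c assume c: "c \<in> A"
  have "smooth_on (snd c ` (W \<inter> fst c)) (in_chart c f) \<longleftrightarrow> smooth_on (snd c ` (W \<inter> fst c)) (in_chart c h)"
    by (rule smooth_on_cong[OF chart_image_open[OF c assms(1)]]) (auto simp: in_chart_eq[OF c] assms(2))
  then show "smooth_on (snd c ` (W \<inter> fst c)) (in_chart c h)"
    using assms(3) c unfolding smooth_fun_def by blast
qed

lemma smooth_fun_const: "smooth_fun A W (\<lambda>_. c)"
  unfolding smooth_fun_def in_chart_def by (simp add: smooth_on_const)

lemma smooth_fun_add:
  "open W \<Longrightarrow> smooth_fun A W f \<Longrightarrow> smooth_fun A W h \<Longrightarrow> smooth_fun A W (\<lambda>p. f p + h p)"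
  unfolding smooth_fun_def in_chart_def using smooth_on_add chart_image_open by blast

lemma smooth_fun_bilinear:
  "bounded_bilinear B \<Longrightarrow> open W \<Longrightarrow> smooth_fun A W f \<Longrightarrow> smooth_fun A W h \<Longrightarrow> smooth_fun A W (\<lambda>p. B (f p) (h p))"
  unfolding smooth_fun_def in_chart_def using smooth_on_bilinear chart_image_open by blast

lemmas smooth_fun_mult = smooth_fun_bilinear[OF bounded_bilinear_mult]

lemma smooth_fun_sum:
  "open W \<Longrightarrow> (\<And>i. i \<in> I \<Longrightarrow> smooth_fun A W (f i)) \<Longrightarrow> smooth_fun A W (\<lambda>p. \<Sum>i\<in>I. f i p)"
  by (induction I rule: infinite_finite_induct) (auto intro: smooth_fun_const smooth_fun_add)

lemma smooth_fun_compose: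
  fixes f :: "'a \<Rightarrow> 'b::euclidean_space"
  assumes "open W" "smooth_fun A W f" "open T" "smooth_on T \<theta>" "f ` W \<subseteq> T"
  shows "smooth_fun A W (\<lambda>p. \<theta> (f p))"
  unfolding smooth_fun_def
proof
  fix c assume c: "c \<in> A"
  have "smooth_on (snd c ` (W \<inter> fst c)) (\<lambda>z. \<theta> (in_chart c f z))"
  proof (rule smooth_on_compose[OF chart_image_open[OF c assms(1)] assms(3) _ assms(4)])
    show "in_chart c f ` snd c ` (W \<inter> fst c) \<subseteq> T" using assms(5) by (auto simp: in_chart_eq[OF c])
    show "smooth_on (snd c ` (W \<inter> fst c)) (in_chart c f)" using assms(2) c unfolding smooth_fun_def by blast
  qed
  then show "smooth_on (snd c ` (W \<inter> fst c)) (in_chart c (\<lambda>p. \<theta> (f p)))" by (simp add: in_chart_def)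
qed

lemma smooth_fun_exp: "open W \<Longrightarrow> smooth_fun A W f \<Longrightarrow> smooth_fun A W (\<lambda>p. exp (f p :: real))"
  by (rule smooth_fun_compose[OF _ _ open_UNIV smooth_on_exp]) auto

lemma smooth_fun_ln: "open W \<Longrightarrow> smooth_fun A W f \<Longrightarrow> (\<And>p. p \<in> W \<Longrightarrow> 0 < f p) \<Longrightarrow> smooth_fun A W (\<lambda>p. ln (f p :: real))"
  by (rule smooth_fun_compose[OF _ _ open_greaterThan smooth_on_ln]) auto

lemma smooth_fun_cmult: "open W \<Longrightarrow> smooth_fun A W f \<Longrightarrow> smooth_fun A W (\<lambda>p. c * f p :: real)"
  by (rule smooth_fun_mult[OF _ smooth_fun_const])

lemma smooth_fun_minus: "open W \<Longrightarrow> smooth_fun A W f \<Longrightarrow> smooth_fun A W (\<lambda>p. - f p :: real)"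
  using smooth_fun_cmult[of W f "-1"] by simp

lemma smooth_fun_norm_sq:
  assumes "open W" "smooth_fun A W (f :: 'a \<Rightarrow> complex)" shows "smooth_fun A W (\<lambda>p. (norm (f p))\<^sup>2)"
  using smooth_fun_bilinear[OF bounded_bilinear_inner assms assms(2)] by (simp add: power2_norm_eq_inner)

lemma holomorphic_fun_smooth:
  assumes "open W" "holomorphic_fun A W f" shows "smooth_fun A W f"
  unfolding smooth_fun_def
  using assms(2) hol_on_smooth_on[OF chart_image_open[OF _ assms(1)]] unfolding holomorphic_fun_def by blast

lemma holomorphic_fun_subset: "holomorphic_fun A W f \<Longrightarrow> V \<subseteq> W \<Longrightarrow> holomorphic_fun A V f"
  unfolding holomorphic_fun_def by (meson Int_mono hol_on_subset image_mono order_refl)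

lemma smooth_fun_continuous:
  assumes "open W" "smooth_fun A W f" shows "continuous_on W f"
proof (rule continuous_at_imp_continuous_on, rule ballI)
  fix p assume p: "p \<in> W"
  obtain c where c: "c \<in> A" "p \<in> fst c" by (rule chart_cover)
  have "continuous_on (W \<inter> fst c) (\<lambda>q. in_chart c f (snd c q))"
  proof (rule continuous_on_compose2[where g = "in_chart c f" and f = "snd c"])
    show "continuous_on (snd c ` (W \<inter> fst c)) (in_chart c f)"
      using assms(2) c(1) unfolding smooth_fun_def by (auto intro: smooth_on_continuous)
    show "continuous_on (W \<inter> fst c) (snd c)" using continuous_on_subset[OF chart_continuous[OF c(1)]] by simp
  qed auto
  then have "continuous_on (W \<inter> fst c) f"
    by (rule continuous_on_eq) (simp add: in_chart_eq[OF c(1)])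
  then show "isCont f p"
    using continuous_on_eq_continuous_at[of "W \<inter> fst c" f] assms(1) chart_open[OF c(1)] c p by auto
qed

end

section \<open>The Laplacian on a Hermitian manifold\<close>

locale hermitian_mfd = complex_mfd A for A :: "('a::{t2_space, second_countable_topology}, 'n::finite) chart set" +
  fixes g :: "('a, 'n) tensor"
  assumes metric: "hermitian_metric A g"
begin

lemma metric_posdef: "c \<in> A \<Longrightarrow> p \<in> fst c \<Longrightarrow> posdef (g c p)"
  using metric[unfolded hermitian_metric_def, THEN bspec, THEN conjunct2, THEN conjunct1, THEN bspec, THEN conjunct2]
  unfolding posdef_def by simp

lemma metric_invertible: "c \<in> A \<Longrightarrow> p \<in> fst c \<Longrightarrow> invertible (g c p)"
  by (rule posdef_invertible[OF metric_posdef])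

lemma metric_inv_continuous:
  assumes c: "c \<in> A" shows "continuous_on (fst c) (\<lambda>p. matrix_inv (g c p) $ i $ j)"
proof (rule continuous_on_matrix_inv[OF _ metric_invertible[OF c]])
  fix i j
  have "smooth_on (snd c ` fst c) (in_chart c (\<lambda>p. g c p $ i $ j))"
    using metric[unfolded hermitian_metric_def, THEN bspec, OF c] by (elim conjE allE)
  then have "smooth_fun A (fst c) (\<lambda>p. g c p $ i $ j)"
    by (rule smooth_fun_chart[OF c chart_open[OF c] order_refl])
  then show "continuous_on (fst c) (\<lambda>p. g c p $ i $ j)"
    by (rule smooth_fun_continuous[OF chart_open[OF c]])
qed

lemma laplacian_levi: "laplacian g \<phi> c p = herm_trace (g c p) (levi_matrix (in_chart c \<phi>) (snd c p))"
  by (simp add: laplacian_def levi_form_def levi_matrix_def in_chart_def)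

lemma laplacian_chart_independent:
  assumes W: "open W" "p \<in> W" "smooth_fun A W \<phi>"
    and c: "c \<in> A" "p \<in> fst c" and d: "d \<in> A" "p \<in> fst d"
  shows "laplacian g \<phi> c p = laplacian g \<phi> d p"
  unfolding laplacian_levi
proof (rule herm_trace_congruence[where J = "\<chi> k i. d_z i (in_chart c (\<lambda>q. snd d q $ k)) (snd c p)"])
  let ?S = "snd c ` (W \<inter> fst d \<inter> fst c)"
  let ?F = "in_chart c (snd d)"
  have oS: "open ?S" using chart_image_open[OF c(1)] W(1) chart_open[OF d(1)] by blast
  have pS: "snd c p \<in> ?S" using W c d by blast
  have Fp: "?F (snd c p) = snd d p" using in_chart_eq[OF c] .
  show "g c p $ i $ j = (\<Sum>k\<in>UNIV. \<Sum>l\<in>UNIV. g d p $ k $ l *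
      (\<chi> k i. d_z i (in_chart c (\<lambda>q. snd d q $ k)) (snd c p)) $ k $ i *
      cnj ((\<chi> k i. d_z i (in_chart c (\<lambda>q. snd d q $ k)) (snd c p)) $ l $ j))" for i j
    using metric[unfolded hermitian_metric_def, rule_format, OF c(1), THEN conjunct2, THEN conjunct2,
        rule_format, OF d(1) IntI[OF c(2) d(2)], of i j] by simp
  have eq: "levi_matrix (in_chart c \<phi>) (snd c p) = levi_matrix (\<lambda>z. in_chart d \<phi> (?F z)) (snd c p)"
    by (rule levi_cong[OF oS pS]) (auto simp: in_chart_eq[OF c(1)] in_chart_eq[OF d(1)])
  have "levi_matrix (\<lambda>z. in_chart d \<phi> (?F z)) (snd c p) $ i $ j =
    (\<Sum>k\<in>UNIV. \<Sum>l\<in>UNIV. levi_matrix (in_chart d \<phi>) (?F (snd c p)) $ k $ l * d_z i (\<lambda>z. ?F z $ k) (snd c p) *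
       cnj (d_z j (\<lambda>z. ?F z $ l) (snd c p)))" for i j
  proof (rule levi_hol_compose[OF oS _ pS chart_image_open[OF d(1) W(1)]])
    show "hol_on ?S (\<lambda>z. ?F z $ k)" for k by (rule transition_hol[OF c(1) d(1)]) blast
    show "smooth_on (snd d ` (W \<inter> fst d)) (in_chart d \<phi>)" using W(3) d(1) unfolding smooth_fun_def by blast
    show "?F ` ?S \<subseteq> snd d ` (W \<inter> fst d)" by (auto simp: in_chart_eq[OF c(1)])
  qed
  then show "levi_matrix (in_chart c \<phi>) (snd c p) $ i $ j = (\<Sum>k\<in>UNIV. \<Sum>l\<in>UNIV. levi_matrix (in_chart d \<phi>) (snd d p) $ k $ l *
      (\<chi> k i. d_z i (in_chart c (\<lambda>q. snd d q $ k)) (snd c p)) $ k $ i *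
      cnj ((\<chi> k i. d_z i (in_chart c (\<lambda>q. snd d q $ k)) (snd c p)) $ l $ j))" for i j
    unfolding eq Fp by (simp add: in_chart_def)
qed (use metric_invertible c d in auto)

text \<open>The Laplacian computed in an arbitrarily chosen chart around each point. For functions that are
  smooth near the point, the choice is immaterial by \<open>lap_chart\<close>.\<close>

definition lap :: "('a \<Rightarrow> real) \<Rightarrow> 'a \<Rightarrow> real" where
  "lap \<phi> p = laplacian g \<phi> (SOME c. c \<in> A \<and> p \<in> fst c) p"

lemma lap_chart:
  assumes "open W" "p \<in> W" "smooth_fun A W \<phi>" "c \<in> A" "p \<in> fst c"
  shows "lap \<phi> p = laplacian g \<phi> c p"
proof -
  have "(SOME c. c \<in> A \<and> p \<in> fst c) \<in> A \<and> p \<in> fst (SOME c. c \<in> A \<and> p \<in> fst c)"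
    by (rule someI_ex) (use assms in blast)
  then show ?thesis unfolding lap_def using laplacian_chart_independent assms by blast
qed

lemma lap_cong:
  assumes "open W" "p \<in> W" "\<And>q. q \<in> W \<Longrightarrow> \<phi> q = \<psi> q"
  shows "lap \<phi> p = lap \<psi> p"
proof -
  define c where "c = (SOME c. c \<in> A \<and> p \<in> fst c)"
  have c: "c \<in> A" "p \<in> fst c" unfolding c_def using someI_ex[of "\<lambda>c. c \<in> A \<and> p \<in> fst c"] chart_cover by metis+
  have "levi_matrix (in_chart c \<phi>) (snd c p) = levi_matrix (in_chart c \<psi>) (snd c p)"
    by (rule levi_cong[OF chart_image_open[OF c(1) assms(1)]]) (use assms c in \<open>auto simp: in_chart_eq[OF c(1)]\<close>)
  then show ?thesis unfolding lap_def laplacian_levi c_def[symmetric] by simp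
qed

lemma lap_add:
  assumes "open W" "p \<in> W" "smooth_fun A W \<phi>" "smooth_fun A W \<psi>"
  shows "lap (\<lambda>q. \<phi> q + \<psi> q) p = lap \<phi> p + lap \<psi> p"
proof -
  obtain c where c: "c \<in> A" "p \<in> fst c" by (rule chart_cover)
  have "levi_matrix (in_chart c (\<lambda>q. \<phi> q + \<psi> q)) (snd c p) = levi_matrix (in_chart c \<phi>) (snd c p) + levi_matrix (in_chart c \<psi>) (snd c p)"
    using levi_add[OF chart_image_open[OF c(1) assms(1)], of "in_chart c \<phi>" "in_chart c \<psi>" "snd c p"] assms c
    unfolding smooth_fun_def by (auto simp: in_chart_def)
  then show ?thesis
    unfolding lap_chart[OF assms(1,2) smooth_fun_add[OF assms(1,3,4)] c] lap_chart[OF assms(1-3) c]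
      lap_chart[OF assms(1,2,4) c] laplacian_levi by (simp add: herm_trace_add)
qed

text \<open>The squared length of the \<open>(1,0)\<close> part of \<open>d\<phi>\<close> with respect to the metric, in the chart \<open>c\<close>.\<close>

definition gradsq :: "('a \<Rightarrow> real) \<Rightarrow> ('a, 'n) chart \<Rightarrow> 'a \<Rightarrow> real" where
  "gradsq \<phi> c p = Re (\<Sum>i\<in>UNIV. \<Sum>j\<in>UNIV. cnj (matrix_inv (g c p) $ i $ j) *
     (d_z i (\<lambda>z. complex_of_real (in_chart c \<phi> z)) (snd c p) * cnj (d_z j (\<lambda>z. complex_of_real (in_chart c \<phi> z)) (snd c p))))"

lemma gradsq_nonneg:
  assumes "c \<in> A" "p \<in> fst c" shows "0 \<le> gradsq \<phi> c p"
proof (cases "(\<chi> i. d_z i (\<lambda>z. complex_of_real (in_chart c \<phi> z)) (snd c p)) = 0")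
  case True
  then have "d_z i (\<lambda>z. complex_of_real (in_chart c \<phi> z)) (snd c p) = 0" for i by (simp add: vec_eq_iff)
  then show ?thesis by (simp add: gradsq_def)
next
  case False
  from posdef_matrix_inv[OF metric_posdef[OF assms] this] show ?thesis by (simp add: gradsq_def)
qed

text \<open>The form used for explicit computations in a given chart; the next lemma hides the
  gradient behind an unspecified nonnegative number.\<close>

lemma lap_compose_chart:
  assumes W: "open W" "p \<in> W" "smooth_fun A W \<phi>" "smooth_fun A W (\<lambda>q. \<theta> (\<phi> q))"
    and U: "open U" "\<phi> p \<in> U" "\<And>x. x \<in> U \<Longrightarrow> (\<theta> has_real_derivative \<theta>1 x) (at x)"
      "(\<theta>1 has_real_derivative t2) (at (\<phi> p))"
    and c: "c \<in> A" "p \<in> fst c"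
  shows "lap (\<lambda>q. \<theta> (\<phi> q)) p = \<theta>1 (\<phi> p) * lap \<phi> p + t2 * gradsq \<phi> c p"
proof -
  have s: "smooth_on (snd c ` (W \<inter> fst c)) (in_chart c \<phi>)" using W(3) c unfolding smooth_fun_def by blast
  have z: "snd c p \<in> snd c ` (W \<inter> fst c)" using W c by blast
  note l = levi_real_compose[OF chart_image_open[OF c(1) W(1)] s z U(1), of \<theta> \<theta>1 t2,
      unfolded in_chart_eq[OF c], OF U(2,3,4)]
  have e: "in_chart c (\<lambda>q. \<theta> (\<phi> q)) = (\<lambda>z. \<theta> (in_chart c \<phi> z))" by (simp add: in_chart_def)
  show ?thesis
    unfolding lap_chart[OF W(1,2,4) c] lap_chart[OF W(1-3) c] laplacian_levi e herm_trace_def gradsq_def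
    by (simp only: l) (simp add: algebra_simps sum.distrib sum_distrib_left)
qed

lemma lap_compose:
  assumes W: "open W" "p \<in> W" "smooth_fun A W \<phi>" "smooth_fun A W (\<lambda>q. \<theta> (\<phi> q))"
    and U: "open U" "\<phi> p \<in> U" "\<And>x. x \<in> U \<Longrightarrow> (\<theta> has_real_derivative \<theta>1 x) (at x)"
      "(\<theta>1 has_real_derivative t2) (at (\<phi> p))"
  obtains q where "0 \<le> q" "lap (\<lambda>q. \<theta> (\<phi> q)) p = \<theta>1 (\<phi> p) * lap \<phi> p + t2 * q"
proof -
  obtain c where c: "c \<in> A" "p \<in> fst c" by (rule chart_cover)
  show ?thesis using that gradsq_nonneg[OF c] lap_compose_chart[OF assms c] by blast
qed

lemma lap_cmult:
  assumes "open W" "p \<in> W" "smooth_fun A W \<phi>"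
  shows "lap (\<lambda>q. a * \<phi> q) p = a * lap \<phi> p"
proof -
  have "((\<lambda>x. a * x) has_real_derivative a) (at x)" for x by (auto intro!: derivative_eq_intros)
  then obtain q where "lap (\<lambda>q. a * \<phi> q) p = a * lap \<phi> p + 0 * q"
    using lap_compose[where \<theta> = "\<lambda>x. a * x" and ?\<theta>1.0 = "\<lambda>_. a" and ?t2.0 = 0,
        OF assms smooth_fun_cmult[OF assms(1,3)] open_UNIV] by auto
  then show ?thesis by simp
qed

lemma lap_const: "lap (\<lambda>_. c) p = 0"
proof -
  have "d_zbar j (\<lambda>z. complex_of_real (in_chart d (\<lambda>_. c) z)) = (\<lambda>z. 0)" for d :: "('a, 'n) chart" and j
    unfolding in_chart_def by (rule ext) (rule d_z_const(2))
  then show ?thesis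
    unfolding lap_def laplacian_levi levi_matrix_def herm_trace_def by (simp add: d_z_const)
qed

lemma lap_sum:
  assumes "finite I" "open W" "p \<in> W" "\<And>i. i \<in> I \<Longrightarrow> smooth_fun A W (\<phi> i)"
  shows "lap (\<lambda>q. \<Sum>i\<in>I. \<phi> i q) p = (\<Sum>i\<in>I. lap (\<phi> i) p)"
  using assms(1,4)
proof (induction I rule: finite_induct)
  case empty then show ?case by (simp add: lap_const)
next
  case (insert i I)
  then have "lap (\<lambda>q. \<phi> i q + (\<Sum>i\<in>I. \<phi> i q)) p = lap (\<phi> i) p + lap (\<lambda>q. \<Sum>i\<in>I. \<phi> i q) p"
    by (intro lap_add[OF assms(2,3)] smooth_fun_sum[OF assms(2)]) auto
  with insert show ?case by simp
qed

lemma lap_continuous: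
  assumes "open W" "smooth_fun A W \<phi>" shows "continuous_on W (lap \<phi>)"
proof (rule continuous_at_imp_continuous_on, rule ballI)
  fix p assume p: "p \<in> W"
  obtain c where c: "c \<in> A" "p \<in> fst c" by (rule chart_cover)
  have s: "smooth_on (snd c ` (W \<inter> fst c)) (in_chart c \<phi>)" using assms(2) c unfolding smooth_fun_def by blast
  have "continuous_on (W \<inter> fst c) (\<lambda>q. levi_matrix (in_chart c \<phi>) (snd c q) $ i $ j)" for i j
  proof (rule continuous_on_compose2[where g = "\<lambda>z. levi_matrix (in_chart c \<phi>) z $ i $ j" and f = "snd c"])
    show "continuous_on (snd c ` (W \<inter> fst c)) (\<lambda>z. levi_matrix (in_chart c \<phi>) z $ i $ j)"
      by (rule smooth_on_continuous[OF smooth_on_levi[OF chart_image_open[OF c(1) assms(1)] s]])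
    show "continuous_on (W \<inter> fst c) (snd c)" using continuous_on_subset[OF chart_continuous[OF c(1)]] by simp
  qed auto
  then have "continuous_on (W \<inter> fst c) (laplacian g \<phi> c)"
    unfolding laplacian_levi herm_trace_def
    by (intro continuous_on_Re continuous_on_sum continuous_on_mult continuous_on_cnj
        continuous_on_subset[OF metric_inv_continuous[OF c(1)]]) auto
  then have "continuous_on (W \<inter> fst c) (lap \<phi>)"
    by (rule continuous_on_eq) (use lap_chart[OF assms(1) _ assms(2) c(1)] in auto)
  then show "isCont (lap \<phi>) p"
    using continuous_on_eq_continuous_at[of "W \<inter> fst c" "lap \<phi>"] assms(1) chart_open[OF c(1)] c p by auto
qed

lemma lap_ln_norm_sq_holomorphic:
  assumes W: "open W" "p \<in> W" "holomorphic_fun A W f" "\<And>q. q \<in> W \<Longrightarrow> f q \<noteq> 0"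
  shows "lap (\<lambda>q. ln ((norm (f q))\<^sup>2)) p = 0"
proof -
  obtain c where c: "c \<in> A" "p \<in> fst c" by (rule chart_cover)
  have s: "smooth_fun A W (\<lambda>q. ln ((norm (f q))\<^sup>2))"
    by (intro smooth_fun_ln smooth_fun_norm_sq holomorphic_fun_smooth W) (use W(4) in auto)
  have "levi_matrix (\<lambda>z. ln ((norm (in_chart c f z))\<^sup>2)) (snd c p) = 0"
  proof (rule levi_ln_norm_sq_hol[OF chart_image_open[OF c(1) W(1)]])
    show "hol_on (snd c ` (W \<inter> fst c)) (in_chart c f)" using W(3) c unfolding holomorphic_fun_def by blast
  qed (use W c in \<open>auto simp: in_chart_eq[OF c(1)]\<close>)
  then show ?thesis unfolding lap_chart[OF W(1,2) s c] laplacian_levi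
    by (simp add: in_chart_def herm_trace_def)
qed

end

section \<open>Bumps whose Laplacian is negative only near the centre\<close>

lemma compact_positive_lower_bound:
  fixes f :: "'b::topological_space \<Rightarrow> real"
  assumes "compact K" "continuous_on K f" "\<And>x. x \<in> K \<Longrightarrow> 0 < f x"
  obtains m where "0 < m" "\<And>x. x \<in> K \<Longrightarrow> m \<le> f x"
proof (cases "K = {}")
  case True then show ?thesis using that[of 1] by auto
next
  case False
  from continuous_attains_inf[OF assms(1) False assms(2)] assms(3) that show ?thesis by metis
qed

lemma compact_abs_bound:
  fixes f :: "'b::topological_space \<Rightarrow> real"
  assumes "compact K" "continuous_on K f"
  obtains M where "0 \<le> M" "\<And>x. x \<in> K \<Longrightarrow> \<bar>f x\<bar> \<le> M"
proof (cases "K = {}")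
  case True then show ?thesis using that[of 0] by auto
next
  case False
  have "continuous_on K (\<lambda>x. \<bar>f x\<bar>)" using assms(2) by (intro continuous_intros)
  from continuous_attains_sup[OF assms(1) False this] that show ?thesis by (metis abs_ge_zero order_trans)
qed

context hermitian_mfd begin

lemma lap_eq_0_off_closed:
  assumes "closed K" "\<And>q. q \<notin> K \<Longrightarrow> \<phi> q = 0" "p \<notin> K"
  shows "lap \<phi> p = 0"
proof -
  have "lap \<phi> p = lap (\<lambda>_. 0) p"
    by (rule lap_cong[of "- K"]) (use assms in auto)
  then show ?thesis by (simp add: lap_const)
qed

text \<open>The bracket in the Laplacian of \<open>exp (- a/d)\<close>, where \<open>d = r\<^sup>2 - \<bar>z\<bar>\<^sup>2\<close>: here \<open>t\<close> is the Laplacian of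
  \<open>\<bar>z\<bar>\<^sup>2\<close>, and \<open>q\<close> the squared length of its gradient. The gradient term grows like \<open>a / d\<^sup>2\<close> relative to
  the other one, so it wins for large \<open>a\<close> once \<open>q\<close> is bounded below by some \<open>m > 0\<close>.\<close>

lemma bump_estimate:
  fixes a d q t m M :: real
  assumes "0 < d" "d \<le> R" "0 < m" "m \<le> q" "t \<le> M" "0 \<le> M" "a = 2 * R + R\<^sup>2 * (M + 1) / m"
  shows "0 < - (1 / a) * (a / d)\<^sup>2 * t + (1 / a\<^sup>2) * ((a / d)\<^sup>2 * ((a / d)\<^sup>2 - 2 * (a / d))) * q"
proof -
  have a: "0 < a" using assms by (simp add: add_pos_nonneg)
  have "(M + 1) * d\<^sup>2 \<le> (M + 1) * R\<^sup>2"
    using assms by (intro mult_left_mono power_mono) auto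
  also have "\<dots> = (a - 2 * R) * m" using assms(3,7) by (simp add: field_simps)
  also have "\<dots> \<le> (a - 2 * d) * q"
  proof (rule mult_mono)
    have "0 \<le> R\<^sup>2 * (M + 1) / m" using assms by simp
    then show "a - 2 * R \<le> a - 2 * d" "0 \<le> a - 2 * d" using assms(2,7) by linarith+
  qed (use assms in auto)
  finally have "(M + 1) * d\<^sup>2 \<le> (a - 2 * d) * q" .
  moreover have "t * d\<^sup>2 < (M + 1) * d\<^sup>2" using assms(1,5) by (intro mult_strict_right_mono) auto
  ultimately have "t * d\<^sup>2 < (a - 2 * d) * q" by linarith
  then have "0 < ((a - 2 * d) * q - t * d\<^sup>2) * (a / d ^ 4)" using a assms(1) by simp
  also have "\<dots> = - (1 / a) * (a / d)\<^sup>2 * t + (1 / a\<^sup>2) * ((a / d)\<^sup>2 * ((a / d)\<^sup>2 - 2 * (a / d))) * q"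
    using a assms(1) by (simp add: field_simps power2_eq_square power4_eq_xxxx)
  finally show ?thesis .
qed

text \<open>The function \<open>exp (- a / (r\<^sup>2 - \<bar>z - z0\<bar>\<^sup>2))\<close>. The gradient of \<open>\<bar>z - z0\<bar>\<^sup>2\<close> vanishes only at the
  centre, so the lower bound in \<open>bump_estimate\<close> holds on the shell between the radii \<open>r'\<close> and \<open>r\<close>.\<close>

lemma bump:
  assumes c: "c \<in> A" and r: "0 < r'" "r' < r" "cball z0 r \<subseteq> snd c ` fst c"
  obtains \<alpha> where "smooth_fun A UNIV \<alpha>" "\<And>p. 0 \<le> \<alpha> p"
    "\<And>p. p \<in> fst c \<Longrightarrow> snd c p \<in> ball z0 r \<Longrightarrow> 0 < \<alpha> p"
    "\<And>p. \<not> (p \<in> fst c \<and> snd c p \<in> ball z0 r) \<Longrightarrow> \<alpha> p = 0"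
    "\<And>p. p \<in> fst c \<Longrightarrow> snd c p \<in> ball z0 r - ball z0 r' \<Longrightarrow> 0 < lap \<alpha> p"
    "\<And>p. \<not> (p \<in> fst c \<and> snd c p \<in> ball z0 r) \<Longrightarrow> lap \<alpha> p = 0"
proof -
  define D where "D p = (norm (snd c p - z0))\<^sup>2" for p
  have oc: "open (fst c)" and oS: "open (snd c ` fst c)"
    using chart_open[OF c] chart_image_open'[OF c] by auto
  have inD: "in_chart c D z = (norm (z - z0))\<^sup>2" if "z \<in> snd c ` fst c" for z
    using that by (auto simp: in_chart_eq[OF c] D_def)
  have sD: "smooth_fun A (fst c) D"
    by (rule smooth_fun_chart[OF c oc order_refl])
      (rule smooth_on_cong[OF oS, THEN iffD1, rotated, OF smooth_on_dist_sq[OF oS, of z0]], simp add: inD)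
  define M where "M p = matrix_inv (g c p)" for p
  have cM: "continuous_on (fst c) (\<lambda>p. M p $ i $ j)" for i j
    unfolding M_def by (rule metric_inv_continuous[OF c])
  define tr where "tr p = Re (\<Sum>i\<in>UNIV. cnj (M p $ i $ i))" for p
  define q where "q p = Re (\<Sum>i\<in>UNIV. \<Sum>j\<in>UNIV. cnj (M p $ i $ j) * (cnj ((snd c p - z0) $ i) * (snd c p - z0) $ j))" for p
  have cc: "continuous_on (fst c) (\<lambda>p. snd c p - z0)"
    by (intro continuous_intros chart_continuous[OF c])
  have ctr: "continuous_on (fst c) tr" unfolding tr_def
    by (intro continuous_on_Re continuous_on_sum continuous_on_cnj cM)
  have cq: "continuous_on (fst c) q" unfolding q_def
    by (intro continuous_on_Re continuous_on_sum continuous_on_mult continuous_on_cnj cM continuous_on_component cc)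
  \<comment> \<open>The Levi matrix of \<open>D\<close> is the identity, so its Laplacian is the trace of the conjugate inverse metric.\<close>
  have lapD: "lap D p = tr p" if p: "p \<in> fst c" for p
  proof -
    have "levi_matrix (in_chart c D) (snd c p) = levi_matrix (\<lambda>z. (norm (z - z0))\<^sup>2) (snd c p)"
      by (rule levi_cong[OF oS]) (use p inD in auto)
    then show ?thesis
      unfolding lap_chart[OF oc p sD c p] laplacian_levi herm_trace_def tr_def M_def
      by (simp add: dist_sq_wirtinger(2) if_distrib cong: if_cong)
  qed
  have gD: "gradsq D c p = q p" if p: "p \<in> fst c" for p
  proof -
    have "d_z i (\<lambda>z. complex_of_real (in_chart c D z)) (snd c p) = cnj (snd c p $ i - z0 $ i)" for i
      unfolding dist_sq_wirtinger(1)[symmetric]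
      by (rule d_z_cong(1)[OF oS]) (use p inD in auto)
    then show ?thesis unfolding gradsq_def q_def M_def by simp
  qed
  have qpos: "0 < q p" if p: "p \<in> fst c" "snd c p \<noteq> z0" for p
  proof -
    have "(\<chi> i. cnj ((snd c p - z0) $ i)) \<noteq> 0" using p(2) by (auto simp: vec_eq_iff)
    from posdef_matrix_inv[OF metric_posdef[OF c p(1)] this] show ?thesis
      by (simp add: q_def M_def)
  qed
  define K where "K = {p \<in> fst c. snd c p \<in> cball z0 r}"
  define K' where "K' = {p \<in> fst c. snd c p \<in> cball z0 r - ball z0 r'}"
  have cK: "compact K" unfolding K_def by (rule chart_preimage_compact[OF c _ r(3)]) simp
  have cK': "compact K'" unfolding K'_def
    by (rule chart_preimage_compact[OF c]) (use r(3) in \<open>auto intro: compact_diff\<close>)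
  have sub: "K' \<subseteq> fst c" by (auto simp: K'_def)
  obtain m where m: "0 < m" "\<And>p. p \<in> K' \<Longrightarrow> m \<le> q p"
    by (rule compact_positive_lower_bound[OF cK' continuous_on_subset[OF cq sub]])
      (use r in \<open>auto simp: K'_def intro!: qpos\<close>)
  obtain B where B: "0 \<le> B" "\<And>p. p \<in> K' \<Longrightarrow> \<bar>tr p\<bar> \<le> B"
    by (rule compact_abs_bound[OF cK' continuous_on_subset[OF ctr sub]]) auto
  define a where "a = 2 * r\<^sup>2 + (r\<^sup>2)\<^sup>2 * (B + 1) / m"
  have r0: "0 < r" using r by simp
  have a0: "0 < a" unfolding a_def using r0 B m by (intro add_pos_nonneg) auto
  define F where "F p = (r\<^sup>2 - D p) / a" for p
  define \<alpha> where "\<alpha> p = (if p \<in> fst c then flat_poly 1 (F p) else 0)" for p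
  have inball: "snd c p \<in> ball z0 \<rho> \<longleftrightarrow> D p < \<rho>\<^sup>2" if "0 < \<rho>" for p \<rho>
    unfolding D_def using that by (simp add: dist_norm norm_minus_commute abs_le_square_iff[symmetric] not_le[symmetric])
  have F_pos: "0 < F p \<longleftrightarrow> snd c p \<in> ball z0 r" for p
    unfolding F_def inball[OF r0] using a0 by (simp add: field_simps)
  have off: "\<alpha> p = 0" if "p \<notin> K" for p
    using that F_pos[of p] by (auto simp: \<alpha>_def K_def flat_poly_def)
  have sF: "smooth_fun A (fst c) F"
    using smooth_fun_add[OF oc smooth_fun_const[of _ "r\<^sup>2 / a"] smooth_fun_cmult[OF oc sD, of "- 1 / a"]]
    by (simp add: F_def[abs_def] diff_divide_distrib)
  have s1: "smooth_fun A (fst c) (\<lambda>p. flat_poly 1 ((r\<^sup>2 - D p) / a))"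
    using smooth_fun_compose[OF oc sF open_UNIV smooth_on_flat_poly] by (simp add: F_def)
  have s: "smooth_fun A UNIV \<alpha>"
  proof (rule smooth_fun_local)
    fix p :: 'a
    show "\<exists>N. open N \<and> p \<in> N \<and> smooth_fun A N \<alpha>"
    proof (cases "p \<in> fst c")
      case True
      have "smooth_fun A (fst c) \<alpha>"
        by (rule smooth_fun_cong[OF oc _ s1]) (simp add: \<alpha>_def F_def)
      with True oc show ?thesis by blast
    next
      case False
      have "smooth_fun A (- K) \<alpha>"
        by (rule smooth_fun_cong[OF _ _ smooth_fun_const[of _ 0]]) (use cK off in \<open>auto simp: compact_imp_closed\<close>)
      with False cK show ?thesis by (intro exI[of _ "- K"]) (auto simp: K_def compact_imp_closed)
    qed
  qed
  \<comment> \<open>The polynomials that belong to the first two derivatives of the flat function.\<close>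
  define P1 where "P1 = (monom 1 2 :: real poly)"
  define P2 where "P2 = monom 1 2 * (P1 - pderiv P1)"
  have dl: "((\<lambda>s. (r\<^sup>2 - s) / a) has_real_derivative - (1 / a)) (at x)" for x
    using a0 by (auto intro!: derivative_eq_intros)
  have d1: "((\<lambda>s. flat_poly 1 ((r\<^sup>2 - s) / a)) has_real_derivative - (1 / a) * flat_poly P1 ((r\<^sup>2 - x) / a)) (at x)" for x
    using DERIV_chain2[OF flat_poly_has_derivative[of 1] dl, of x] by (simp add: P1_def pderiv_1 mult.commute)
  have d2: "((\<lambda>s. - (1 / a) * flat_poly P1 ((r\<^sup>2 - s) / a)) has_real_derivative (1 / a\<^sup>2) * flat_poly P2 ((r\<^sup>2 - x) / a)) (at x)" for x
    using DERIV_cmult[OF DERIV_chain2[OF flat_poly_has_derivative[of P1] dl, of x], of "- (1 / a)"]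
    by (simp add: P2_def power2_eq_square mult.commute)
  have lap1: "lap \<alpha> p = - (1 / a) * flat_poly P1 (F p) * tr p + (1 / a\<^sup>2) * flat_poly P2 (F p) * q p" if p: "p \<in> fst c" for p
  proof -
    have "lap \<alpha> p = lap (\<lambda>p. flat_poly 1 ((r\<^sup>2 - D p) / a)) p"
      by (rule lap_cong[OF oc p]) (simp add: \<alpha>_def F_def)
    also have "\<dots> = - (1 / a) * flat_poly P1 ((r\<^sup>2 - D p) / a) * lap D p + (1 / a\<^sup>2) * flat_poly P2 ((r\<^sup>2 - D p) / a) * gradsq D c p"
      by (rule lap_compose_chart[OF oc p sD s1 open_UNIV UNIV_I d1 d2 c p])
    finally show ?thesis by (simp add: lapD[OF p] gD[OF p] F_def)
  qed
  have poly12: "poly P1 y = y\<^sup>2" "poly P2 y = y\<^sup>2 * (y\<^sup>2 - 2 * y)" for y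
    by (simp_all add: P1_def P2_def poly_monom pderiv_monom)
  show ?thesis
  proof
    show "smooth_fun A UNIV \<alpha>" by (rule s)
    show "0 \<le> \<alpha> p" for p by (simp add: \<alpha>_def flat_poly_def)
    show "0 < \<alpha> p" if "p \<in> fst c" "snd c p \<in> ball z0 r" for p
      using that F_pos[of p] by (simp add: \<alpha>_def flat_poly_def)
    show "\<alpha> p = 0" if "\<not> (p \<in> fst c \<and> snd c p \<in> ball z0 r)" for p
      using that F_pos[of p] by (auto simp: \<alpha>_def flat_poly_def)
    show "lap \<alpha> p = 0" if *: "\<not> (p \<in> fst c \<and> snd c p \<in> ball z0 r)" for p
    proof (cases "p \<in> fst c")
      case True
      then have "\<not> 0 < F p" using * F_pos[of p] by simp
      then show ?thesis by (simp add: lap1[OF True] flat_poly_def)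
    next
      case False
      then have "p \<notin> K" by (simp add: K_def)
      then show ?thesis using lap_eq_0_off_closed[OF compact_imp_closed[OF cK], of \<alpha> p] off by simp
    qed
    show "0 < lap \<alpha> p" if p: "p \<in> fst c" "snd c p \<in> ball z0 r - ball z0 r'" for p
    proof -
      have pK: "p \<in> K'" using p by (auto simp: K'_def)
      have Fp: "0 < F p" using F_pos p by blast
      have dp: "0 < r\<^sup>2 - D p" "r\<^sup>2 - D p \<le> r\<^sup>2" using p inball[OF r0] by (auto simp: D_def)
      have inv: "1 / F p = a / (r\<^sup>2 - D p)" by (simp add: F_def)
      have "0 < - (1 / a) * (a / (r\<^sup>2 - D p))\<^sup>2 * tr p + (1 / a\<^sup>2) * ((a / (r\<^sup>2 - D p))\<^sup>2 * ((a / (r\<^sup>2 - D p))\<^sup>2 - 2 * (a / (r\<^sup>2 - D p)))) * q p"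
        by (rule bump_estimate[OF dp m(1) m(2)[OF pK] _ B(1) a_def]) (use B(2)[OF pK] in auto)
      then have "0 < exp (- 1 / F p) * (- (1 / a) * (1 / F p)\<^sup>2 * tr p + (1 / a\<^sup>2) * ((1 / F p)\<^sup>2 * ((1 / F p)\<^sup>2 - 2 * (1 / F p))) * q p)"
        unfolding inv by simp
      also have "\<dots> = lap \<alpha> p"
        unfolding lap1[OF p(1)] flat_poly_def poly12 using Fp by (simp add: algebra_simps)
      finally show ?thesis .
    qed
  qed
qed

section \<open>Moving the negative part of the Laplacian\<close>

definition cpt_smooth :: "'a set \<Rightarrow> ('a \<Rightarrow> real) \<Rightarrow> bool" where
  "cpt_smooth C \<beta> \<longleftrightarrow> smooth_fun A UNIV \<beta> \<and> (\<exists>K. compact K \<and> K \<subseteq> C \<and> (\<forall>p. p \<notin> K \<longrightarrow> \<beta> p = 0))"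

lemma cpt_smooth_smooth: "cpt_smooth C \<beta> \<Longrightarrow> smooth_fun A UNIV \<beta>"
  by (simp add: cpt_smooth_def)

lemma cpt_smooth_mono: "cpt_smooth C \<beta> \<Longrightarrow> C \<subseteq> C' \<Longrightarrow> cpt_smooth C' \<beta>"
  unfolding cpt_smooth_def by (meson order_trans)

lemma cpt_smooth_0: "cpt_smooth C (\<lambda>_. 0)"
  unfolding cpt_smooth_def by (auto intro: smooth_fun_const exI[of _ "{}"])

lemma cpt_smooth_add:
  assumes "cpt_smooth C \<beta>" "cpt_smooth C \<gamma>" shows "cpt_smooth C (\<lambda>p. \<beta> p + \<gamma> p)"
proof -
  obtain K L where K: "compact K" "K \<subseteq> C" "\<And>p. p \<notin> K \<Longrightarrow> \<beta> p = 0"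
    and L: "compact L" "L \<subseteq> C" "\<And>p. p \<notin> L \<Longrightarrow> \<gamma> p = 0"
    using assms unfolding cpt_smooth_def by metis
  have "compact (K \<union> L)" "K \<union> L \<subseteq> C" "\<And>p. p \<notin> K \<union> L \<Longrightarrow> \<beta> p + \<gamma> p = 0"
    using K L by auto
  moreover have "smooth_fun A UNIV (\<lambda>p. \<beta> p + \<gamma> p)"
    using assms by (intro smooth_fun_add) (auto simp: cpt_smooth_def)
  ultimately show ?thesis unfolding cpt_smooth_def by metis
qed

lemma cpt_smooth_cmult:
  assumes "cpt_smooth C \<beta>" shows "cpt_smooth C (\<lambda>p. a * \<beta> p)"
proof -
  obtain K where K: "compact K" "K \<subseteq> C" "\<And>p. p \<notin> K \<Longrightarrow> \<beta> p = 0"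
    using assms unfolding cpt_smooth_def by metis
  then have "\<And>p. p \<notin> K \<Longrightarrow> a * \<beta> p = 0" by auto
  moreover have "smooth_fun A UNIV (\<lambda>p. a * \<beta> p)"
    using assms by (intro smooth_fun_cmult) (auto simp: cpt_smooth_def)
  ultimately show ?thesis using K unfolding cpt_smooth_def by metis
qed

lemma cpt_smooth_sum:
  "finite I \<Longrightarrow> (\<And>i. i \<in> I \<Longrightarrow> cpt_smooth C (\<beta> i)) \<Longrightarrow> cpt_smooth C (\<lambda>p. \<Sum>i\<in>I. \<beta> i p)"
  by (induction I rule: finite_induct) (auto intro: cpt_smooth_0 cpt_smooth_add)

text \<open>The negative part of a Laplacian can be moved from \<open>x\<close> to \<open>y\<close> inside \<open>C\<close>. Positivity is asked for on
  \<open>W - V\<close> rather than on \<open>W\<close>, so that the relation makes sense, and is reflexive, also when \<open>x\<close> lies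
  in \<open>V\<close>.\<close>

definition reach :: "'a set \<Rightarrow> 'a \<Rightarrow> 'a \<Rightarrow> bool" where
  "reach C x y \<longleftrightarrow> (\<forall>V. open V \<and> y \<in> V \<longrightarrow>
     (\<exists>W \<beta>. open W \<and> x \<in> W \<and> cpt_smooth C \<beta> \<and> (\<forall>p. p \<notin> V \<longrightarrow> 0 \<le> lap \<beta> p) \<and> (\<forall>p\<in>W - V. 0 < lap \<beta> p)))"

lemma reachD:
  assumes "reach C x y" "open V" "y \<in> V"
  obtains W \<beta> where "open W" "x \<in> W" "cpt_smooth C \<beta>"
    "\<And>p. p \<notin> V \<Longrightarrow> 0 \<le> lap \<beta> p" "\<And>p. p \<in> W - V \<Longrightarrow> 0 < lap \<beta> p"
  using assms unfolding reach_def by metis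

lemma reach_mono: "reach C x y \<Longrightarrow> C \<subseteq> C' \<Longrightarrow> reach C' x y"
  unfolding reach_def by (meson cpt_smooth_mono)

lemma lap_continuous_on: "smooth_fun A UNIV \<phi> \<Longrightarrow> continuous_on S (lap \<phi>)"
  using lap_continuous[OF open_UNIV] continuous_on_subset by blast

lemma lap_lincomb:
  assumes "smooth_fun A UNIV \<phi>" "smooth_fun A UNIV \<psi>"
  shows "lap (\<lambda>q. \<phi> q + a * \<psi> q) p = lap \<phi> p + a * lap \<psi> p"
  using lap_add[OF open_UNIV UNIV_I assms(1) smooth_fun_cmult[OF open_UNIV assms(2)]]
    lap_cmult[OF open_UNIV UNIV_I assms(2)] by simp

text \<open>The function for the pair \<open>(x, y)\<close> is negative only in a small neighbourhood of \<open>y\<close>. There the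
  function for \<open>(y, z)\<close> is positive, and a large multiple of it outweighs the negative values.\<close>

lemma reach_trans:
  assumes "reach C x y" "reach C y z"
  shows "reach C x z"
  unfolding reach_def
proof (intro allI impI)
  fix V assume V: "open V \<and> z \<in> V"
  obtain W2 \<beta>2 where 2: "open W2" "y \<in> W2" "cpt_smooth C \<beta>2"
    "\<And>p. p \<notin> V \<Longrightarrow> 0 \<le> lap \<beta>2 p" "\<And>p. p \<in> W2 - V \<Longrightarrow> 0 < lap \<beta>2 p"
    using reachD[OF assms(2)] V by metis
  \<comment> \<open>A compact neighbourhood of \<open>y\<close> is needed so that one multiple suffices for all its points.\<close>
  obtain W' K where W': "open W'" "y \<in> W'" "W' \<subseteq> K" "compact K" "K \<subseteq> W2"
    using locally_compact[OF 2(1,2)] .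
  obtain W1 \<beta>1 where 1: "open W1" "x \<in> W1" "cpt_smooth C \<beta>1"
    "\<And>p. p \<notin> W' \<Longrightarrow> 0 \<le> lap \<beta>1 p" "\<And>p. p \<in> W1 - W' \<Longrightarrow> 0 < lap \<beta>1 p"
    using reachD[OF assms(1) W'(1,2)] by metis
  note s1 = cpt_smooth_smooth[OF 1(3)] and s2 = cpt_smooth_smooth[OF 2(3)]
  have cKV: "compact (K - V)" using W'(4) V by (auto intro: compact_diff)
  obtain m where m: "0 < m" "\<And>p. p \<in> K - V \<Longrightarrow> m \<le> lap \<beta>2 p"
    by (rule compact_positive_lower_bound[OF cKV lap_continuous_on[OF s2]]) (use 2(5) W' in auto)
  obtain M where M: "0 \<le> M" "\<And>p. p \<in> K \<Longrightarrow> \<bar>lap \<beta>1 p\<bar> \<le> M"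
    by (rule compact_abs_bound[OF W'(4) lap_continuous_on[OF s1]]) auto
  define a where "a = (M + 1) / m"
  have a: "0 \<le> a" "a * m = M + 1" using m M by (auto simp: a_def)
  let ?\<beta> = "\<lambda>p. \<beta>1 p + a * \<beta>2 p"
  have lap: "lap ?\<beta> p = lap \<beta>1 p + a * lap \<beta>2 p" for p by (rule lap_lincomb[OF s1 s2])
  have pos: "0 < lap ?\<beta> p" if "p \<in> W'" "p \<notin> V" for p
  proof -
    have "M + 1 \<le> a * lap \<beta>2 p" unfolding a(2)[symmetric]
      using m(2)[of p] that W' a(1) by (intro mult_left_mono) auto
    moreover have "- M \<le> lap \<beta>1 p" using M(2)[of p] that W' by (auto simp: abs_le_iff)
    ultimately show ?thesis by (simp add: lap)
  qed
  have nn: "0 \<le> a * lap \<beta>2 p" if "p \<notin> V" for p using a(1) 2(4)[OF that] by simp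
  show "\<exists>W \<beta>. open W \<and> x \<in> W \<and> cpt_smooth C \<beta> \<and> (\<forall>p. p \<notin> V \<longrightarrow> 0 \<le> lap \<beta> p) \<and> (\<forall>p\<in>W - V. 0 < lap \<beta> p)"
  proof (intro exI conjI allI ballI impI)
    show "cpt_smooth C ?\<beta>" by (intro cpt_smooth_add cpt_smooth_cmult 1 2)
    show "0 \<le> lap ?\<beta> p" if "p \<notin> V" for p
      using pos[of p] nn[OF that] 1(4)[of p] that unfolding lap by (cases "p \<in> W'") auto
    show "0 < lap ?\<beta> p" if "p \<in> W1 - V" for p
      using pos[of p] nn[of p] 1(5)[of p] that unfolding lap by (cases "p \<in> W'") auto
  qed (use 1 in auto)
qed

text \<open>For \<open>y\<close>, \<open>z\<close> close to \<open>x\<close> in one chart, the bump centred at \<open>z\<close> works, since its ball can be taken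
  large enough to contain \<open>y\<close>, and its negative part lies in a ball as small as desired.\<close>

lemma reach_local:
  assumes "open C" "x \<in> C"
  obtains N where "open N" "x \<in> N" "\<And>y z. y \<in> N \<Longrightarrow> z \<in> N \<Longrightarrow> reach C y z"
proof -
  obtain c r0 where c: "c \<in> A" "x \<in> fst c" "0 < r0" "cball (snd c x) r0 \<subseteq> snd c ` (C \<inter> fst c)"
    using chart_ball[OF assms] .
  \<comment> \<open>Two points of this ball have distance less than \<open>r0/2\<close>, and balls of radius \<open>r0/2\<close> about them stay in that of radius \<open>r0\<close>.\<close>
  define N where "N = {q \<in> fst c. snd c q \<in> ball (snd c x) (r0 / 4)}"
  have "reach C y z" if yz: "y \<in> N" "z \<in> N" for y z
    unfolding reach_def
  proof (intro allI impI)
    fix V assume V: "open V \<and> z \<in> V"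
    have z: "z \<in> fst c" "dist (snd c x) (snd c z) < r0 / 4" and y: "y \<in> fst c" "dist (snd c x) (snd c y) < r0 / 4"
      using yz by (auto simp: N_def)
    have "open (snd c ` (V \<inter> fst c))" "snd c z \<in> snd c ` (V \<inter> fst c)"
      using chart_image_open[OF c(1)] V z by auto
    then obtain e where e: "0 < e" "ball (snd c z) e \<subseteq> snd c ` (V \<inter> fst c)"
      using open_contains_ball by blast
    define r' where "r' = min e (r0 / 4)"
    have r': "0 < r'" "r' < r0 / 2" "ball (snd c z) r' \<subseteq> snd c ` (V \<inter> fst c)"
      using e c(3) by (auto simp: r'_def)
    have "cball (snd c z) (r0 / 2) \<subseteq> cball (snd c x) r0"
    proof
      fix w assume "w \<in> cball (snd c z) (r0 / 2)"
      then have "dist (snd c z) w \<le> r0 / 2" by simp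
      moreover have "dist (snd c x) w \<le> dist (snd c x) (snd c z) + dist (snd c z) w" by (rule dist_triangle)
      ultimately show "w \<in> cball (snd c x) r0" using z(2) c(3) by simp
    qed
    then have subC: "cball (snd c z) (r0 / 2) \<subseteq> snd c ` (C \<inter> fst c)" using c(4) by blast
    then have sub: "cball (snd c z) (r0 / 2) \<subseteq> snd c ` fst c" by blast
    let ?W = "{q \<in> fst c. snd c q \<in> ball (snd c z) (r0 / 2)}"
    let ?K = "{q \<in> fst c. snd c q \<in> cball (snd c z) (r0 / 2)}"
    obtain \<alpha> where \<alpha>: "smooth_fun A UNIV \<alpha>"
      "\<And>p. \<not> (p \<in> fst c \<and> snd c p \<in> ball (snd c z) (r0 / 2)) \<Longrightarrow> \<alpha> p = 0"
      "\<And>p. p \<in> fst c \<Longrightarrow> snd c p \<in> ball (snd c z) (r0 / 2) - ball (snd c z) r' \<Longrightarrow> 0 < lap \<alpha> p"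
      "\<And>p. \<not> (p \<in> fst c \<and> snd c p \<in> ball (snd c z) (r0 / 2)) \<Longrightarrow> lap \<alpha> p = 0"
      using bump[OF c(1) r'(1,2) sub] by metis
    have "compact ?K" by (rule chart_preimage_compact[OF c(1) _ sub]) simp
    moreover have "?K \<subseteq> C" by (rule chart_preimage_subset[OF c(1) subC])
    moreover have "\<forall>p. p \<notin> ?K \<longrightarrow> \<alpha> p = 0" using \<alpha>(2) by auto
    ultimately have cs: "cpt_smooth C \<alpha>" unfolding cpt_smooth_def using \<alpha>(1) by blast
    have pos: "0 < lap \<alpha> p" if "p \<in> ?W" "p \<notin> V" for p
    proof -
      have "snd c p \<notin> ball (snd c z) r'"
        using chart_preimage_subset[OF c(1) r'(3)] that by blast
      with that \<alpha>(3) show ?thesis by blast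
    qed
    show "\<exists>W \<beta>. open W \<and> y \<in> W \<and> cpt_smooth C \<beta> \<and> (\<forall>p. p \<notin> V \<longrightarrow> 0 \<le> lap \<beta> p) \<and> (\<forall>p\<in>W - V. 0 < lap \<beta> p)"
    proof (intro exI conjI allI ballI impI)
      show "open ?W" by (rule chart_preimage_open[OF c(1)]) simp
      have "dist (snd c z) (snd c y) \<le> dist (snd c x) (snd c z) + dist (snd c x) (snd c y)"
        by (metis dist_commute dist_triangle)
      then show "y \<in> ?W" using y z by simp
      show "0 \<le> lap \<alpha> p" if "p \<notin> V" for p
        using pos[of p] \<alpha>(4)[of p] that by (cases "p \<in> ?W") auto
    qed (use pos cs in auto)
  qed
  moreover have "open N" unfolding N_def by (rule chart_preimage_open[OF c(1)]) simp
  moreover have "x \<in> N" using c by (simp add: N_def)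
  ultimately show ?thesis using that by blast
qed

lemma reach_connected:
  assumes "open C" "connected C" "x \<in> C" "y \<in> C"
  shows "reach C x y"
proof -
  have "reach C x y \<and> reach C y x"
  proof (rule connected_equivalence_relation[OF assms(2-4), where R = "\<lambda>x y. reach C x y \<and> reach C y x"])
    fix a assume a: "a \<in> C"
    obtain N where N: "open N" "a \<in> N" "\<And>y z. y \<in> N \<Longrightarrow> z \<in> N \<Longrightarrow> reach C y z"
      using reach_local[OF assms(1) a] by metis
    show "\<exists>T. openin (top_of_set C) T \<and> a \<in> T \<and> (\<forall>x\<in>T. reach C a x \<and> reach C x a)"
      using N a by (intro exI[of _ "C \<inter> N"]) auto
  qed (blast intro: reach_trans)+
  then show ?thesis by simp
qed

text \<open>Finitely many of the functions provided by \<open>reach\<close> are positive on neighbourhoods that cover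
  \<open>Q\<close>; all are nonnegative off \<open>V\<close>, so they can be added.\<close>

lemma positive_lap_on_compact:
  assumes "compact Q" "open V" "\<And>x. x \<in> Q \<Longrightarrow> \<exists>y\<in>V. reach H x y"
  obtains \<beta> where "cpt_smooth H \<beta>" "\<And>p. p \<notin> V \<Longrightarrow> 0 \<le> lap \<beta> p" "\<And>p. p \<in> Q - V \<Longrightarrow> 0 < lap \<beta> p"
proof -
  define ok where "ok x W \<beta> \<longleftrightarrow> open W \<and> x \<in> W \<and> cpt_smooth H \<beta> \<and>
    (\<forall>p. p \<notin> V \<longrightarrow> 0 \<le> lap \<beta> p) \<and> (\<forall>p\<in>W - V. 0 < lap \<beta> p)" for x W \<beta>
  have "\<exists>W \<beta>. ok x W \<beta>" if "x \<in> Q" for x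
    using assms(3)[OF that] assms(2) unfolding reach_def ok_def by blast
  then obtain W \<beta> where "\<And>x. x \<in> Q \<Longrightarrow> ok x (W x) (\<beta> x)" by metis
  then have W: "\<And>x. x \<in> Q \<Longrightarrow> open (W x)" "\<And>x. x \<in> Q \<Longrightarrow> x \<in> W x"
    and \<beta>: "\<And>x. x \<in> Q \<Longrightarrow> cpt_smooth H (\<beta> x)" "\<And>x p. x \<in> Q \<Longrightarrow> p \<notin> V \<Longrightarrow> 0 \<le> lap (\<beta> x) p"
      "\<And>x p. x \<in> Q \<Longrightarrow> p \<in> W x - V \<Longrightarrow> 0 < lap (\<beta> x) p"
    unfolding ok_def by blast+
  obtain I where I: "I \<subseteq> Q" "finite I" "Q \<subseteq> (\<Union>x\<in>I. W x)"
    by (rule compactE_image[OF assms(1), of Q W]) (use W in auto)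
  let ?\<beta> = "\<lambda>p. \<Sum>x\<in>I. \<beta> x p"
  have lap: "lap ?\<beta> p = (\<Sum>x\<in>I. lap (\<beta> x) p)" for p
    by (rule lap_sum[OF I(2) open_UNIV UNIV_I]) (use \<beta>(1) I cpt_smooth_smooth in blast)
  show ?thesis
  proof
    show "cpt_smooth H ?\<beta>" by (rule cpt_smooth_sum[OF I(2)]) (use \<beta>(1) I in auto)
    show "0 \<le> lap ?\<beta> p" if "p \<notin> V" for p
      unfolding lap using \<beta>(2) I that by (intro sum_nonneg) auto
    show "0 < lap ?\<beta> p" if p: "p \<in> Q - V" for p
    proof -
      obtain x where "x \<in> I" "p \<in> W x" using I p by auto
      then show ?thesis unfolding lap using \<beta>(2,3) I p by (intro sum_pos2[OF I(2)]) auto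
    qed
  qed
qed

lemma bump_function:
  assumes "open C" "p \<in> C"
  obtains \<beta> where "cpt_smooth C \<beta>" "\<And>q. 0 \<le> \<beta> q" "0 < \<beta> p"
proof -
  obtain c r where c: "c \<in> A" "p \<in> fst c" "0 < r" "cball (snd c p) r \<subseteq> snd c ` (C \<inter> fst c)"
    using chart_ball[OF assms] .
  have sub: "cball (snd c p) r \<subseteq> snd c ` fst c" using c(4) by blast
  let ?K = "{q \<in> fst c. snd c q \<in> cball (snd c p) r}"
  have r2: "0 < r / 2" "r / 2 < r" using c(3) by auto
  obtain \<alpha> :: "'a \<Rightarrow> real" where \<alpha>: "smooth_fun A UNIV \<alpha>" "\<And>q. 0 \<le> \<alpha> q"
      "\<And>q. q \<in> fst c \<Longrightarrow> snd c q \<in> ball (snd c p) r \<Longrightarrow> 0 < \<alpha> q"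
      "\<And>q. \<not> (q \<in> fst c \<and> snd c q \<in> ball (snd c p) r) \<Longrightarrow> \<alpha> q = 0"
    using bump[OF c(1) r2 sub] by metis
  have "compact ?K" by (rule chart_preimage_compact[OF c(1) _ sub]) simp
  moreover have "?K \<subseteq> C" by (rule chart_preimage_subset[OF c(1,4)])
  moreover have "\<forall>q. q \<notin> ?K \<longrightarrow> \<alpha> q = 0" using \<alpha>(4) by auto
  ultimately have "cpt_smooth C \<alpha>" unfolding cpt_smooth_def using \<alpha>(1) by blast
  moreover have "0 < \<alpha> p" using \<alpha>(3)[of p] c by simp
  ultimately show ?thesis using that \<alpha>(2) by blast
qed

end

section \<open>Exhaustion by compact sets\<close>

context complex_mfd begin

lemma compact_neighbourhood:
  fixes K :: "'a set"
  assumes "compact K" obtains L where "compact L" "K \<subseteq> interior L"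
proof -
  have "\<exists>V L. open V \<and> x \<in> V \<and> V \<subseteq> L \<and> compact L" for x :: 'a
    using locally_compact[OF open_UNIV UNIV_I] by metis
  then obtain V L where VL: "\<And>x::'a. open (V x)" "\<And>x. x \<in> V x" "\<And>x. V x \<subseteq> L x" "\<And>x. compact (L x)"
    by metis
  obtain I where I: "I \<subseteq> K" "finite I" "K \<subseteq> (\<Union>x\<in>I. V x)"
    by (rule compactE_image[OF assms, of K V]) (use VL in auto)
  show ?thesis
  proof
    show "compact (\<Union>x\<in>I. L x)" using I VL by auto
    have "(\<Union>x\<in>I. V x) \<subseteq> interior (\<Union>x\<in>I. L x)"
      by (rule interior_maximal) (use VL in blast)+
    then show "K \<subseteq> interior (\<Union>x\<in>I. L x)" using I by blast
  qed
qed

lemma sigma_compact: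
  obtains U :: "nat \<Rightarrow> 'a set" where "\<And>n. compact (U n)" "(\<Union>n. U n) = UNIV"
proof -
  let ?F = "{V :: 'a set. open V \<and> (\<exists>L. V \<subseteq> L \<and> compact L)}"
  obtain F' where F': "F' \<subseteq> ?F" "countable F'" "\<Union>F' = \<Union>?F"
    by (rule Lindelof[of ?F]) auto
  have "x \<in> \<Union>?F" for x
  proof -
    obtain V K where "open V" "x \<in> V" "V \<subseteq> K" "compact K" "K \<subseteq> UNIV"
      using locally_compact[OF open_UNIV UNIV_I, of x] .
    then show ?thesis by (intro UnionI[of V] CollectI conjI exI[of _ K])
  qed
  then have U: "\<Union>F' = UNIV" using F'(3) by auto
  then have ne: "F' \<noteq> {}" by auto
  have "\<forall>V\<in>F'. \<exists>L. V \<subseteq> L \<and> compact L" using F'(1) by blast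
  then obtain L where L: "\<And>V. V \<in> F' \<Longrightarrow> V \<subseteq> L V" "\<And>V. V \<in> F' \<Longrightarrow> compact (L V)" by metis
  show ?thesis
  proof
    show "compact (L (from_nat_into F' n))" for n using L(2) from_nat_into[OF ne] by blast
    show "(\<Union>n. L (from_nat_into F' n)) = UNIV"
    proof -
      have "x \<in> (\<Union>n. L (from_nat_into F' n))" for x
      proof -
        have "x \<in> \<Union>F'" using U by simp
        then obtain V where V: "V \<in> F'" "x \<in> V" by (rule UnionE)
        obtain n where "from_nat_into F' n = V" using from_nat_into_surj[OF F'(2) V(1)] by (elim exE)
        then show ?thesis using L(1)[OF V(1)] V(2) by (intro UN_I[of n]) auto
      qed
      then show ?thesis by (intro equalityI subsetI UNIV_I)
    qed
  qed
qed

text \<open>The property \<open>P\<close> is a parameter, because the construction of a bundle metric uses an arbitrary exhaustion,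
  and the construction of a potential one by filled sets.\<close>

lemma exhaustion:
  assumes "\<And>K. compact K \<Longrightarrow> \<exists>K'. compact K' \<and> K \<subseteq> K' \<and> P K'"
  obtains E :: "nat \<Rightarrow> 'a set" where "\<And>k. compact (E k)" "\<And>k. P (E k)"
    "\<And>k. E k \<subseteq> interior (E (Suc k))" "(\<Union>k. E k) = UNIV"
proof -
  obtain U :: "nat \<Rightarrow> 'a set" where U: "\<And>n. compact (U n)" "(\<Union>n. U n) = UNIV" using sigma_compact by metis
  have "\<exists>E. \<forall>n. (compact (E n) \<and> P (E n) \<and> U n \<subseteq> E n) \<and> E n \<subseteq> interior (E (Suc n))"
  proof (rule dependent_nat_choice)
    show "\<exists>K. compact K \<and> P K \<and> U 0 \<subseteq> K" using assms[OF U(1)] by blast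
    fix K n assume "compact K \<and> P K \<and> U n \<subseteq> K"
    then obtain L where L: "compact L" "K \<subseteq> interior L" using compact_neighbourhood by blast
    then have "compact (L \<union> U (Suc n))" using U(1) by auto
    from assms[OF this] obtain K' where K': "compact K'" "L \<union> U (Suc n) \<subseteq> K'" "P K'" by blast
    then have "interior L \<subseteq> interior K'" by (intro interior_mono) auto
    then show "\<exists>K'. (compact K' \<and> P K' \<and> U (Suc n) \<subseteq> K') \<and> K \<subseteq> interior K'"
      using K' L by blast
  qed
  then obtain E where E: "\<And>n. compact (E n)" "\<And>n. P (E n)" "\<And>n. U n \<subseteq> E n" "\<And>n. E n \<subseteq> interior (E (Suc n))" by metis
  have "(\<Union>n. U n) \<subseteq> (\<Union>k. E k)" using E(3) by (rule UN_mono[OF order_refl])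
  then have "(\<Union>k. E k) = UNIV" unfolding U(2) by (rule top.extremum_uniqueI)
  with E(1,2,4) show ?thesis by (rule that)
qed

lemma open_component:
  fixes S :: "'a set"
  assumes "open S" shows "open (connected_component_set S x)"
proof (subst open_subopen, rule ballI)
  fix y assume y: "y \<in> connected_component_set S x"
  then have "y \<in> S" using connected_component_subset by blast
  then obtain V where V: "open V" "y \<in> V" "connected V" "V \<subseteq> S"
    using locally_connected[OF assms] by blast
  have "V \<subseteq> connected_component_set S y" by (rule connected_component_maximal[OF V(2,3,4)])
  then show "\<exists>T. open T \<and> y \<in> T \<and> T \<subseteq> connected_component_set S x"
    using V connected_component_eq[OF y] by blast
qed

text \<open>No component of the complement is relatively compact, so from each point off \<open>K\<close> one can escape
  from any given compact set without meeting \<open>K\<close>.\<close>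

definition filled :: "'a set \<Rightarrow> bool" where
  "filled K \<longleftrightarrow> (\<forall>x. x \<notin> K \<longrightarrow> \<not> (\<exists>Q. compact Q \<and> connected_component_set (- K) x \<subseteq> Q))"

text \<open>Add to \<open>K\<close> the relatively compact components of its complement. For compactness of the
  result take a compact neighbourhood \<open>L\<close> of \<open>K\<close>. Finitely many components cover the compact set
  \<open>L - interior L\<close>, and a component that misses this set lies in the interior of \<open>L\<close> or off \<open>L\<close>.
  In the latter case it would be open and closed, hence the whole noncompact space, so it is not
  relatively compact.\<close>

lemma filled_hull:
  assumes conn: "connected (UNIV :: 'a set)" and nc: "\<not> compact (UNIV :: 'a set)" and K: "compact (K :: 'a set)"
  shows "\<exists>K'. compact K' \<and> K \<subseteq> K' \<and> filled K'"
proof -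
  define cmp where "cmp x = connected_component_set (- K) x" for x
  have oK: "open (- K)" using K by (simp add: compact_imp_closed open_Compl)
  have ocmp: "open (cmp x)" for x unfolding cmp_def by (rule open_component[OF oK])
  have self: "x \<in> cmp x" if "x \<notin> K" for x using that by (simp add: cmp_def connected_component_refl)
  have cmp_eq: "cmp y = cmp x" if "y \<in> cmp x" for x y
    using connected_component_eq that unfolding cmp_def by metis
  have cmp_sub: "cmp x \<subseteq> - K" for x unfolding cmp_def by (rule connected_component_subset)
  define bdd where "bdd x \<longleftrightarrow> (\<exists>Q. compact Q \<and> cmp x \<subseteq> Q)" for x
  define K' where "K' = K \<union> {x. x \<notin> K \<and> bdd x}"
  have out: "cmp x \<subseteq> - K'" if "x \<notin> K'" for x
    using that cmp_sub[of x] cmp_eq[of _ x] unfolding K'_def bdd_def by fastforce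
  have closed: "closed K'"
  proof -
    have "open (- K')"
    proof (subst open_subopen, rule ballI)
      fix x assume "x \<in> - K'"
      then have "x \<notin> K'" "x \<notin> K" by (auto simp: K'_def)
      then show "\<exists>T. open T \<and> x \<in> T \<and> T \<subseteq> - K'" by (intro exI[of _ "cmp x"] conjI ocmp self out)
    qed
    then show ?thesis by (simp add: closed_def)
  qed
  obtain L where L: "compact L" "K \<subseteq> interior L" using compact_neighbourhood[OF K] .
  define F where "F = L - interior L"
  have cF: "compact F" unfolding F_def using L(1) by (simp add: compact_diff)
  have FK: "x \<notin> K" if "x \<in> F" for x using that L(2) by (auto simp: F_def)
  obtain Y where Y: "Y \<subseteq> F" "finite Y" "F \<subseteq> (\<Union>y\<in>Y. cmp y)"
    by (rule compactE_image[OF cF, of F cmp]) (use ocmp self FK in auto)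
  define Q where "Q y = (SOME Q. compact Q \<and> cmp y \<subseteq> Q)" for y
  have Q: "compact (Q y) \<and> cmp y \<subseteq> Q y" if "bdd y" for y
    using someI_ex[OF that[unfolded bdd_def]] by (simp add: Q_def)
  define Z where "Z = L \<union> (\<Union>y\<in>{y\<in>Y. bdd y}. Q y)"
  have cZ: "compact Z" unfolding Z_def using L(1) Y(2) Q by (intro compact_Un compact_UN) auto
  have "x \<in> Z" if x: "x \<notin> K" "bdd x" for x
  proof (cases "cmp x \<inter> F = {}")
    case False
    then obtain f y where f: "f \<in> cmp x" "y \<in> Y" "f \<in> cmp y" using Y(3) by blast
    then have "cmp x = cmp y" using cmp_eq by metis
    then have "bdd y" "x \<in> cmp y" using x self unfolding bdd_def by auto
    then have "x \<in> Q y" using Q[of y] by auto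
    then show ?thesis unfolding Z_def using f(2) \<open>bdd y\<close> by auto
  next
    case True
    have "x \<in> L"
    proof (rule ccontr)
      assume xL: "x \<notin> L"
      have "connected (cmp x)" unfolding cmp_def by (rule connected_connected_component)
      moreover have "cmp x \<subseteq> interior L \<union> - L" using True by (auto simp: F_def)
      moreover have "open (interior L)" "open (- L)" using L(1) by (auto simp: compact_imp_closed open_Compl)
      moreover have "interior L \<inter> - L \<inter> cmp x = {}" using interior_subset by blast
      moreover have "- L \<inter> cmp x \<noteq> {}" using xL self[OF x(1)] by blast
      ultimately have disj: "interior L \<inter> cmp x = {}"
        using connectedD[of "cmp x" "interior L" "- L"] by blast
      have "closed (cmp x)"
      proof -
        have "open (- cmp x)"
        proof (subst open_subopen, rule ballI)
          fix y assume y: "y \<in> - cmp x"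
          show "\<exists>T. open T \<and> y \<in> T \<and> T \<subseteq> - cmp x"
          proof (cases "y \<in> K")
            case True
            then show ?thesis using L(2) disj by (intro exI[of _ "interior L"]) auto
          next
            case False
            have "w \<notin> cmp x" if "w \<in> cmp y" for w
              using cmp_eq[OF that] cmp_eq[of w x] self[OF False] y by auto
            then have "cmp y \<subseteq> - cmp x" by blast
            then show ?thesis by (intro exI[of _ "cmp y"] conjI ocmp self[OF False])
          qed
        qed
        then show ?thesis by (simp add: closed_def)
      qed
      then have "cmp x = {} \<or> cmp x = UNIV"
        using conn[unfolded connected_clopen, rule_format, of "cmp x"] ocmp[of x] by simp
      then have "cmp x = UNIV" using self[OF x(1)] by blast
      then have "\<exists>Q :: 'a set. compact Q \<and> UNIV \<subseteq> Q" using x(2) unfolding bdd_def by auto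
      then show False using nc by (metis top.extremum_uniqueI)
    qed
    then show ?thesis by (simp add: Z_def)
  qed
  then have "K' \<subseteq> Z" using L(2) interior_subset by (fastforce simp: K'_def Z_def)
  then have "compact K'" using cZ closed by (metis compact_Int_closed inf.absorb2)
  moreover have "filled K'"
    unfolding filled_def
  proof (intro allI impI notI)
    fix x assume x: "x \<notin> K'" and "\<exists>Q. compact Q \<and> connected_component_set (- K') x \<subseteq> Q"
    then obtain Q where Q: "compact Q" "connected_component_set (- K') x \<subseteq> Q" by blast
    have "x \<notin> K" using x by (simp add: K'_def)
    have "cmp x \<subseteq> connected_component_set (- K') x"
      by (rule connected_component_maximal[OF self[OF \<open>x \<notin> K\<close>] _ out[OF x]])
        (simp add: cmp_def connected_connected_component)
    then have "bdd x" using Q unfolding bdd_def by blast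
    then show False using x by (simp add: K'_def)
  qed
  ultimately show ?thesis by (auto simp: K'_def)
qed

end

text \<open>Each point lies in some \<open>E k\<close>, from which index on the sequence is constant there. The index \<open>x\<close> allows whole families of functions: it ranges over trivializations when bundle
  metrics are built, and over \<open>unit\<close> for a single function.\<close>

lemma stationary_limit:
  fixes f :: "nat \<Rightarrow> 'x \<Rightarrow> 'a \<Rightarrow> 'y" and E :: "nat \<Rightarrow> 'a set"
  assumes mono: "\<And>k. E k \<subseteq> E (Suc k)" and cov: "(\<Union>k. E k) = UNIV"
    and st: "\<And>k x p. p \<in> E k \<Longrightarrow> f (Suc k) x p = f k x p"
  obtains F where "\<And>k x p. p \<in> E k \<Longrightarrow> F x p = f k x p"
proof -
  have eq: "p \<in> E (k + j) \<and> f (k + j) x p = f k x p" if "p \<in> E k" for k j x p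
  proof (induction j)
    case 0 then show ?case using that by simp
  next
    case (Suc j) then show ?case using mono[of "k + j"] st[of p "k + j" x] by auto
  qed
  define l where "l p = (LEAST k. p \<in> E k)" for p
  have "f (l p) x p = f k x p" if "p \<in> E k" for k x p
  proof -
    have "p \<in> E (l p)" "l p \<le> k" unfolding l_def using that by (auto intro: LeastI Least_le)
    then show ?thesis using eq[of p "l p" "k - l p" x] by simp
  qed
  then show ?thesis by (intro that[of "\<lambda>x p. f (l p) x p"])
qed

section \<open>The potential on a compact manifold\<close>

context hermitian_mfd begin

lemma positive_lap_off:
  assumes "compact (UNIV :: 'a set)" "connected (UNIV :: 'a set)" "open V" "v \<in> V"
  obtains \<psi> where "smooth_fun A UNIV \<psi>" "\<And>p. p \<notin> V \<Longrightarrow> 0 < lap \<psi> p"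
proof -
  have "\<exists>y\<in>V. reach UNIV x y" for x
    using reach_connected[OF open_UNIV assms(2)] assms(4) by blast
  then obtain \<beta> where \<beta>: "cpt_smooth UNIV \<beta>" "\<And>p. p \<notin> V \<Longrightarrow> 0 \<le> lap \<beta> p" "\<And>p. p \<in> UNIV - V \<Longrightarrow> 0 < lap \<beta> p"
    using positive_lap_on_compact[OF assms(1,3)] by metis
  show ?thesis by (rule that[OF cpt_smooth_smooth[OF \<beta>(1)]]) (use \<beta>(3) in auto)
qed

text \<open>Both the change of trivialization and the passage from a weight to the norm of a holomorphic
  section multiply by \<open>\<bar>f\<bar>\<^sup>2\<close> with \<open>f\<close> holomorphic and nonvanishing; the curvature does not notice.\<close>

lemma lap_neg_ln_twist:
  assumes W: "open W" "p \<in> W" "smooth_fun A W \<rho>1" "\<And>q. q \<in> W \<Longrightarrow> 0 < \<rho>1 q"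
    and f: "holomorphic_fun A W f" "\<And>q. q \<in> W \<Longrightarrow> f q \<noteq> 0"
    and eq: "\<And>q. q \<in> W \<Longrightarrow> \<rho>2 q = \<rho>1 q * (norm (f q))\<^sup>2"
  shows "lap (\<lambda>q. - ln (\<rho>2 q)) p = lap (\<lambda>q. - ln (\<rho>1 q)) p"
proof -
  have s1: "smooth_fun A W (\<lambda>q. - ln (\<rho>1 q))" by (intro smooth_fun_minus smooth_fun_ln W)
  have s2: "smooth_fun A W (\<lambda>q. ln ((norm (f q))\<^sup>2))"
    by (intro smooth_fun_ln smooth_fun_norm_sq holomorphic_fun_smooth W f) (use f in auto)
  have "lap (\<lambda>q. - ln (\<rho>2 q)) p = lap (\<lambda>q. - ln (\<rho>1 q) + (- 1) * ln ((norm (f q))\<^sup>2)) p"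
  proof (rule lap_cong[OF W(1,2)])
    fix q assume q: "q \<in> W"
    show "- ln (\<rho>2 q) = - ln (\<rho>1 q) + (- 1) * ln ((norm (f q))\<^sup>2)"
      using W(4)[OF q] f(2)[OF q] by (simp add: eq[OF q] ln_mult)
  qed
  also have "\<dots> = lap (\<lambda>q. - ln (\<rho>1 q)) p + (- 1) * lap (\<lambda>q. ln ((norm (f q))\<^sup>2)) p"
    using lap_add[OF W(1,2) s1 smooth_fun_cmult[OF W(1) s2]] lap_cmult[OF W(1,2) s2] by metis
  finally show ?thesis using lap_ln_norm_sq_holomorphic[OF W(1,2) f] by simp
qed

lemma lap_add_const_fun:
  assumes "open W" "p \<in> W" "smooth_fun A W \<phi>"
  shows "lap (\<lambda>q. \<phi> q + c) p = lap \<phi> p"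
  using lap_add[OF assms smooth_fun_const[of W c]] by (simp add: lap_const)

lemma smooth_fun_power: "open W \<Longrightarrow> smooth_fun A W f \<Longrightarrow> smooth_fun A W (\<lambda>p. (f p :: real) ^ n)"
  by (induction n) (auto intro: smooth_fun_const smooth_fun_mult)

text \<open>Put \<open>u = - ln S\<close> and \<open>v = \<epsilon> \<psi> + ln (4/\<sigma>)\<close>, where \<open>\<psi>\<close> has positive Laplacian off the set
  \<open>Z = {S < \<sigma>/16}\<close>. With \<open>F = exp (v - u)\<close> the function \<open>\<phi> = (1/N) ln (1 + F\<^sup>N)\<close> turns \<open>u\<close> into
  \<open>u + \<phi> = (1/N) ln (exp (N u) + exp (N v))\<close>, a convex function of \<open>u\<close> and \<open>v\<close>, whence
  \<open>(1 + F\<^sup>N) \<Delta> (u + \<phi>) \<ge> \<Delta> u + F\<^sup>N \<Delta> v\<close>. The right-hand side is positive everywhere: on \<open>Z\<close> because \<open>F \<le> 1\<close>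
  and \<open>\<epsilon>\<close> is small compared with the lower bound of \<open>\<Delta> u = R\<close> off \<open>V\<close>; on \<open>V\<close> because \<open>F \<ge> 2\<close> and
  \<open>N\<close> is large; elsewhere because both terms are positive. At a zero of \<open>S\<close>, where \<open>u\<close> is
  infinite, \<open>F\<close> is still smooth, \<open>\<Delta> \<phi> = 0\<close> and \<open>R > 0\<close>.\<close>

lemma glue_potential:
  fixes S :: "'a \<Rightarrow> real" and R :: "'a \<Rightarrow> real"
  assumes cpt: "compact (UNIV :: 'a set)" and conn: "connected (UNIV :: 'a set)"
    and S: "smooth_fun A UNIV S" "\<And>p. 0 \<le> S p"
    and R: "continuous_on UNIV R" "\<And>p. 0 < S p \<Longrightarrow> lap (\<lambda>q. - ln (S q)) p = R p"
    and V: "open V" "\<And>p. p \<notin> V \<Longrightarrow> 0 < R p" and \<sigma>: "0 < \<sigma>" "\<And>p. p \<in> V \<Longrightarrow> \<sigma> \<le> S p"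
    and p0: "S p0 = 0"
  obtains \<phi> where "smooth_fun A UNIV \<phi>" "\<And>p. 0 < R p + lap \<phi> p"
proof -
  have contS: "continuous_on UNIV S" by (rule smooth_fun_continuous[OF open_UNIV S(1)])
  define Z where "Z = {p. S p < \<sigma> / 16}"
  have oZ: "open Z" unfolding Z_def by (intro open_Collect_less contS continuous_on_const)
  have p0Z: "p0 \<in> Z" using p0 \<sigma> by (simp add: Z_def)
  obtain \<psi> where \<psi>: "smooth_fun A UNIV \<psi>" "\<And>p. p \<notin> Z \<Longrightarrow> 0 < lap \<psi> p"
    by (rule positive_lap_off[OF cpt conn oZ p0Z]) blast
  have cptc: "compact (- U)" if "open U" for U :: "'a set"
    using compact_Int_closed[OF cpt] that by (metis closed_Compl inf_top_left)
  obtain \<delta> where \<delta>: "0 < \<delta>" "\<And>p. p \<in> - V \<Longrightarrow> \<delta> \<le> R p"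
    by (rule compact_positive_lower_bound[OF cptc[OF V(1)] continuous_on_subset[OF R(1)]]) (use V in auto)
  obtain m where m: "0 < m" "\<And>p. p \<in> - Z \<Longrightarrow> m \<le> lap \<psi> p"
    by (rule compact_positive_lower_bound[OF cptc[OF oZ] lap_continuous_on[OF \<psi>(1)]]) (use \<psi> in auto)
  obtain B where B: "0 \<le> B" "\<And>p. \<bar>lap \<psi> p\<bar> \<le> B"
    using compact_abs_bound[OF cpt lap_continuous_on[OF \<psi>(1)]] by (metis UNIV_I)
  obtain P where P: "0 \<le> P" "\<And>p. \<bar>\<psi> p\<bar> \<le> P"
    using compact_abs_bound[OF cpt smooth_fun_continuous[OF open_UNIV \<psi>(1)]] by (metis UNIV_I)
  obtain B1 where B1: "0 \<le> B1" "\<And>p. \<bar>R p\<bar> \<le> B1"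
    using compact_abs_bound[OF cpt R(1)] by (metis UNIV_I)
  \<comment> \<open>The first bound keeps \<open>exp (\<epsilon> \<psi>)\<close> between \<open>1/2\<close> and \<open>2\<close>, so that \<open>F \<le> 1\<close> on \<open>Z\<close> and \<open>F \<ge> 2\<close> on \<open>V\<close>; the second makes \<open>\<epsilon> \<bar>\<Delta> \<psi>\<bar> < \<delta>\<close>.\<close>
  define \<epsilon> where "\<epsilon> = min (1 / (2 * (P + 1))) (\<delta> / (2 * (B + 1)))"
  have \<epsilon>: "0 < \<epsilon>" using P B \<delta> by (simp add: \<epsilon>_def)
  have \<epsilon>P: "\<bar>\<epsilon> * \<psi> p\<bar> \<le> 1 / 2" for p
  proof -
    have "\<bar>\<epsilon> * \<psi> p\<bar> \<le> (1 / (2 * (P + 1))) * (P + 1)"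
      unfolding abs_mult using \<epsilon> P(1) P(2)[of p] by (intro mult_mono) (auto simp: \<epsilon>_def)
    also have "\<dots> = 1 / 2" using P(1) by (simp add: field_simps)
    finally show ?thesis .
  qed
  have \<epsilon>B: "\<bar>\<epsilon> * lap \<psi> p\<bar> < \<delta>" for p
  proof -
    have "\<bar>\<epsilon> * lap \<psi> p\<bar> \<le> (\<delta> / (2 * (B + 1))) * (B + 1)"
      unfolding abs_mult using \<epsilon> B(1) B(2)[of p] \<delta> by (intro mult_mono) (auto simp: \<epsilon>_def)
    also have "\<dots> = \<delta> / 2" using B(1) by (simp add: field_simps)
    also have "\<dots> < \<delta>" using \<delta>(1) by simp
    finally show ?thesis .
  qed
  obtain n where n: "B1 / (\<epsilon> * m) < 2 ^ n" using real_arch_pow[of 2] by auto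
  \<comment> \<open>An exponent \<open>\<ge> 3\<close> makes the first two derivatives of \<open>x\<^sup>N\<close> vanish at \<open>0\<close>, so that \<open>\<Delta> \<phi> = 0\<close> on the zero set of \<open>S\<close>.\<close>
  define N where "N = n + 3"
  have N0: "0 < real N" by (simp add: N_def)
  have NB: "B1 < 2 ^ N * (\<epsilon> * m)"
  proof -
    have "(2::real) ^ n \<le> 2 ^ N" by (intro power_increasing) (auto simp: N_def)
    then have "B1 / (\<epsilon> * m) < 2 ^ N" using n by linarith
    then show ?thesis using \<epsilon> m by (simp add: field_simps)
  qed
  define F where "F p = S p * (4 / \<sigma>) * exp (\<epsilon> * \<psi> p)" for p
  have F0: "0 \<le> F p" for p using S(2)[of p] \<sigma> by (simp add: F_def)
  have sF: "smooth_fun A UNIV F" unfolding F_def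
    by (intro smooth_fun_mult smooth_fun_exp smooth_fun_cmult smooth_fun_const S \<psi> open_UNIV)
  define \<phi> where "\<phi> p = (1 / real N) * ln (1 + F p ^ N)" for p
  have F1: "0 < 1 + F p ^ N" for p using F0[of p] by (simp add: add_pos_nonneg)
  have s\<phi>: "smooth_fun A UNIV \<phi>" unfolding \<phi>_def
    by (intro smooth_fun_cmult smooth_fun_ln smooth_fun_add smooth_fun_const smooth_fun_power sF open_UNIV F1)
  have expb: "exp (\<epsilon> * \<psi> p) \<le> 2" "1 / 2 \<le> exp (\<epsilon> * \<psi> p)" for p
  proof -
    have "exp (\<epsilon> * \<psi> p) \<le> exp (1 / 2)" "exp (- (1 / 2)) \<le> exp (\<epsilon> * \<psi> p)"
      using \<epsilon>P[of p] by (auto simp: abs_le_iff)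
    moreover have "1 / 2 \<le> exp (- (1 / 2) :: real)"
      using exp_half_le2 by (simp add: exp_minus field_simps)
    ultimately show "exp (\<epsilon> * \<psi> p) \<le> 2" "1 / 2 \<le> exp (\<epsilon> * \<psi> p)"
      using exp_half_le2 by linarith+
  qed
  have FZ: "F p \<le> 1" if "p \<in> Z" for p
  proof -
    have "F p \<le> (\<sigma> / 16 * (4 / \<sigma>)) * 2"
      unfolding F_def using that S(2)[of p] \<sigma> expb(1)[of p] by (intro mult_mono) (auto simp: Z_def)
    then show ?thesis using \<sigma> by simp
  qed
  have FV: "2 \<le> F p" if "p \<in> V" for p
  proof -
    have "\<sigma> * (4 / \<sigma>) * (1 / 2) \<le> F p"
      unfolding F_def using \<sigma>(2)[OF that] S(2)[of p] \<sigma> expb(2)[of p] by (intro mult_mono) auto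
    then show ?thesis using \<sigma> by simp
  qed
  have VZ: "p \<notin> Z" if "p \<in> V" for p using \<sigma>(1) \<sigma>(2)[OF that] by (auto simp: Z_def)
  have "0 < R p + lap \<phi> p" for p
  proof (cases "S p = 0")
    case True
    then have Fp: "F p = 0" by (simp add: F_def)
    have "p \<notin> V" using \<sigma>(1) \<sigma>(2)[of p] True by auto
    then have "0 < R p" using V by blast
    moreover have "lap \<phi> p = 0"
    proof -
      let ?U = "{x :: real. 0 < 1 + x ^ N}"
      let ?\<theta>1 = "\<lambda>x :: real. x ^ (n + 2) / (1 + x ^ N)"
      have oU: "open ?U" by (intro open_Collect_less continuous_intros)
      have d1: "((\<lambda>x. (1 / real N) * ln (1 + x ^ N)) has_real_derivative ?\<theta>1 x) (at x)" if "x \<in> ?U" for x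
      proof -
        have "((\<lambda>x. 1 + x ^ N) has_real_derivative real N * x ^ (n + 2)) (at x)"
          by (auto intro!: derivative_eq_intros simp: N_def)
        from DERIV_cmult[OF DERIV_chain2[OF DERIV_ln this], of "1 / real N"]
        have "((\<lambda>x. (1 / real N) * ln (1 + x ^ N)) has_real_derivative
            (1 / real N) * (inverse (1 + x ^ N) * (real N * x ^ (n + 2)))) (at x)" using that by simp
        moreover have "(1 / real N) * (inverse (1 + x ^ N) * (real N * x ^ (n + 2))) = ?\<theta>1 x"
          using N0 by (simp only: divide_inverse) simp
        ultimately show ?thesis by metis
      qed
      have d2: "(?\<theta>1 has_real_derivative 0) (at (F p))"
        unfolding Fp by (auto intro!: derivative_eq_intros simp: N_def power_add)
      obtain q where "lap (\<lambda>q. (1 / real N) * ln (1 + F q ^ N)) p = ?\<theta>1 (F p) * lap F p + 0 * q"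
        by (rule lap_compose[OF open_UNIV UNIV_I sF s\<phi>[unfolded \<phi>_def] oU _ d1 d2]) (use F1 in auto)
      then show ?thesis by (simp add: \<phi>_def[abs_def] Fp)
    qed
    ultimately show ?thesis by simp
  next
    case False
    then have Sp: "0 < S p" using S(2)[of p] by simp
    define W where "W = {q. 0 < S q}"
    have oW: "open W" unfolding W_def by (intro open_Collect_less contS continuous_on_const)
    have pW: "p \<in> W" using Sp by (simp add: W_def)
    note sub = smooth_fun_subset[OF _ subset_UNIV]
    define w where "w q = (- 1) * (- ln (S q)) + \<epsilon> * \<psi> q + ln (4 / \<sigma>)" for q
    have slS: "smooth_fun A W (\<lambda>q. - ln (S q))"
      by (intro smooth_fun_minus smooth_fun_ln oW sub[OF S(1)]) (simp add: W_def)
    have s1: "smooth_fun A W (\<lambda>q. (- 1) * (- ln (S q)))" by (rule smooth_fun_cmult[OF oW slS])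
    have s2: "smooth_fun A W (\<lambda>q. \<epsilon> * \<psi> q)" by (rule smooth_fun_cmult[OF oW sub[OF \<psi>(1)]])
    have sw: "smooth_fun A W w" unfolding w_def
      by (intro smooth_fun_add[OF oW] smooth_fun_const s1 s2)
    have Fw: "F q = exp (w q)" if "q \<in> W" for q
      using that \<sigma>(1) by (simp add: F_def w_def W_def exp_add exp_ln mult_ac)
    have lw: "lap w p = - R p + \<epsilon> * lap \<psi> p"
      unfolding w_def lap_add_const_fun[OF oW pW smooth_fun_add[OF oW s1 s2]]
        lap_add[OF oW pW s1 s2] lap_cmult[OF oW pW slS] lap_cmult[OF oW pW sub[OF \<psi>(1)]] R(2)[OF Sp] by simp
    \<comment> \<open>Off the zero set of \<open>S\<close> the convex function \<open>\<kappa>\<close> of \<open>w = v - u = ln F\<close> may be used instead; its derivative is \<open>F\<^sup>N / (1 + F\<^sup>N)\<close>.\<close>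
    let ?\<kappa> = "\<lambda>x. (1 / real N) * ln (1 + exp (real N * x))"
    let ?\<kappa>1 = "\<lambda>x. 1 - 1 / (1 + exp (real N * x))"
    have e1: "0 < 1 + exp (real N * x)" for x by (simp add: add_pos_pos)
    have \<phi>w: "\<phi> q = ?\<kappa> (w q)" if "q \<in> W" for q
      by (simp add: \<phi>_def Fw[OF that] exp_of_nat_mult)
    have sk: "smooth_fun A W (\<lambda>q. ?\<kappa> (w q))"
      by (rule smooth_fun_cong[OF oW \<phi>w sub[OF s\<phi>]])
    let ?e = "exp (real N * w p)"
    let ?t2 = "real N * ?e / (1 + ?e)\<^sup>2"
    have d1: "(?\<kappa> has_real_derivative ?\<kappa>1 x) (at x)" for x
    proof -
      have "((\<lambda>x. 1 + exp (real N * x)) has_real_derivative real N * exp (real N * x)) (at x)"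
        by (auto intro!: derivative_eq_intros)
      from DERIV_cmult[OF DERIV_chain2[OF DERIV_ln[OF e1[of x]] this], of "1 / real N"]
      have "(?\<kappa> has_real_derivative (1 / real N) * (inverse (1 + exp (real N * x)) * (real N * exp (real N * x)))) (at x)" .
      moreover have "(1 / real N) * (inverse (1 + exp (real N * x)) * (real N * exp (real N * x))) = ?\<kappa>1 x"
      proof -
        have "(1 / real N) * (inverse e * (real N * (e - 1))) = 1 - 1 / e" if "0 < e" for e
          using that N0 by (simp add: field_simps)
        from this[OF e1[of x]] show ?thesis by simp
      qed
      ultimately show ?thesis by metis
    qed
    have d2: "(?\<kappa>1 has_real_derivative ?t2) (at (w p))"
      using e1[of "w p"] by (auto intro!: derivative_eq_intros simp: power2_eq_square)
    obtain q where q: "0 \<le> q" "lap (\<lambda>q. ?\<kappa> (w q)) p = ?\<kappa>1 (w p) * lap w p + ?t2 * q"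
      using lap_compose[OF oW pW sw sk open_UNIV UNIV_I d1 d2] .
    have "lap \<phi> p = lap (\<lambda>q. ?\<kappa> (w q)) p" by (rule lap_cong[OF oW pW \<phi>w])
    then have "lap \<phi> p \<ge> ?\<kappa>1 (w p) * lap w p" using q by simp
    then have "R p + lap \<phi> p \<ge> R p + ?\<kappa>1 (w p) * (- R p + \<epsilon> * lap \<psi> p)" unfolding lw by simp
    also have "R p + ?\<kappa>1 (w p) * (- R p + \<epsilon> * lap \<psi> p) = (R p + ?e * (\<epsilon> * lap \<psi> p)) / (1 + ?e)"
      using e1[of "w p"] by (simp add: field_simps)
    finally have le: "(R p + ?e * (\<epsilon> * lap \<psi> p)) / (1 + ?e) \<le> R p + lap \<phi> p" .
    have eF: "?e = F p ^ N" by (simp add: Fw[OF pW] exp_of_nat_mult)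
    have "0 < R p + ?e * (\<epsilon> * lap \<psi> p)"
    proof -
      consider "p \<in> Z" | "p \<in> V" | "p \<notin> Z" "p \<notin> V" by blast
      then show ?thesis
      proof cases
        case 1
        then have "\<delta> \<le> R p" using \<delta>(2) VZ by blast
        moreover have "\<bar>?e * (\<epsilon> * lap \<psi> p)\<bar> \<le> 1 * \<bar>\<epsilon> * lap \<psi> p\<bar>"
          unfolding eF abs_mult[of "F p ^ N"] using F0[of p] FZ[OF 1] by (intro mult_right_mono) (auto intro: power_le_one)
        ultimately show ?thesis using \<epsilon>B[of p] by linarith
      next
        case 2
        have "2 ^ N * (\<epsilon> * m) \<le> ?e * (\<epsilon> * lap \<psi> p)"
          unfolding eF using FV[OF 2] m(1) m(2)[of p] VZ[OF 2] \<epsilon> by (intro mult_mono power_mono) auto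
        then show ?thesis using NB B1(2)[of p] by (simp add: abs_le_iff)
      next
        case 3
        then have "0 < R p" "0 < \<epsilon> * lap \<psi> p" using V \<psi>(2) \<epsilon> by auto
        then show ?thesis by (simp add: add_pos_pos)
      qed
    qed
    then show ?thesis using le e1[of "w p"] by (smt (verit) divide_pos_pos)
  qed
  then show ?thesis using that s\<phi> by blast
qed

text \<open>A multiple of a function \<open>\<psi>\<close> with positive Laplacian off a neighbourhood \<open>V\<close> of \<open>q0\<close> makes the
  curvature positive off \<open>V\<close>. The relation between \<open>S\<close> and \<open>R\<close> persists when both are twisted by this
  multiple, and \<open>S\<close> stays bounded below on \<open>V\<close>, so \<open>glue_potential\<close> applies.\<close>

lemma compact_potential:
  fixes S :: "'a \<Rightarrow> real" and R :: "'a \<Rightarrow> real"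
  assumes cpt: "compact (UNIV :: 'a set)" and conn: "connected (UNIV :: 'a set)"
    and S: "smooth_fun A UNIV S" "\<And>p. 0 \<le> S p"
    and R: "continuous_on UNIV R" "\<And>p. 0 < S p \<Longrightarrow> lap (\<lambda>q. - ln (S q)) p = R p"
    and p0: "S p0 = 0" and q0: "0 < S q0"
  obtains \<phi> where "smooth_fun A UNIV \<phi>" "\<And>p. 0 < R p + lap \<phi> p"
proof -
  have contS: "continuous_on UNIV S" by (rule smooth_fun_continuous[OF open_UNIV S(1)])
  define V where "V = {p. S q0 / 2 < S p}"
  have oV: "open V" unfolding V_def by (intro open_Collect_less contS continuous_on_const)
  obtain \<psi> where \<psi>: "smooth_fun A UNIV \<psi>" "\<And>p. p \<notin> V \<Longrightarrow> 0 < lap \<psi> p"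
    by (rule positive_lap_off[OF cpt conn oV, of q0]) (use q0 in \<open>auto simp: V_def\<close>)
  have cV: "compact (- V)" using compact_Int_closed[OF cpt] oV by (metis closed_Compl inf_top_left)
  obtain m where m: "0 < m" "\<And>p. p \<in> - V \<Longrightarrow> m \<le> lap \<psi> p"
    by (rule compact_positive_lower_bound[OF cV lap_continuous_on[OF \<psi>(1)]]) (use \<psi> in auto)
  obtain B where B: "0 \<le> B" "\<And>p. \<bar>R p\<bar> \<le> B"
    using compact_abs_bound[OF cpt R(1)] by (metis UNIV_I)
  obtain P where P: "0 \<le> P" "\<And>p. \<bar>\<psi> p\<bar> \<le> P"
    using compact_abs_bound[OF cpt smooth_fun_continuous[OF open_UNIV \<psi>(1)]] by (metis UNIV_I)
  define a where "a = (B + 1) / m"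
  have a: "0 \<le> a" "a * m = B + 1" using m B by (auto simp: a_def)
  let ?S = "\<lambda>p. S p * exp (- a * \<psi> p)"
  let ?R = "\<lambda>p. R p + a * lap \<psi> p"
  have s: "smooth_fun A UNIV ?S"
    by (intro smooth_fun_mult smooth_fun_exp smooth_fun_cmult S \<psi> open_UNIV)
  have cR: "continuous_on UNIV ?R" by (intro continuous_intros R lap_continuous_on \<psi>)
  have lapS: "lap (\<lambda>q. - ln (?S q)) p = ?R p" if "0 < ?S p" for p
  proof -
    have Sp: "0 < S p" using that by (simp add: zero_less_mult_iff)
    define W where "W = {q. 0 < S q}"
    have oW: "open W" unfolding W_def by (intro open_Collect_less contS continuous_on_const)
    have pW: "p \<in> W" using Sp by (simp add: W_def)
    have s1: "smooth_fun A W (\<lambda>q. - ln (S q))"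
      by (intro smooth_fun_minus smooth_fun_ln oW smooth_fun_subset[OF S(1)]) (auto simp: W_def)
    have s2: "smooth_fun A W \<psi>" by (rule smooth_fun_subset[OF \<psi>(1)]) simp
    have "lap (\<lambda>q. - ln (?S q)) p = lap (\<lambda>q. - ln (S q) + a * \<psi> q) p"
      by (rule lap_cong[OF oW pW]) (simp add: W_def ln_mult)
    also have "\<dots> = R p + a * lap \<psi> p"
      unfolding lap_add[OF oW pW s1 smooth_fun_cmult[OF oW s2]] lap_cmult[OF oW pW s2] R(2)[OF Sp] ..
    finally show ?thesis .
  qed
  have posR: "0 < ?R p" if "p \<notin> V" for p
  proof -
    have "B + 1 \<le> a * lap \<psi> p" unfolding a(2)[symmetric] using m(2)[of p] that a(1) by (intro mult_left_mono) auto
    then show ?thesis using B(2)[of p] by (simp add: abs_le_iff)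
  qed
  define \<sigma> where "\<sigma> = S q0 / 2 * exp (- (a * P))"
  have \<sigma>: "0 < \<sigma>" using q0 by (simp add: \<sigma>_def)
  have lowS: "\<sigma> \<le> ?S p" if "p \<in> V" for p
    unfolding \<sigma>_def
  proof (rule mult_mono)
    have "a * \<psi> p \<le> a * P" using P(2)[of p] a(1) by (intro mult_left_mono) auto
    then show "exp (- (a * P)) \<le> exp (- a * \<psi> p)" by simp
  qed (use that q0 S(2) in \<open>auto simp: V_def\<close>)
  obtain \<phi> where \<phi>: "smooth_fun A UNIV \<phi>" "\<And>p. 0 < ?R p + lap \<phi> p"
    by (rule glue_potential[OF cpt conn s _ cR lapS oV posR \<sigma> lowS, of p0]) (use S(2) p0 in auto)
  show ?thesis
  proof
    show "smooth_fun A UNIV (\<lambda>p. \<phi> p + a * \<psi> p)"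
      by (intro smooth_fun_add smooth_fun_cmult open_UNIV \<phi> \<psi>)
    show "0 < R p + lap (\<lambda>p. \<phi> p + a * \<psi> p) p" for p
      using \<phi>(2)[of p] by (simp add: lap_lincomb[OF \<phi>(1) \<psi>(1)] algebra_simps)
  qed
qed

section \<open>The potential on a noncompact manifold\<close>

text \<open>The set \<open>Q\<close> of points of \<open>L'\<close> where the inequality fails is compact and disjoint from \<open>L\<close>. As \<open>L\<close> is
  filled, each point of \<open>Q\<close> can be joined off \<open>L\<close> to a point outside \<open>L'\<close>. This yields a function
  supported off \<open>L\<close> with nonnegative Laplacian on \<open>L'\<close>, positive on \<open>Q\<close>; a large multiple of it is
  added.\<close>

lemma extend_potential:
  assumes \<phi>: "smooth_fun A UNIV \<phi>" "\<And>p. p \<in> L \<Longrightarrow> \<rho> p < lap \<phi> p" and \<rho>: "continuous_on UNIV \<rho>"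
    and L: "compact L" "filled L" and L': "compact L'"
  obtains \<phi>' where "smooth_fun A UNIV \<phi>'" "\<And>p. p \<in> L \<Longrightarrow> \<phi>' p = \<phi> p" "\<And>p. p \<in> L' \<Longrightarrow> \<rho> p < lap \<phi>' p"
proof -
  define N where "N = {p. \<rho> p < lap \<phi> p}"
  have oN: "open N" unfolding N_def by (intro open_Collect_less \<rho> lap_continuous_on \<phi>)
  define Q where "Q = L' - N"
  have cQ: "compact Q" unfolding Q_def using L' oN by (rule compact_diff)
  have oH: "open (- L)" and oV: "open (- L')" using L(1) L' by (auto simp: compact_imp_closed open_Compl)
  have reachV: "\<exists>y\<in>- L'. reach (- L) x y" if x: "x \<in> Q" for x
  proof -
    let ?C = "connected_component_set (- L) x"
    have xL: "x \<notin> L" using x \<phi>(2) by (auto simp: Q_def N_def)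
    then have "\<not> ?C \<subseteq> L'" using L(2) L' unfolding filled_def by blast
    then obtain y where y: "y \<in> ?C" "y \<notin> L'" by blast
    have "x \<in> ?C" using xL by (simp add: connected_component_refl)
    then have "reach ?C x y"
      by (rule reach_connected[OF open_component[OF oH] connected_connected_component _ y(1)])
    then have "reach (- L) x y" by (rule reach_mono[OF _ connected_component_subset])
    then show ?thesis using y by blast
  qed
  obtain \<beta> where \<beta>: "cpt_smooth (- L) \<beta>" "\<And>p. p \<notin> - L' \<Longrightarrow> 0 \<le> lap \<beta> p" "\<And>p. p \<in> Q - (- L') \<Longrightarrow> 0 < lap \<beta> p"
    using positive_lap_on_compact[OF cQ oV reachV] by metis
  note s\<beta> = cpt_smooth_smooth[OF \<beta>(1)]
  obtain m where m: "0 < m" "\<And>p. p \<in> Q \<Longrightarrow> m \<le> lap \<beta> p"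
    by (rule compact_positive_lower_bound[OF cQ lap_continuous_on[OF s\<beta>]]) (use \<beta>(3) in \<open>auto simp: Q_def\<close>)
  have cont: "continuous_on Q (\<lambda>p. \<rho> p - lap \<phi> p)"
    by (intro continuous_intros continuous_on_subset[OF \<rho>] lap_continuous_on \<phi>) auto
  obtain B where B: "0 \<le> B" "\<And>p. p \<in> Q \<Longrightarrow> \<bar>\<rho> p - lap \<phi> p\<bar> \<le> B"
    by (rule compact_abs_bound[OF cQ cont]) blast
  define a where "a = (B + 1) / m"
  have a: "0 \<le> a" "a * m = B + 1" using m B by (auto simp: a_def)
  have lap: "lap (\<lambda>p. \<phi> p + a * \<beta> p) p = lap \<phi> p + a * lap \<beta> p" for p
    by (rule lap_lincomb[OF \<phi>(1) s\<beta>])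
  show ?thesis
  proof
    show "smooth_fun A UNIV (\<lambda>p. \<phi> p + a * \<beta> p)"
      by (intro smooth_fun_add smooth_fun_cmult open_UNIV \<phi> s\<beta>)
    show "\<phi> p + a * \<beta> p = \<phi> p" if "p \<in> L" for p
      using \<beta>(1) that unfolding cpt_smooth_def by (metis ComplD add_0_right mult_zero_right subsetD)
    show "\<rho> p < lap (\<lambda>p. \<phi> p + a * \<beta> p) p" if p: "p \<in> L'" for p
    proof (cases "p \<in> N")
      case True
      moreover have "0 \<le> a * lap \<beta> p" using \<beta>(2)[of p] p a by simp
      ultimately show ?thesis unfolding lap N_def by simp
    next
      case False
      then have pQ: "p \<in> Q" using p by (simp add: Q_def)
      have "B + 1 \<le> a * lap \<beta> p" unfolding a(2)[symmetric] using m(2)[OF pQ] a(1) by (rule mult_left_mono)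
      then show ?thesis using B(2)[OF pQ] unfolding lap by (simp add: abs_le_iff)
    qed
  qed
qed

lemma noncompact_potential:
  assumes conn: "connected (UNIV :: 'a set)" and nc: "\<not> compact (UNIV :: 'a set)" and \<rho>: "continuous_on UNIV \<rho>"
  obtains \<phi> where "smooth_fun A UNIV \<phi>" "\<And>p. \<rho> p < lap \<phi> p"
proof -
  obtain E :: "nat \<Rightarrow> 'a set" where E: "\<And>k. compact (E k)" "\<And>k. filled (E k)"
    "\<And>k. E k \<subseteq> interior (E (Suc k))" "(\<Union>k. E k) = UNIV"
    using exhaustion[OF filled_hull[OF conn nc]] by metis
  define good where "good k \<phi> \<longleftrightarrow> smooth_fun A UNIV \<phi> \<and> (\<forall>p\<in>E k. \<rho> p < lap \<phi> p)" for k \<phi>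
  have fe: "filled ({} :: 'a set)"
  proof -
    have "connected_component_set UNIV x = (UNIV :: 'a set)" for x
      using connected_component_maximal[of x UNIV UNIV] conn by auto
    moreover have "\<not> UNIV \<subseteq> Q" if "compact Q" for Q :: "'a set" using nc that top.extremum_uniqueI by metis
    ultimately show ?thesis unfolding filled_def by simp
  qed
  have "\<exists>f. \<forall>k. good k (f k) \<and> (\<forall>p\<in>E k. f (Suc k) p = f k p)"
  proof (rule dependent_nat_choice)
    show "\<exists>\<phi>. good 0 \<phi>"
    proof -
      obtain \<phi>' where "smooth_fun A UNIV \<phi>'" "\<And>p. p \<in> {} \<Longrightarrow> \<phi>' p = 0" "\<And>p. p \<in> E 0 \<Longrightarrow> \<rho> p < lap \<phi>' p"
        by (rule extend_potential[OF smooth_fun_const[of UNIV 0] _ \<rho> compact_empty fe E(1)[of 0]]) auto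
      then show ?thesis by (auto simp: good_def)
    qed
    fix \<phi> k assume "good k \<phi>"
    then have *: "smooth_fun A UNIV \<phi>" "\<And>p. p \<in> E k \<Longrightarrow> \<rho> p < lap \<phi> p" by (auto simp: good_def)
    obtain \<phi>' where "smooth_fun A UNIV \<phi>'" "\<And>p. p \<in> E k \<Longrightarrow> \<phi>' p = \<phi> p" "\<And>p. p \<in> E (Suc k) \<Longrightarrow> \<rho> p < lap \<phi>' p"
      using extend_potential[OF * \<rho> E(1,2,1)] by metis
    then show "\<exists>\<phi>'. good (Suc k) \<phi>' \<and> (\<forall>p\<in>E k. \<phi>' p = \<phi> p)" by (auto simp: good_def)
  qed
  then obtain f where f: "\<And>k. good k (f k)" "\<And>k p. p \<in> E k \<Longrightarrow> f (Suc k) p = f k p" by metis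
  have mono: "E k \<subseteq> E (Suc k)" for k using E(3)[of k] interior_subset by blast
  obtain F where F: "\<And>k (x::unit) p. p \<in> E k \<Longrightarrow> F x p = f k p"
    using stationary_limit[of E "\<lambda>k (x::unit) p. f k p", OF mono E(4) f(2)] by metis
  have nbhd: "\<exists>k. p \<in> interior (E (Suc k))" for p using E(3,4) by blast
  have agree: "F () q = f (Suc k) q" if "q \<in> interior (E (Suc k))" for q k
    using F that interior_subset by blast
  show ?thesis
  proof
    show "smooth_fun A UNIV (F ())"
    proof (rule smooth_fun_local)
      fix p :: 'a
      obtain k where k: "p \<in> interior (E (Suc k))" using nbhd by blast
      have "smooth_fun A (interior (E (Suc k))) (f (Suc k))"
        using f(1)[of "Suc k"] unfolding good_def by (auto intro: smooth_fun_subset)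
      then have "smooth_fun A (interior (E (Suc k))) (F ())"
        by (rule smooth_fun_cong[OF open_interior, rotated]) (simp add: agree)
      then show "\<exists>N. open N \<and> p \<in> N \<and> smooth_fun A N (F ())"
        using k by (intro exI[of _ "interior (E (Suc k))"]) simp
    qed
    fix p
    obtain k where k: "p \<in> interior (E (Suc k))" using nbhd by blast
    have "lap (F ()) p = lap (f (Suc k)) p" by (rule lap_cong[OF open_interior k agree])
    then show "\<rho> p < lap (F ()) p"
      using f(1)[of "Suc k"] k interior_subset unfolding good_def by auto
  qed
qed

end

section \<open>Metrics in a line bundle and their curvature\<close>

locale line_bundle = hermitian_mfd A g
  for A :: "('a::{t2_space, second_countable_topology}, 'n::finite) chart set"
    and g :: "('a, 'n) tensor" +
  fixes \<pi> :: "'e \<Rightarrow> 'a" and T :: "('a, 'e) triv set"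
  assumes line_bundle: "holomorphic_line_bundle A \<pi> T"
begin

lemma triv_cover: obtains c where "c \<in> T" "p \<in> fst c"
proof -
  have "(\<Union>(U, t)\<in>T. U) = UNIV" using line_bundle unfolding holomorphic_line_bundle_def by (elim conjE)
  then have "p \<in> (\<Union>(U, t)\<in>T. U)" by simp
  then show ?thesis using that by auto
qed

lemma triv_data:
  assumes "c \<in> T"
  shows "open (fst c) \<and> bij_betw (\<lambda>e. (\<pi> e, snd c e)) (\<pi> -` fst c) (fst c \<times> UNIV)"
proof -
  have "\<forall>(U, t)\<in>T. open U \<and> bij_betw (\<lambda>e. (\<pi> e, t e)) (\<pi> -` U) (U \<times> UNIV)"
    using line_bundle unfolding holomorphic_line_bundle_def by (elim conjE)
  from bspec[OF this assms] show ?thesis by (simp add: case_prod_unfold)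
qed

lemma triv_open: "c \<in> T \<Longrightarrow> open (fst c)"
  using triv_data by blast

lemma triv_unit:
  assumes "c \<in> T" "p \<in> fst c" obtains e where "\<pi> e = p" "snd c e = 1"
proof -
  have "(p, 1) \<in> (\<lambda>e. (\<pi> e, snd c e)) ` (\<pi> -` fst c)"
    using triv_data[OF assms(1)] assms(2) unfolding bij_betw_def by auto
  then show ?thesis using that by auto
qed

lemma transition:
  assumes "c \<in> T" "d \<in> T"
  obtains \<tau> where "holomorphic_fun A (fst c \<inter> fst d) \<tau>" "\<And>p. p \<in> fst c \<inter> fst d \<Longrightarrow> \<tau> p \<noteq> 0"
    "\<And>e. \<pi> e \<in> fst c \<inter> fst d \<Longrightarrow> snd c e = \<tau> (\<pi> e) * snd d e"
proof -
  have "\<forall>(U, t)\<in>T. \<forall>(V, u)\<in>T. \<exists>\<tau>. holomorphic_fun A (U \<inter> V) \<tau> \<and>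
        (\<forall>p\<in>U \<inter> V. \<tau> p \<noteq> 0) \<and> (\<forall>e. \<pi> e \<in> U \<inter> V \<longrightarrow> t e = \<tau> (\<pi> e) * u e)"
    using line_bundle unfolding holomorphic_line_bundle_def by (elim conjE)
  from bspec[OF bspec[OF this assms(1), unfolded case_prod_unfold] assms(2)]
  show ?thesis using that by (auto simp: case_prod_unfold)
qed

text \<open>A possibly degenerate Hermitian metric, given by its factor \<open>\<rho> c\<close> in each trivialization \<open>c\<close>. Admitting zeros gives a class that is closed
  under sums and contains metrics cut off by bumps.\<close>

definition preweights :: "(('a, 'e) triv \<Rightarrow> 'a \<Rightarrow> real) \<Rightarrow> bool" where
  "preweights \<rho> \<longleftrightarrow>
     (\<forall>c\<in>T. smooth_fun A (fst c) (\<rho> c) \<and> (\<forall>p\<in>fst c. 0 \<le> \<rho> c p)) \<and>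
     (\<forall>c\<in>T. \<forall>d\<in>T. \<forall>e. \<pi> e \<in> fst c \<inter> fst d \<longrightarrow>
        \<rho> c (\<pi> e) * (norm (snd c e))\<^sup>2 = \<rho> d (\<pi> e) * (norm (snd d e))\<^sup>2)"

lemma preweights_smooth: "preweights \<rho> \<Longrightarrow> c \<in> T \<Longrightarrow> smooth_fun A (fst c) (\<rho> c)"
  and preweights_nonneg: "preweights \<rho> \<Longrightarrow> c \<in> T \<Longrightarrow> p \<in> fst c \<Longrightarrow> 0 \<le> \<rho> c p"
  and preweights_eq: "preweights \<rho> \<Longrightarrow> c \<in> T \<Longrightarrow> d \<in> T \<Longrightarrow> \<pi> e \<in> fst c \<Longrightarrow> \<pi> e \<in> fst d \<Longrightarrow>
     \<rho> c (\<pi> e) * (norm (snd c e))\<^sup>2 = \<rho> d (\<pi> e) * (norm (snd d e))\<^sup>2"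
  unfolding preweights_def by blast+

lemma preweights_transition:
  assumes \<rho>: "preweights \<rho>" "c \<in> T" "d \<in> T"
    and \<tau>: "\<And>e. \<pi> e \<in> fst c \<inter> fst d \<Longrightarrow> snd c e = \<tau> (\<pi> e) * snd d e" and p: "p \<in> fst c \<inter> fst d"
  shows "\<rho> d p = \<rho> c p * (norm (\<tau> p))\<^sup>2"
proof -
  obtain e where e: "\<pi> e = p" "snd d e = 1" using triv_unit[OF \<rho>(3), of p] p by auto
  then have "snd c e = \<tau> p" using \<tau>[of e] p by simp
  then show ?thesis using preweights_eq[OF \<rho>, of e] e p by simp
qed

lemma preweights_pos_indep:
  assumes "preweights \<rho>" "c \<in> T" "d \<in> T" "p \<in> fst c" "p \<in> fst d" "0 < \<rho> c p"
  shows "0 < \<rho> d p"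
proof -
  obtain \<tau> where "\<And>p. p \<in> fst c \<inter> fst d \<Longrightarrow> \<tau> p \<noteq> 0"
    "\<And>e. \<pi> e \<in> fst c \<inter> fst d \<Longrightarrow> snd c e = \<tau> (\<pi> e) * snd d e"
    using transition[OF assms(2,3)] by metis
  then show ?thesis using preweights_transition[OF assms(1-3), of \<tau> p] assms(4-6) by auto
qed

lemma preweights_add:
  assumes "preweights \<rho>" "preweights \<sigma>" shows "preweights (\<lambda>c p. \<rho> c p + \<sigma> c p)"
  unfolding preweights_def
proof (intro conjI ballI allI impI)
  fix c assume c: "c \<in> T"
  show "smooth_fun A (fst c) (\<lambda>p. \<rho> c p + \<sigma> c p)"
    by (intro smooth_fun_add triv_open preweights_smooth c assms)
  fix p assume "p \<in> fst c"
  then show "0 \<le> \<rho> c p + \<sigma> c p" using preweights_nonneg assms c by (simp add: add_nonneg_nonneg)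
next
  fix c d e assume "c \<in> T" "d \<in> T" "\<pi> e \<in> fst c \<inter> fst d"
  then show "(\<rho> c (\<pi> e) + \<sigma> c (\<pi> e)) * (norm (snd c e))\<^sup>2 = (\<rho> d (\<pi> e) + \<sigma> d (\<pi> e)) * (norm (snd d e))\<^sup>2"
    using preweights_eq[OF assms(1), of c d e] preweights_eq[OF assms(2), of c d e] by (simp add: distrib_right)
qed

lemma preweights_0: "preweights (\<lambda>c p. 0)"
  unfolding preweights_def by (simp add: smooth_fun_const)

lemma preweights_sum:
  "finite I \<Longrightarrow> (\<And>i. i \<in> I \<Longrightarrow> preweights (\<rho> i)) \<Longrightarrow> preweights (\<lambda>c p. \<Sum>i\<in>I. \<rho> i c p)"
  by (induction I rule: finite_induct) (auto intro: preweights_0 preweights_add)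

text \<open>The flat metric of a trivialization around \<open>x\<close>, cut off by a bump.\<close>

lemma preweights_bump:
  assumes H: "open H" "x \<in> H"
  obtains \<sigma> N where "preweights \<sigma>" "open N" "x \<in> N" "\<And>c p. p \<notin> H \<Longrightarrow> \<sigma> c p = 0"
    "\<And>c p. c \<in> T \<Longrightarrow> p \<in> fst c \<Longrightarrow> p \<in> N \<Longrightarrow> 0 < \<sigma> c p"
proof -
  obtain c0 where c0: "c0 \<in> T" "x \<in> fst c0" by (rule triv_cover)
  have "open (H \<inter> fst c0)" "x \<in> H \<inter> fst c0" using H c0 triv_open[OF c0(1)] by auto
  then obtain b where b: "cpt_smooth (H \<inter> fst c0) b" "\<And>q. 0 \<le> b q" "0 < b x"
    using bump_function by metis
  then obtain K where K: "compact K" "K \<subseteq> H \<inter> fst c0" "\<And>p. p \<notin> K \<Longrightarrow> b p = 0"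
    unfolding cpt_smooth_def by metis
  note sb = cpt_smooth_smooth[OF b(1)]
  define unit where "unit d p = (SOME e. \<pi> e = p \<and> snd d e = 1)" for d :: "('a, 'e) triv" and p
  have unit: "\<pi> (unit d p) = p" "snd d (unit d p) = 1" if "d \<in> T" "p \<in> fst d" for d p
    using someI_ex[of "\<lambda>e. \<pi> e = p \<and> snd d e = 1"] triv_unit[OF that] unfolding unit_def by metis+
  define \<sigma> where "\<sigma> d p = b p * (norm (snd c0 (unit d p)))\<^sup>2" for d p
  have off: "\<sigma> d p = 0" if "p \<notin> K" for d p using K(3)[OF that] by (simp add: \<sigma>_def)
  have eq: "\<sigma> d (\<pi> e) * (norm (snd d e))\<^sup>2 = b (\<pi> e) * (norm (snd c0 e))\<^sup>2" if d: "d \<in> T" "\<pi> e \<in> fst d" for d e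
  proof (cases "\<pi> e \<in> K")
    case True
    then have pc: "\<pi> e \<in> fst c0 \<inter> fst d" using K d by auto
    obtain \<tau> where \<tau>: "\<And>e. \<pi> e \<in> fst c0 \<inter> fst d \<Longrightarrow> snd c0 e = \<tau> (\<pi> e) * snd d e"
      using transition[OF c0(1) d(1)] by metis
    have "snd c0 (unit d (\<pi> e)) = \<tau> (\<pi> e)" using \<tau>[of "unit d (\<pi> e)"] unit[OF d] pc by simp
    then show ?thesis using \<tau>[OF pc] by (simp add: \<sigma>_def norm_mult power_mult_distrib)
  next
    case False
    then show ?thesis using K(3) off by simp
  qed
  have smooth: "smooth_fun A (fst d) (\<sigma> d)" if d: "d \<in> T" for d
  proof (rule smooth_fun_local)
    fix p assume p: "p \<in> fst d"
    show "\<exists>N. open N \<and> p \<in> N \<and> smooth_fun A N (\<sigma> d)"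
    proof (cases "p \<in> fst c0")
      case True
      let ?N = "fst c0 \<inter> fst d"
      have oN: "open ?N" using triv_open c0 d by blast
      obtain \<tau> where \<tau>: "holomorphic_fun A ?N \<tau>" "\<And>e. \<pi> e \<in> ?N \<Longrightarrow> snd c0 e = \<tau> (\<pi> e) * snd d e"
        using transition[OF c0(1) d] by metis
      have "smooth_fun A ?N (\<lambda>p. b p * (norm (\<tau> p))\<^sup>2)"
        by (intro smooth_fun_mult smooth_fun_norm_sq holomorphic_fun_smooth oN \<tau> smooth_fun_subset[OF sb]) simp
      then have "smooth_fun A ?N (\<sigma> d)"
      proof (rule smooth_fun_cong[OF oN, rotated])
        fix q assume q: "q \<in> ?N"
        then have "snd c0 (unit d q) = \<tau> q" using \<tau>(2)[of "unit d q"] unit[OF d, of q] by simp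
        then show "b q * (norm (\<tau> q))\<^sup>2 = \<sigma> d q" by (simp add: \<sigma>_def)
      qed
      then show ?thesis using oN True p by (intro exI[of _ ?N]) simp
    next
      case False
      have oK: "open (- K)" using K(1) by (simp add: compact_imp_closed open_Compl)
      have "smooth_fun A (- K) (\<sigma> d)"
        by (rule smooth_fun_cong[OF oK _ smooth_fun_const[of _ 0]]) (simp add: off)
      then show ?thesis using False K(2) oK by (intro exI[of _ "- K"]) auto
    qed
  qed
  define N where "N = {p \<in> fst c0. 0 < b p}"
  show ?thesis
  proof
    have "0 \<le> \<sigma> c p" for c p using b(2) by (simp add: \<sigma>_def)
    then show "preweights \<sigma>" unfolding preweights_def by (simp add: smooth eq)
    have "open ({p. 0 < b p} \<inter> fst c0)"
      using smooth_fun_continuous[OF open_UNIV sb] triv_open[OF c0(1)]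
      by (intro open_Int open_Collect_less continuous_on_const)
    then show "open N" by (simp add: N_def Int_def conj_commute)
    show "x \<in> N" using c0 b(3) by (simp add: N_def)
    show "\<sigma> c p = 0" if "p \<notin> H" for c p using off[of p c] that K(2) by auto
    show "0 < \<sigma> c p" if "c \<in> T" "p \<in> fst c" "p \<in> N" for c p
    proof -
      have "p \<in> fst c0" using that(3) by (simp add: N_def)
      then obtain e where e: "\<pi> e = p" "snd c0 e = 1" using triv_unit[OF c0(1)] by metis
      have "\<sigma> c p * (norm (snd c e))\<^sup>2 = b p" using eq[of c e] e that by simp
      then show ?thesis using that(3) b(2)[of p] unfolding N_def
        by (auto simp: \<sigma>_def zero_less_mult_iff)
    qed
  qed
qed

text \<open>Positivity is extended from \<open>L\<close> to \<open>L'\<close> by adding cut-off metrics supported off \<open>L\<close>, near the compact set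
  where \<open>\<rho>\<close> may vanish.\<close>

lemma extend_preweights:
  assumes \<rho>: "preweights \<rho>" "\<And>c p. c \<in> T \<Longrightarrow> p \<in> fst c \<Longrightarrow> p \<in> L \<Longrightarrow> 0 < \<rho> c p"
    and L: "closed L" and L': "compact L'"
  obtains \<rho>' where "preweights \<rho>'" "\<And>c p. p \<in> L \<Longrightarrow> \<rho>' c p = \<rho> c p"
    "\<And>c p. c \<in> T \<Longrightarrow> p \<in> fst c \<Longrightarrow> p \<in> L' \<Longrightarrow> 0 < \<rho>' c p"
proof -
  define N where "N = (\<Union>c\<in>T. {p \<in> fst c. 0 < \<rho> c p})"
  have oN: "open N" unfolding N_def
  proof (intro open_UN ballI)
    fix c assume c: "c \<in> T"
    have "open (fst c \<inter> \<rho> c -` {0<..})"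
      by (rule continuous_open_preimage[OF smooth_fun_continuous[OF triv_open[OF c] preweights_smooth[OF \<rho>(1) c]] triv_open[OF c]]) simp
    then show "open {p \<in> fst c. 0 < \<rho> c p}" by (simp add: vimage_def Int_def)
  qed
  have LN: "p \<in> N" if "p \<in> L" for p
  proof -
    obtain c where "c \<in> T" "p \<in> fst c" by (rule triv_cover)
    then show ?thesis using \<rho>(2) that unfolding N_def by blast
  qed
  define Q where "Q = L' - N"
  have cQ: "compact Q" unfolding Q_def using L' oN by (rule compact_diff)
  define ok where "ok x \<sigma> M \<longleftrightarrow> preweights \<sigma> \<and> open M \<and> x \<in> M \<and> (\<forall>c p. p \<in> L \<longrightarrow> \<sigma> c p = 0) \<and>
    (\<forall>c p. c \<in> T \<longrightarrow> p \<in> fst c \<longrightarrow> p \<in> M \<longrightarrow> 0 < \<sigma> c p)" for x \<sigma> M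
  have "\<exists>\<sigma> M. ok x \<sigma> M" if x: "x \<in> Q" for x
  proof -
    have "open (- L)" "x \<in> - L" using L LN x by (auto simp: Q_def open_Compl)
    then obtain \<sigma> M where "preweights \<sigma>" "open M" "x \<in> M" "\<And>c p. p \<notin> - L \<Longrightarrow> \<sigma> c p = 0"
      "\<And>c p. c \<in> T \<Longrightarrow> p \<in> fst c \<Longrightarrow> p \<in> M \<Longrightarrow> 0 < \<sigma> c p"
      using preweights_bump by metis
    then have "ok x \<sigma> M" unfolding ok_def by simp
    then show ?thesis by blast
  qed
  then obtain \<sigma> M where \<sigma>M: "\<And>x. x \<in> Q \<Longrightarrow> ok x (\<sigma> x) (M x)" by metis
  obtain I where I: "I \<subseteq> Q" "finite I" "Q \<subseteq> (\<Union>x\<in>I. M x)"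
    by (rule compactE_image[OF cQ, of Q M]) (use \<sigma>M in \<open>auto simp: ok_def\<close>)
  have ok: "ok x (\<sigma> x) (M x)" if "x \<in> I" for x using \<sigma>M I that by blast
  let ?\<sigma> = "\<lambda>c p. \<Sum>x\<in>I. \<sigma> x c p"
  have pre: "preweights ?\<sigma>" by (rule preweights_sum[OF I(2)]) (use ok in \<open>auto simp: ok_def\<close>)
  show ?thesis
  proof
    show "preweights (\<lambda>c p. \<rho> c p + ?\<sigma> c p)" by (rule preweights_add[OF \<rho>(1) pre])
    show "\<rho> c p + ?\<sigma> c p = \<rho> c p" if p: "p \<in> L" for c p
    proof -
      have "\<sigma> x c p = 0" if "x \<in> I" for x using ok[OF that] p unfolding ok_def by blast
      then show ?thesis by simp
    qed
    show "0 < \<rho> c p + ?\<sigma> c p" if c: "c \<in> T" "p \<in> fst c" "p \<in> L'" for c p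
    proof (cases "p \<in> N")
      case True
      then obtain d where "d \<in> T" "p \<in> fst d" "0 < \<rho> d p" unfolding N_def by blast
      then have "0 < \<rho> c p" using preweights_pos_indep[OF \<rho>(1)] c by blast
      moreover have "0 \<le> ?\<sigma> c p" by (rule preweights_nonneg[OF pre c(1,2)])
      ultimately show ?thesis by simp
    next
      case False
      then obtain x where x: "x \<in> I" "p \<in> M x" using I(3) c by (auto simp: Q_def)
      have "0 < ?\<sigma> c p"
      proof (rule sum_pos2[OF I(2) x(1)])
        show "0 < \<sigma> x c p" using ok[OF x(1)] c x(2) unfolding ok_def by blast
        show "0 \<le> \<sigma> y c p" if "y \<in> I" for y
          using ok[OF that] preweights_nonneg[OF _ c(1,2)] unfolding ok_def by blast
      qed
      moreover have "0 \<le> \<rho> c p" by (rule preweights_nonneg[OF \<rho>(1) c(1,2)])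
      ultimately show ?thesis by simp
    qed
  qed
qed

definition weights :: "(('a, 'e) triv \<Rightarrow> 'a \<Rightarrow> real) \<Rightarrow> bool" where
  "weights \<rho> \<longleftrightarrow> preweights \<rho> \<and> (\<forall>c\<in>T. \<forall>p\<in>fst c. 0 < \<rho> c p)"

text \<open>The stagewise construction over an exhaustion replaces a partition of unity.\<close>

lemma weights_exist: obtains \<rho> where "weights \<rho>"
proof -
  obtain E :: "nat \<Rightarrow> 'a set" where E: "\<And>k. compact (E k)"
    "\<And>k. E k \<subseteq> interior (E (Suc k))" "(\<Union>k. E k) = UNIV"
    by (rule exhaustion[of "\<lambda>_. True"]) auto
  define good where "good k \<rho> \<longleftrightarrow> preweights \<rho> \<and> (\<forall>c p. c \<in> T \<longrightarrow> p \<in> fst c \<longrightarrow> p \<in> E k \<longrightarrow> 0 < \<rho> c p)" for k \<rho>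
  have "\<exists>f. \<forall>k. good k (f k) \<and> (\<forall>c. \<forall>p\<in>E k. f (Suc k) c p = f k c p)"
  proof (rule dependent_nat_choice)
    obtain \<rho>' where "preweights \<rho>'" "\<And>c p. p \<in> {} \<Longrightarrow> \<rho>' c p = 0"
      "\<And>c p. c \<in> T \<Longrightarrow> p \<in> fst c \<Longrightarrow> p \<in> E 0 \<Longrightarrow> 0 < \<rho>' c p"
      by (rule extend_preweights[OF preweights_0 _ closed_empty E(1)[of 0]]) auto
    then show "\<exists>\<rho>. good 0 \<rho>" unfolding good_def by blast
    fix \<rho> k assume "good k \<rho>"
    then have *: "preweights \<rho>" "\<And>c p. c \<in> T \<Longrightarrow> p \<in> fst c \<Longrightarrow> p \<in> E k \<Longrightarrow> 0 < \<rho> c p"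
      unfolding good_def by blast+
    obtain \<rho>' where "preweights \<rho>'" "\<And>c p. p \<in> E k \<Longrightarrow> \<rho>' c p = \<rho> c p"
      "\<And>c p. c \<in> T \<Longrightarrow> p \<in> fst c \<Longrightarrow> p \<in> E (Suc k) \<Longrightarrow> 0 < \<rho>' c p"
      by (rule extend_preweights[OF *(1) _ compact_imp_closed[OF E(1)[of k]] E(1)[of "Suc k"]]) (use *(2) in auto)
    then show "\<exists>\<rho>'. good (Suc k) \<rho>' \<and> (\<forall>c. \<forall>p\<in>E k. \<rho>' c p = \<rho> c p)" unfolding good_def by blast
  qed
  then obtain f where f: "\<And>k. good k (f k)" "\<And>k c p. p \<in> E k \<Longrightarrow> f (Suc k) c p = f k c p" by metis
  have mono: "E k \<subseteq> E (Suc k)" for k using E(2)[of k] interior_subset by blast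
  obtain F where F: "\<And>k c p. p \<in> E k \<Longrightarrow> F c p = f k c p"
    using stationary_limit[of E f, OF mono E(3) f(2)] by metis
  have pre: "preweights (f k)" for k using f(1)[of k] by (simp add: good_def)
  have nbhd: "\<exists>k. p \<in> interior (E (Suc k))" for p using E(2,3) by blast
  have agree: "F c q = f (Suc k) c q" if "q \<in> interior (E (Suc k))" for q k c
    using F that interior_subset by blast
  have Fk: "\<exists>k. \<forall>c. F c p = f k c p \<and> p \<in> E k" for p using F E(3) by blast
  have "weights F"
    unfolding weights_def preweights_def
  proof (intro conjI ballI allI impI)
    fix c assume c: "c \<in> T"
    show "smooth_fun A (fst c) (F c)"
    proof (rule smooth_fun_local)
      fix p assume p: "p \<in> fst c"
      obtain k where k: "p \<in> interior (E (Suc k))" using nbhd by blast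
      let ?N = "fst c \<inter> interior (E (Suc k))"
      have oN: "open ?N" using triv_open[OF c] open_interior by (rule open_Int)
      have "smooth_fun A ?N (f (Suc k) c)"
        by (rule smooth_fun_subset[OF preweights_smooth[OF pre c]]) simp
      then have "smooth_fun A ?N (F c)"
        by (rule smooth_fun_cong[OF oN, rotated]) (auto intro: agree[symmetric])
      then show "\<exists>N. open N \<and> p \<in> N \<and> smooth_fun A N (F c)" using oN p k by (intro exI[of _ ?N]) simp
    qed
  next
    fix c p assume c: "c \<in> T" "p \<in> fst c"
    obtain k where k: "F c p = f k c p" "p \<in> E k" using Fk[of p] by blast
    have "0 < f k c p" using f(1)[of k] c k(2) unfolding good_def by blast
    then show "0 < F c p" unfolding k(1) .
    then show "0 \<le> F c p" by simp
  next
    fix c d e assume c: "c \<in> T" "d \<in> T" "\<pi> e \<in> fst c \<inter> fst d"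
    obtain k where "\<And>c. F c (\<pi> e) = f k c (\<pi> e)" using Fk[of "\<pi> e"] by blast
    then show "F c (\<pi> e) * (norm (snd c e))\<^sup>2 = F d (\<pi> e) * (norm (snd d e))\<^sup>2"
      using preweights_eq[OF pre, of c d e k] c by simp
  qed
  then show ?thesis by (rule that)
qed

lemma weights_preweights: "weights \<rho> \<Longrightarrow> preweights \<rho>"
  and weights_pos: "weights \<rho> \<Longrightarrow> c \<in> T \<Longrightarrow> p \<in> fst c \<Longrightarrow> 0 < \<rho> c p"
  unfolding weights_def by blast+

lemma weights_smooth_ln:
  assumes "weights \<rho>" "c \<in> T" shows "smooth_fun A (fst c) (\<lambda>q. - ln (\<rho> c q))"
  using assms weights_pos preweights_smooth[OF weights_preweights]
  by (intro smooth_fun_minus smooth_fun_ln triv_open) auto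

text \<open>The scalar curvature of the metric with weights \<open>\<rho>\<close>. A trivialization is the same as a nonvanishing
  local section, namely the one with coordinate \<open>1\<close>, and the weight is the squared norm of this section.\<close>

definition scalar_curv :: "(('a, 'e) triv \<Rightarrow> 'a \<Rightarrow> real) \<Rightarrow> 'a \<Rightarrow> real" where
  "scalar_curv \<rho> p = lap (\<lambda>q. - ln (\<rho> (SOME c. c \<in> T \<and> p \<in> fst c) q)) p"

lemma curv_eq:
  assumes \<rho>: "weights \<rho>" and d: "d \<in> T" "p \<in> fst d"
  shows "scalar_curv \<rho> p = lap (\<lambda>q. - ln (\<rho> d q)) p"
proof -
  define c where "c = (SOME c. c \<in> T \<and> p \<in> fst c)"
  have c: "c \<in> T" "p \<in> fst c" unfolding c_def
    using someI_ex[of "\<lambda>c. c \<in> T \<and> p \<in> fst c"] triv_cover by metis+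
  let ?W = "fst c \<inter> fst d"
  obtain \<tau> where \<tau>: "holomorphic_fun A ?W \<tau>" "\<And>p. p \<in> ?W \<Longrightarrow> \<tau> p \<noteq> 0"
    "\<And>e. \<pi> e \<in> ?W \<Longrightarrow> snd c e = \<tau> (\<pi> e) * snd d e"
    using transition[OF c(1) d(1)] by metis
  have "lap (\<lambda>q. - ln (\<rho> d q)) p = lap (\<lambda>q. - ln (\<rho> c q)) p"
  proof (rule lap_neg_ln_twist[OF _ _ _ _ \<tau>(1,2)])
    show "open ?W" using triv_open c d by blast
    show "p \<in> ?W" using c d by blast
    show "smooth_fun A ?W (\<rho> c)"
      by (rule smooth_fun_subset[OF preweights_smooth[OF weights_preweights[OF \<rho>] c(1)]]) simp
    show "0 < \<rho> c q" if "q \<in> ?W" for q using weights_pos[OF \<rho> c(1)] that by simp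
    show "\<rho> d q = \<rho> c q * (norm (\<tau> q))\<^sup>2" if "q \<in> ?W" for q
      by (rule preweights_transition[OF weights_preweights[OF \<rho>] c(1) d(1) \<tau>(3) that])
  qed
  then show ?thesis unfolding scalar_curv_def c_def[symmetric] by simp
qed

lemma curv_continuous:
  assumes \<rho>: "weights \<rho>" shows "continuous_on UNIV (scalar_curv \<rho>)"
proof (rule continuous_at_imp_continuous_on, rule ballI)
  fix p :: 'a
  obtain c where c: "c \<in> T" "p \<in> fst c" by (rule triv_cover)
  have "continuous_on (fst c) (lap (\<lambda>q. - ln (\<rho> c q)))"
    by (rule lap_continuous[OF triv_open[OF c(1)] weights_smooth_ln[OF \<rho> c(1)]])
  then have "continuous_on (fst c) (scalar_curv \<rho>)"
    by (rule continuous_on_eq) (simp add: curv_eq[OF \<rho> c(1)])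
  then show "isCont (scalar_curv \<rho>) p"
    using continuous_on_eq_continuous_at[OF triv_open[OF c(1)]] c(2) by blast
qed

lemma weights_twist:
  assumes \<rho>: "weights \<rho>" and \<phi>: "smooth_fun A UNIV \<phi>"
  shows "weights (\<lambda>c p. \<rho> c p * exp (- \<phi> p))" (is "weights ?\<rho>")
    and "scalar_curv (\<lambda>c p. \<rho> c p * exp (- \<phi> p)) p = scalar_curv \<rho> p + lap \<phi> p"
proof -
  note pre = weights_preweights[OF \<rho>]
  show w: "weights ?\<rho>"
    unfolding weights_def preweights_def
  proof (intro conjI ballI allI impI)
    fix c assume c: "c \<in> T"
    show "smooth_fun A (fst c) (\<lambda>p. \<rho> c p * exp (- \<phi> p))"
      using triv_open[OF c] preweights_smooth[OF pre c]
      by (intro smooth_fun_mult smooth_fun_exp smooth_fun_minus smooth_fun_subset[OF \<phi>]) auto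
  next
    fix c p assume "c \<in> T" "p \<in> fst c"
    then show "0 < \<rho> c p * exp (- \<phi> p)" using weights_pos[OF \<rho>] by simp
    then show "0 \<le> \<rho> c p * exp (- \<phi> p)" by simp
  next
    fix c d e assume "c \<in> T" "d \<in> T" "\<pi> e \<in> fst c \<inter> fst d"
    then show "\<rho> c (\<pi> e) * exp (- \<phi> (\<pi> e)) * (norm (snd c e))\<^sup>2 = \<rho> d (\<pi> e) * exp (- \<phi> (\<pi> e)) * (norm (snd d e))\<^sup>2"
      using preweights_eq[OF pre, of c d e] by simp
  qed
  obtain c where c: "c \<in> T" "p \<in> fst c" by (rule triv_cover)
  note oc = triv_open[OF c(1)]
  have "scalar_curv ?\<rho> p = lap (\<lambda>q. - ln (\<rho> c q * exp (- \<phi> q))) p" by (rule curv_eq[OF w c])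
  also have "\<dots> = lap (\<lambda>q. - ln (\<rho> c q) + \<phi> q) p"
  proof (rule lap_cong[OF oc c(2)])
    fix q assume "q \<in> fst c"
    from weights_pos[OF \<rho> c(1) this] show "- ln (\<rho> c q * exp (- \<phi> q)) = - ln (\<rho> c q) + \<phi> q"
      by (simp add: ln_mult)
  qed
  also have "\<dots> = lap (\<lambda>q. - ln (\<rho> c q)) p + lap \<phi> p"
    by (rule lap_add[OF oc c(2) weights_smooth_ln[OF \<rho> c(1)] smooth_fun_subset[OF \<phi>]]) simp
  finally show "scalar_curv ?\<rho> p = scalar_curv \<rho> p + lap \<phi> p" unfolding curv_eq[OF \<rho> c] .
qed

text \<open>The form \<open>\<rho> t(e) cnj (t(e'))\<close> is independent of the trivialization. For a nonvanishing section
  \<open>s\<close> the squared norm is \<open>\<rho> \<bar>t(s)\<bar>\<^sup>2\<close> with \<open>t(s)\<close> holomorphic, so every section yields the same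
  curvature.\<close>

lemma metric_of_weights:
  assumes \<rho>: "weights \<rho>"
  obtains h where "smooth_hermitian_bundle_metric A \<pi> T h" "is_scalar_curvature A g \<pi> T h (scalar_curv \<rho>)"
proof -
  define ch where "ch p = (SOME c. c \<in> T \<and> p \<in> fst c)" for p
  have ch: "ch p \<in> T" "p \<in> fst (ch p)" for p unfolding ch_def
    using someI_ex[of "\<lambda>c. c \<in> T \<and> p \<in> fst c"] triv_cover by metis+
  define h where "h e e' = complex_of_real (\<rho> (ch (\<pi> e)) (\<pi> e)) * snd (ch (\<pi> e)) e * cnj (snd (ch (\<pi> e)) e')" for e e'
  note pre = weights_preweights[OF \<rho>]
  have h_eq: "h e e' = complex_of_real (\<rho> d (\<pi> e)) * snd d e * cnj (snd d e')"
    if d: "d \<in> T" "\<pi> e \<in> fst d" "\<pi> e' = \<pi> e" for d e e'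
  proof -
    let ?c = "ch (\<pi> e)"
    obtain \<tau> where \<tau>: "\<And>e. \<pi> e \<in> fst ?c \<inter> fst d \<Longrightarrow> snd ?c e = \<tau> (\<pi> e) * snd d e"
      using transition[OF ch(1) d(1)] by metis
    have p: "\<pi> e \<in> fst ?c \<inter> fst d" using ch d by blast
    have "\<rho> d (\<pi> e) = \<rho> ?c (\<pi> e) * (norm (\<tau> (\<pi> e)))\<^sup>2"
      by (rule preweights_transition[OF pre ch(1) d(1) \<tau> p])
    then have "complex_of_real (\<rho> d (\<pi> e)) = complex_of_real (\<rho> ?c (\<pi> e)) * (\<tau> (\<pi> e) * cnj (\<tau> (\<pi> e)))"
      by (simp add: complex_norm_square[symmetric])
    then show ?thesis unfolding h_def using \<tau>[OF p] \<tau>[of e'] p d(3) by simp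
  qed
  have "smooth_hermitian_bundle_metric A \<pi> T h"
    unfolding smooth_hermitian_bundle_metric_def
  proof (rule ballI, clarify)
    fix U t assume Ut: "(U, t) \<in> T"
    show "\<exists>r. smooth_fun A U r \<and> (\<forall>p\<in>U. 0 < r p) \<and>
       (\<forall>e e'. \<pi> e \<in> U \<and> \<pi> e' = \<pi> e \<longrightarrow> h e e' = complex_of_real (r (\<pi> e)) * t e * cnj (t e'))"
      using preweights_smooth[OF pre Ut] weights_pos[OF \<rho> Ut] h_eq[OF Ut]
      by (intro exI[of _ "\<rho> (U, t)"]) simp
  qed
  moreover have "is_scalar_curvature A g \<pi> T h (scalar_curv \<rho>)"
    unfolding is_scalar_curvature_def
  proof (intro allI impI ballI)
    fix W s c p
    assume "open W \<and> holomorphic_section A \<pi> T W s \<and> nonvanishing_on T W s"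
    then have W: "open W" "holomorphic_section A \<pi> T W s" "nonvanishing_on T W s" by auto
    assume c: "c \<in> A" "p \<in> W \<inter> fst c"
    obtain d where d: "d \<in> T" "p \<in> fst d" by (rule triv_cover)
    let ?V = "W \<inter> fst d"
    have oV: "open ?V" and pV: "p \<in> ?V" using W triv_open[OF d(1)] c d by auto
    have hol: "holomorphic_fun A ?V (\<lambda>p. snd d (s p))" and \<pi>s: "\<And>q. q \<in> W \<Longrightarrow> \<pi> (s q) = q"
      using W(2) d(1) unfolding holomorphic_section_def by (auto simp: case_prod_unfold)
    have nz: "snd d (s q) \<noteq> 0" if "q \<in> ?V" for q
      using W(3) d(1) that unfolding nonvanishing_on_def by (auto simp: case_prod_unfold)
    have ns: "norm_sq h (s q) = \<rho> d q * (norm (snd d (s q)))\<^sup>2" if q: "q \<in> ?V" for q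
    proof -
      have "h (s q) (s q) = complex_of_real (\<rho> d q) * (snd d (s q) * cnj (snd d (s q)))"
        using h_eq[OF d(1), of "s q" "s q"] \<pi>s q by simp
      also have "\<dots> = complex_of_real (\<rho> d q * (norm (snd d (s q)))\<^sup>2)"
        by (simp flip: complex_norm_square)
      finally show ?thesis by (simp only: norm_sq_def Re_complex_of_real)
    qed
    have sd: "smooth_fun A ?V (\<rho> d)" by (rule smooth_fun_subset[OF preweights_smooth[OF pre d(1)]]) simp
    have pd: "0 < \<rho> d q" if "q \<in> ?V" for q using weights_pos[OF \<rho> d(1)] that by simp
    have "smooth_fun A ?V (\<lambda>q. - ln (\<rho> d q * (norm (snd d (s q)))\<^sup>2))"
      by (intro smooth_fun_minus smooth_fun_ln smooth_fun_mult smooth_fun_norm_sq holomorphic_fun_smooth oV sd hol)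
        (use pd nz in auto)
    then have sm: "smooth_fun A ?V (\<lambda>q. - ln (norm_sq h (s q)))"
      by (rule smooth_fun_cong[OF oV, rotated]) (simp add: ns)
    have "herm_trace (g c p) (curvature_form h s c p) = lap (\<lambda>q. - ln (norm_sq h (s q))) p"
      unfolding scalar_curvature_eq_laplacian using lap_chart[OF oV pV sm] c by simp
    also have "\<dots> = lap (\<lambda>q. - ln (\<rho> d q)) p"
      by (rule lap_neg_ln_twist[OF oV pV sd pd hol nz ns])
    also have "\<dots> = scalar_curv \<rho> p" by (rule curv_eq[OF \<rho> d, symmetric])
    finally show "scalar_curv \<rho> p = herm_trace (g c p) (curvature_form h s c p)" ..
  qed
  ultimately show ?thesis by (rule that)
qed

lemma positive_metric_if_potential:
  assumes \<rho>: "weights \<rho>" and \<phi>: "smooth_fun A UNIV \<phi>" "\<And>p. 0 < scalar_curv \<rho> p + lap \<phi> p"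
  shows "\<exists>h R. smooth_hermitian_bundle_metric A \<pi> T h \<and> is_scalar_curvature A g \<pi> T h R \<and> (\<forall>p. 0 < R p)"
proof -
  obtain h where "smooth_hermitian_bundle_metric A \<pi> T h"
    "is_scalar_curvature A g \<pi> T h (scalar_curv (\<lambda>c p. \<rho> c p * exp (- \<phi> p)))"
    by (rule metric_of_weights[OF weights_twist(1)[OF \<rho> \<phi>(1)]])
  moreover have "0 < scalar_curv (\<lambda>c p. \<rho> c p * exp (- \<phi> p)) p" for p
    unfolding weights_twist(2)[OF \<rho> \<phi>(1)] by (rule \<phi>(2))
  ultimately show ?thesis by blast
qed

end

section \<open>Positive scalar curvature\<close>

text \<open>In the compact case the trivializations adapted to \<open>D\<close> are added to the given ones, which changes
  neither the bundle nor the curvature of a metric. In the trivialization over \<open>U\<close> the canonical section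
  of \<open>[D]\<close> is the local defining function \<open>f\<close>, so its squared norm is \<open>\<bar>f\<bar>\<^sup>2\<close> times the weight.\<close>

theorem theorem2p3:
  fixes A :: "('a::{t2_space, second_countable_topology}, 'n::finite) chart set"
    and g :: "('a, 'n) tensor"
    and \<pi> :: "'e \<Rightarrow> 'a"
    and T :: "('a, 'e) triv set"
  assumes "complex_manifold A"
    and "connected (UNIV :: 'a set)"
    and "hermitian_metric A g"
    and "holomorphic_line_bundle A \<pi> T"
    and "\<not> compact (UNIV :: 'a set) \<or>
         (\<exists>D. effective_divisor A D \<and> nontrivial_divisor D \<and> is_bundle_of_divisor A \<pi> T D)"
  shows "\<exists>h R. smooth_hermitian_bundle_metric A \<pi> T h \<and>
               is_scalar_curvature A g \<pi> T h R \<and>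
               (\<forall>p. 0 < R p)"
proof (cases "compact (UNIV :: 'a set)")
  case False
  interpret line_bundle A g \<pi> T by unfold_locales (rule assms)+
  obtain \<rho> where \<rho>: "weights \<rho>" by (rule weights_exist)
  have "continuous_on UNIV (\<lambda>p. - scalar_curv \<rho> p)" by (intro continuous_intros curv_continuous \<rho>)
  then obtain \<phi> where \<phi>: "smooth_fun A UNIV \<phi>" "\<And>p. - scalar_curv \<rho> p < lap \<phi> p"
    using noncompact_potential[OF assms(2) False] by metis
  have "0 < scalar_curv \<rho> p + lap \<phi> p" for p using \<phi>(2)[of p] by simp
  then show ?thesis by (rule positive_metric_if_potential[OF \<rho> \<phi>(1)])
next
  case True
  then obtain D where D: "effective_divisor A D" "nontrivial_divisor D" "is_bundle_of_divisor A \<pi> T D"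
    using assms(5) by blast
  obtain F where F: "holomorphic_line_bundle A \<pi> (T \<union> (\<lambda>(U, f). (U, F (U, f))) ` D)"
    "\<forall>(U, f)\<in>D. \<forall>(V, k)\<in>D. \<exists>\<tau>. holomorphic_fun A (U \<inter> V) \<tau> \<and>
           (\<forall>p\<in>U \<inter> V. \<tau> p \<noteq> 0 \<and> f p = \<tau> p * k p) \<and>
           (\<forall>e. \<pi> e \<in> U \<inter> V \<longrightarrow> F (U, f) e = \<tau> (\<pi> e) * F (V, k) e)"
    using D(3) unfolding is_bundle_of_divisor_def by (elim exE conjE)
  define T' where "T' = T \<union> (\<lambda>(U, f). (U, F (U, f))) ` D"
  define G where "G d = (fst d, F d)" for d
  interpret T: line_bundle A g \<pi> T by unfold_locales (rule assms)+
  interpret L: line_bundle A g \<pi> T' by unfold_locales (simp add: T'_def F(1))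
  have GT: "G d \<in> T'" if "d \<in> D" for d using that by (force simp: T'_def G_def case_prod_unfold)
  have fstG: "fst (G d) = fst d" "snd (G d) = F d" for d by (simp_all add: G_def)
  obtain \<rho> where \<rho>: "L.weights \<rho>" by (rule L.weights_exist)
  note pre = L.weights_preweights[OF \<rho>]
  have \<rho>T: "T.weights \<rho>"
  proof -
    have "T \<subseteq> T'" by (simp add: T'_def)
    then show ?thesis
      using \<rho> unfolding L.weights_def T.weights_def L.preweights_def T.preweights_def by (meson subsetD)
  qed
  have dcover: "\<exists>d\<in>D. p \<in> fst d" for p
  proof -
    have "(\<Union>(U, f)\<in>D. U) = UNIV" using D(1) unfolding effective_divisor_def by (elim conjE)
    then have "p \<in> (\<Union>(U, f)\<in>D. U)" by simp
    then show ?thesis by (auto intro!: bexI)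
  qed
  have "\<forall>(U, f)\<in>D. open U \<and> holomorphic_fun A U f \<and> (\<forall>V. open V \<and> V \<noteq> {} \<and> V \<subseteq> U \<longrightarrow> (\<exists>p\<in>V. f p \<noteq> 0))"
    using D(1) unfolding effective_divisor_def by (elim conjE)
  then have Dd: "open (fst d)" "holomorphic_fun A (fst d) (snd d)"
    "\<And>V. open V \<Longrightarrow> V \<noteq> {} \<Longrightarrow> V \<subseteq> fst d \<Longrightarrow> \<exists>p\<in>V. snd d p \<noteq> 0" if "d \<in> D" for d
    using that by (auto simp: case_prod_unfold)
  define s where "s d p = (norm (snd d p))\<^sup>2 * \<rho> (G d) p" for d p
  have s_eq: "s d p = s d' p" if d: "d \<in> D" "d' \<in> D" "p \<in> fst d" "p \<in> fst d'" for d d' p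
  proof -
    obtain \<tau> where \<tau>: "\<forall>p\<in>fst d \<inter> fst d'. \<tau> p \<noteq> 0 \<and> snd d p = \<tau> p * snd d' p"
      "\<forall>e. \<pi> e \<in> fst d \<inter> fst d' \<longrightarrow> F d e = \<tau> (\<pi> e) * F d' e"
      using bspec[OF bspec[OF F(2) d(1), unfolded case_prod_unfold] d(2)] by (auto simp: case_prod_unfold)
    have "\<rho> (G d') p = \<rho> (G d) p * (norm (\<tau> p))\<^sup>2"
      by (rule L.preweights_transition[OF pre GT[OF d(1)] GT[OF d(2)]]) (use \<tau>(2) d in \<open>auto simp: fstG\<close>)
    then show ?thesis using \<tau>(1) d by (simp add: s_def norm_mult power_mult_distrib)
  qed
  define S where "S p = s (SOME d. d \<in> D \<and> p \<in> fst d) p" for p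
  have S_eq: "S p = s d p" if "d \<in> D" "p \<in> fst d" for d p
  proof -
    have "(SOME d. d \<in> D \<and> p \<in> fst d) \<in> D \<and> p \<in> fst (SOME d. d \<in> D \<and> p \<in> fst d)"
      by (rule someI_ex) (use that in blast)
    then show ?thesis unfolding S_def using s_eq that by blast
  qed
  have \<rho>pos: "0 < \<rho> (G d) p" if "d \<in> D" "p \<in> fst d" for d p
    using L.weights_pos[OF \<rho> GT[OF that(1)]] that(2) by (simp add: fstG)
  have \<rho>smooth: "smooth_fun A (fst d) (\<rho> (G d))" if "d \<in> D" for d
    using L.preweights_smooth[OF pre GT[OF that]] by (simp add: fstG)
  have Ssmooth: "smooth_fun A UNIV S"
  proof (rule T.smooth_fun_local)
    fix p :: 'a
    obtain d where d: "d \<in> D" "p \<in> fst d" using dcover by blast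
    have "smooth_fun A (fst d) (\<lambda>p. (norm (snd d p))\<^sup>2 * \<rho> (G d) p)"
      by (intro T.smooth_fun_mult T.smooth_fun_norm_sq T.holomorphic_fun_smooth Dd \<rho>smooth d)
    then have "smooth_fun A (fst d) S"
      by (rule T.smooth_fun_cong[OF Dd(1)[OF d(1)], rotated]) (simp add: S_eq[OF d(1)] s_def)
    then show "\<exists>N. open N \<and> p \<in> N \<and> smooth_fun A N S" using Dd(1)[OF d(1)] d(2) by (intro exI[of _ "fst d"]) simp
  qed
  have S0: "0 \<le> S p" for p
  proof -
    obtain d where d: "d \<in> D" "p \<in> fst d" using dcover by blast
    show ?thesis using \<rho>pos[OF d] by (simp add: S_eq[OF d] s_def)
  qed
  have lapS: "T.lap (\<lambda>q. - ln (S q)) p = L.scalar_curv \<rho> p" if Sp: "0 < S p" for p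
  proof -
    obtain d where d: "d \<in> D" "p \<in> fst d" using dcover by blast
    define W where "W = fst d \<inter> {q. 0 < S q}"
    have oW: "open W" unfolding W_def
      using T.smooth_fun_continuous[OF open_UNIV Ssmooth] Dd(1)[OF d(1)]
      by (intro open_Int open_Collect_less continuous_on_const)
    have "T.lap (\<lambda>q. - ln (S q)) p = T.lap (\<lambda>q. - ln (\<rho> (G d) q)) p"
    proof (rule T.lap_neg_ln_twist[OF oW, where f = "snd d"])
      show "p \<in> W" using d Sp by (simp add: W_def)
      show "smooth_fun A W (\<rho> (G d))" by (rule T.smooth_fun_subset[OF \<rho>smooth[OF d(1)]]) (simp add: W_def)
      show "holomorphic_fun A W (snd d)" by (rule T.holomorphic_fun_subset[OF Dd(2)[OF d(1)]]) (simp add: W_def)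
      show "0 < \<rho> (G d) q" if "q \<in> W" for q using \<rho>pos[OF d(1)] that by (simp add: W_def)
      show "snd d q \<noteq> 0" if "q \<in> W" for q using that S_eq[OF d(1), of q] by (auto simp: W_def s_def)
      show "S q = \<rho> (G d) q * (norm (snd d q))\<^sup>2" if "q \<in> W" for q
        using that S_eq[OF d(1), of q] by (simp add: W_def s_def)
    qed
    also have "\<dots> = L.scalar_curv \<rho> p" using L.curv_eq[OF \<rho> GT[OF d(1)]] d(2) by (simp add: fstG)
    finally show ?thesis .
  qed
  obtain d0 p0 where p0: "d0 \<in> D" "p0 \<in> fst d0" "snd d0 p0 = 0"
    using D(2) unfolding nontrivial_divisor_def by (auto simp: case_prod_unfold)
  have Sp0: "S p0 = 0" using S_eq[OF p0(1,2)] p0(3) by (simp add: s_def)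
  obtain q0 where q0: "q0 \<in> fst d0" "snd d0 q0 \<noteq> 0" using Dd(3)[OF p0(1) Dd(1)[OF p0(1)]] p0(2) by blast
  have Sq0: "0 < S q0" using S_eq[OF p0(1) q0(1)] q0(2) \<rho>pos[OF p0(1) q0(1)] by (simp add: s_def)
  obtain \<phi> where \<phi>: "smooth_fun A UNIV \<phi>" "\<And>p. 0 < L.scalar_curv \<rho> p + T.lap \<phi> p"
    using T.compact_potential[OF True assms(2) Ssmooth S0 L.curv_continuous[OF \<rho>] lapS Sp0 Sq0] by metis
  have "T.scalar_curv \<rho> p = L.scalar_curv \<rho> p" for p
  proof -
    obtain c where c: "c \<in> T" "p \<in> fst c" by (rule T.triv_cover)
    then have "c \<in> T'" by (simp add: T'_def)
    then show ?thesis using T.curv_eq[OF \<rho>T c] L.curv_eq[OF \<rho> _ c(2)] by simp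
  qed
  then have "0 < T.scalar_curv \<rho> p + T.lap \<phi> p" for p using \<phi>(2)[of p] by simp
  then show ?thesis by (rule T.positive_metric_if_potential[OF \<rho>T \<phi>(1)])
qed

end
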